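(* Let $D=(V,A)$ be a 2-strong semicomplete multipartite digraph such that $\alpha(D)\leq 2$ and $|V|\geq 5+5\alpha(D)$. Let $x,y\in V$ be different vertices of $D$ such that neither $x$ nor $y$ is contained in a 2-cycle, $y\Rightarrow x$, and both $D-x$ and $D-y$ are 2-strong. If all 2-separators of $x$ and $y$ (if any) are trivial, then $D$ contains an $(x,y)$-quasi-Hamiltonian path.
   Context: All digraphs are finite and simple: no loops and no parallel arcs, but both arcs $vw$ and $wv$ may be present (they then form a 2-cycle). A semicomplete multipartite digraph is a digraph $D$ whose vertex set is partitioned into color classes $V_1,\dots,V_c$ such that, for every pair of distinct vertices, there is at least one arc between them if and only if they lie in different color classes; this partition is unique. The independence number $\alpha(D)$ is that of the underlying undirected graph; here $\alpha(D)=\max_i|V_i|$. An $(x,y)$-path is a directed path starting at $x$ and ending at $y$. An $(x,y)$-quasi-Hamiltonian path in $D$ is an $(x,y)$-path containing at least one vertex from each color class of $D$. A digraph is strong if it contains an $(u,v)$-path for every pair of distinct vertices $u,v$. A digraph is $k$-strong if it has at least $k+1$ vertices, is strong, and remains strong after removing any set of at most $k-1$ vertices. $y\Rightarrow x$ means that there is no arc from $x$ to $y$, i.e. $xy\notin A$. A 2-separator of $x$ and $y$ is a set $X\subseteq V$ with $|X|\leq 2$ such that there is no $(x,y)$-path in $D-X$. A 2-separator $X$ of $x$ and $y$ is trivial if $N^+(x)\subseteq X$ or $N^-(y)\subseteq X$, where $N^+$ and $N^-$ denote out- and in-neighborhoods in $D$. *)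

theory Defs
  imports "Graph_Theory.Graph_Theory" "HOL-Library.Disjoint_Sets"
begin

locale semicomplete_multipartite_digraph = digraph D
  for D :: "('a, 'b) pre_digraph" +
  fixes color_classes :: "'a set set"
  assumes partition: "partition_on (verts D) color_classes"
    and adjacent_iff:
      "\<lbrakk>u \<in> verts D; v \<in> verts D; u \<noteq> v\<rbrakk> \<Longrightarrow>
        (u \<rightarrow>\<^bsub>D\<^esub> v \<or> v \<rightarrow>\<^bsub>D\<^esub> u) \<longleftrightarrow> \<not> (\<exists>C \<in> color_classes. u \<in> C \<and> v \<in> C)"

text \<open>The color classes are a parameter of the locale, but they are determined by the digraph.\<close>

lemma color_classes_unique:
  assumes "semicomplete_multipartite_digraph D P" "semicomplete_multipartite_digraph D Q"
  shows "P = Q"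
proof -
  have *: "P \<subseteq> Q" if "semicomplete_multipartite_digraph D P" "semicomplete_multipartite_digraph D Q"
    for P Q
  proof
    interpret p: semicomplete_multipartite_digraph D P by fact
    interpret q: semicomplete_multipartite_digraph D Q by fact
    have same: "(\<exists>C\<in>P. u \<in> C \<and> v \<in> C) \<longleftrightarrow> (\<exists>C\<in>Q. u \<in> C \<and> v \<in> C)"
      if "u \<in> verts D" "v \<in> verts D" for u v
    proof (cases "u = v")
      case True
      then show ?thesis
        using that partition_onD1[OF p.partition] partition_onD1[OF q.partition] by blast
    next
      case False
      then show ?thesis using p.adjacent_iff[OF that] q.adjacent_iff[OF that] by blast
    qed
    fix C assume C: "C \<in> P"
    then obtain u where u: "u \<in> C" using partition_onD3[OF p.partition] by fastforce
    have uV: "u \<in> verts D" using u C partition_onD1[OF p.partition] by blast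
    then obtain C' where C': "C' \<in> Q" "u \<in> C'" using partition_onD1[OF q.partition] by blast
    have "v \<in> C \<longleftrightarrow> v \<in> C'" for v
    proof (cases "v \<in> verts D")
      case True
      have "v \<in> C \<longleftrightarrow> (\<exists>C\<in>P. u \<in> C \<and> v \<in> C)"
        using C u partition_onD2[OF p.partition] by (auto dest: disjointD)
      moreover have "v \<in> C' \<longleftrightarrow> (\<exists>C\<in>Q. u \<in> C \<and> v \<in> C)"
        using C' partition_onD2[OF q.partition] by (auto dest: disjointD)
      ultimately show ?thesis using same[OF uV True] by simp
    next
      case False
      then show ?thesis
        using C C' partition_onD1[OF p.partition] partition_onD1[OF q.partition] by blast
    qed
    then show "C \<in> Q" using C'(1) by (metis set_eqI)
  qed
  show ?thesis using *[OF assms] *[OF assms(2,1)] by (rule subset_antisym)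
qed

definition independent_set :: "('a, 'b) pre_digraph \<Rightarrow> 'a set \<Rightarrow> bool" where
  "independent_set D S \<longleftrightarrow> S \<subseteq> verts D \<and> (\<forall>u\<in>S. \<forall>v\<in>S. u \<noteq> v \<longrightarrow> \<not> u \<rightarrow>\<^bsub>D\<^esub> v)"

definition independence_number :: "('a, 'b) pre_digraph \<Rightarrow> nat" where
  "independence_number D = Max (card ` {S. independent_set D S})"

definition delete_verts :: "('a, 'b) pre_digraph \<Rightarrow> 'a set \<Rightarrow> ('a, 'b) pre_digraph" where
  "delete_verts D X = D \<restriction> (verts D - X)"

definition k_strong :: "nat \<Rightarrow> ('a, 'b) pre_digraph \<Rightarrow> bool" where
  "k_strong k D \<longleftrightarrow> card (verts D) \<ge> k + 1 \<and> strongly_connected D \<and>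
    (\<forall>X \<subseteq> verts D. card X \<le> k - 1 \<longrightarrow> strongly_connected (delete_verts D X))"

definition in_2_cycle :: "('a, 'b) pre_digraph \<Rightarrow> 'a \<Rightarrow> bool" where
  "in_2_cycle D v \<longleftrightarrow> (\<exists>w. v \<rightarrow>\<^bsub>D\<^esub> w \<and> w \<rightarrow>\<^bsub>D\<^esub> v)"

definition out_nbhd :: "('a, 'b) pre_digraph \<Rightarrow> 'a \<Rightarrow> 'a set" where
  "out_nbhd D v = {w. v \<rightarrow>\<^bsub>D\<^esub> w}"

definition in_nbhd :: "('a, 'b) pre_digraph \<Rightarrow> 'a \<Rightarrow> 'a set" where
  "in_nbhd D v = {w. w \<rightarrow>\<^bsub>D\<^esub> v}"

text \<open>A separator of \<open>x\<close> and \<open>y\<close> avoids both vertices. Otherwise \<open>{x}\<close> would always be a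
  2-separator, and in a 2-strong digraph without an arc from \<open>x\<close> to \<open>y\<close> it is never trivial.\<close>

definition two_separator :: "('a, 'b) pre_digraph \<Rightarrow> 'a \<Rightarrow> 'a \<Rightarrow> 'a set \<Rightarrow> bool" where
  "two_separator D x y X \<longleftrightarrow> X \<subseteq> verts D - {x, y} \<and> card X \<le> 2 \<and>
    \<not> (\<exists>p. pre_digraph.apath (delete_verts D X) x p y)"

definition trivial_two_separator :: "('a, 'b) pre_digraph \<Rightarrow> 'a \<Rightarrow> 'a \<Rightarrow> 'a set \<Rightarrow> bool" where
  "trivial_two_separator D x y X \<longleftrightarrow>
    two_separator D x y X \<and> (out_nbhd D x \<subseteq> X \<or> in_nbhd D y \<subseteq> X)"

definition (in semicomplete_multipartite_digraph) quasi_hamiltonian_path ::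
    "'a \<Rightarrow> 'b awalk \<Rightarrow> 'a \<Rightarrow> bool" where
  "quasi_hamiltonian_path x p y \<longleftrightarrow>
    apath x p y \<and> (\<forall>C \<in> color_classes. \<exists>v \<in> C. v \<in> set (awalk_verts x p))"

end

theory Submission
  imports Defs
begin

text \<open>Call an ordering of distinct vertices from \<open>x\<close> to \<open>y\<close> bipolar if every vertex except
  the first has an in-neighbour before it and every vertex except the last has an out-neighbour
  after it. Since the colour classes have at most two vertices, the set of a bipolar ordering
  contains a path from its first to its last vertex that meets the same colour classes, by
  induction on the length of the ordering. It remains to find a bipolar ordering that meets all
  colour classes.

  Let \<open>H = V - {x, y}\<close>, \<open>S = N\<^sup>+(x)\<close> and \<open>T = N\<^sup>-(y)\<close>; both
  have at least two elements. A trivial separator can be destroyed by placing a vertex of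
  \<open>S - T\<close> directly after \<open>x\<close> when \<open>card S = 2\<close>, and a vertex of
  \<open>T - S\<close> directly before \<open>y\<close> when \<open>card T = 2\<close>, as long as there is
  no arc from the first to the second. Menger's theorem then gives three disjoint paths, and
  these can be merged with paths through the remaining vertices. Otherwise there are two disjoint
  paths (rails) with at most two vertices each from \<open>S\<close> to \<open>T\<close> in \<open>H\<close>. They
  leave so many colour classes that a path or a cycle through the rest of \<open>H\<close>, merged with
  the rails, is bipolar; the lower bound on \<open>card V\<close> is essential only in the case
  \<open>S = T\<close>.\<close>

text \<open>Vertices of one colour class are not adjacent, so a path through a remainder cannot
  simply be merged with given disjoint paths into a single path. A bipolar ordering asks for much
  less: disjoint paths from \<open>S\<close> to \<open>T\<close> may be concatenated in any order,
  and a further path only needs support at its two ends. With three paths that support is always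
  available after small repairs, because a vertex has at most one classmate and so has an arc to or
  from at least two of the three. With two rails one obstruction survives: around a cycle through
  the remainder, the vertices whose classes the rails miss are alternately entered from one rail and
  left to the other. This forces both rails to be single vertices and \<open>S = T\<close>.
  Alternation makes the number of such vertices on the cycle even, and an exchange argument bounds
  it by 5, hence by 4; so five missed classes suffice. The bound on \<open>card V\<close> is what
  guarantees them: \<open>x\<close>, \<open>y\<close> and the classes of two rail vertices account
  for at most \<open>2 + 2 * k\<close> vertices, \<open>k\<close> being the independence number, and
  the remaining \<open>3 + 3 * k\<close> or more vertices meet at least five classes when
  \<open>k \<le> 2\<close>.\<close>

section \<open>Paths as vertex lists and reachability inside a vertex set\<close>

definition dipath :: "('a \<Rightarrow> 'a \<Rightarrow> bool) \<Rightarrow> 'a set \<Rightarrow> 'a list \<Rightarrow> bool" where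
  "dipath E U p \<longleftrightarrow> p \<noteq> [] \<and> distinct p \<and> set p \<subseteq> U \<and> successively E p"

definition reach :: "('a \<Rightarrow> 'a \<Rightarrow> bool) \<Rightarrow> 'a set \<Rightarrow> 'a \<Rightarrow> 'a \<Rightarrow> bool" where
  "reach E U u v \<longleftrightarrow> (\<exists>p. dipath E U p \<and> hd p = u \<and> last p = v)"

text \<open>Reversing all arcs is swapping the arguments of the relation. Since paths refer to a
  bare relation, many dual statements below are instances of their counterparts.\<close>

lemma dipath_rev: "dipath (\<lambda>u v. E v u) U (rev p) \<longleftrightarrow> dipath E U p"
  by (simp add: dipath_def)

lemma dipath_rev_ex:
  assumes "dipath (\<lambda>u v. E v u) U p"
  shows "dipath E U (rev p)" "hd (rev p) = last p" "last (rev p) = hd p"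
  using assms by (auto simp: dipath_def hd_rev last_rev)

lemma dipath_mono: "dipath E U p \<Longrightarrow> U \<subseteq> U' \<Longrightarrow> dipath E U' p"
  by (auto simp: dipath_def)

lemma dipath_append:
  "p \<noteq> [] \<Longrightarrow> q \<noteq> [] \<Longrightarrow> dipath E U (p @ q) \<longleftrightarrow>
    dipath E U p \<and> dipath E U q \<and> set p \<inter> set q = {} \<and> E (last p) (hd q)"
  by (auto simp: dipath_def successively_append_iff)

lemma dipath_single: "dipath E U [v] \<longleftrightarrow> v \<in> U"
  by (auto simp: dipath_def)

lemma walk_imp_dipath:
  assumes "p \<noteq> []" "successively E p" "set p \<subseteq> U"
  obtains q where "dipath E U q" "hd q = hd p" "last q = last p" "set q \<subseteq> set p"
proof -
  have "\<exists>q. dipath E U q \<and> hd q = hd p \<and> last q = last p \<and> set q \<subseteq> set p"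
    using assms
  proof (induction "length p" arbitrary: p rule: less_induct)
    case less
    show ?case
    proof (cases "distinct p")
      case True
      then show ?thesis using less.prems by (auto simp: dipath_def)
    next
      case False
      then obtain xs ys zs y where p: "p = xs @ [y] @ ys @ [y] @ zs"
        using not_distinct_decomp by blast
      let ?p = "xs @ [y] @ zs"
      have "successively E ?p" using less.prems(2) unfolding p
        by (auto simp: successively_append_iff successively_Cons split: if_splits)
      moreover have "length ?p < length p" "?p \<noteq> []" "set ?p \<subseteq> U" using less.prems by (auto simp: p)
      ultimately obtain q where q: "dipath E U q" "hd q = hd ?p" "last q = last ?p" "set q \<subseteq> set ?p"
        using less.hyps by blast
      moreover have "hd ?p = hd p" by (cases xs) (auto simp: p)
      moreover have "last ?p = last p" by (auto simp: p)
      moreover have "set ?p \<subseteq> set p" by (auto simp: p)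
      ultimately show ?thesis by (metis subset_trans)
    qed
  qed
  then show ?thesis using that by blast
qed

lemma reachI_walk: "p \<noteq> [] \<Longrightarrow> successively E p \<Longrightarrow> set p \<subseteq> U \<Longrightarrow> reach E U (hd p) (last p)"
  by (metis reach_def walk_imp_dipath)

lemma reach_refl: "v \<in> U \<Longrightarrow> reach E U v v"
  unfolding reach_def by (rule exI[of _ "[v]"]) (simp add: dipath_single)

lemma reach_in: "reach E U u v \<Longrightarrow> u \<in> U \<and> v \<in> U"
  by (auto simp: reach_def dipath_def)

lemma reach_arc: "u \<in> U \<Longrightarrow> v \<in> U \<Longrightarrow> E u v \<Longrightarrow> reach E U u v"
  using reachI_walk[of "[u,v]" E U] by auto

lemma reach_trans:
  assumes "reach E U u v" "reach E U v w"
  shows "reach E U u w"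
proof -
  obtain p q where p: "dipath E U p" "hd p = u" "last p = v"
    and q: "dipath E U q" "hd q = v" "last q = w"
    using assms by (auto simp: reach_def)
  have "successively E (p @ tl q)"
    using p q by (cases q) (auto simp: dipath_def successively_append_iff successively_Cons)
  moreover have "p @ tl q \<noteq> []" "set (p @ tl q) \<subseteq> U" using p q by (cases q; auto simp: dipath_def)+
  ultimately have "reach E U (hd (p @ tl q)) (last (p @ tl q))" by (intro reachI_walk)
  moreover have "hd (p @ tl q) = u" "last (p @ tl q) = w"
    using p q by (cases q; auto simp: dipath_def)+
  ultimately show ?thesis by simp
qed

lemma reach_converse: "reach (\<lambda>u v. E v u) U u v \<longleftrightarrow> reach E U v u"
proof -
  have *: "reach E U v u" if "reach (\<lambda>u v. E v u) U u v" for E :: "'a \<Rightarrow> 'a \<Rightarrow> bool" and u v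
    using that dipath_rev_ex[of E U] unfolding reach_def by blast
  show ?thesis using *[of E u v] *[of "\<lambda>u v. E v u" v u] by blast
qed

text \<open>Cut \<open>p\<close> after its last vertex in \<open>A\<close>. This is how a path is
  rerouted once it has touched given paths for the last time.\<close>

lemma dipath_last_exit:
  assumes p: "dipath E U p" and hit: "set p \<inter> A \<noteq> {}" and last: "last p \<notin> A"
  obtains c q where "c \<in> A" "c \<in> U" "dipath E (U - A) q" "E c (hd q)" "last q = last p" "set q \<subseteq> set p"
proof -
  have "\<exists>x\<in>set p. x \<in> A" using hit by auto
  from split_list_last_prop[OF this] obtain as c q
    where s: "p = as @ c # q" "c \<in> A" "\<forall>z\<in>set q. z \<notin> A" by blast
  have "q \<noteq> []" using last s by auto
  then have "dipath E (U - A) q" "E c (hd q)" "last q = last p" "c \<in> U"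
    using p s by (auto simp: dipath_def successively_append_iff successively_Cons)
  then show ?thesis using that[of c q] s by auto
qed

lemma dipath_first_entry:
  assumes p: "dipath E U p" and hit: "set p \<inter> A \<noteq> {}" and hd: "hd p \<notin> A"
  obtains c q where "c \<in> A" "c \<in> U" "dipath E (U - A) q" "E (last q) c" "hd q = hd p" "set q \<subseteq> set p"
proof -
  have "dipath (\<lambda>u v. E v u) U (rev p)" using p by (simp add: dipath_rev)
  moreover have "set (rev p) \<inter> A \<noteq> {}" "last (rev p) \<notin> A" using hit hd by (auto simp: last_rev)
  ultimately obtain c q where "c \<in> A" "c \<in> U" "dipath (\<lambda>u v. E v u) (U - A) q" "E (hd q) c"
    "last q = last (rev p)" "set q \<subseteq> set (rev p)"
    by (rule dipath_last_exit)
  then show ?thesis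
    using that[of c "rev q"] dipath_rev_ex[of E "U - A" q] by (auto simp: last_rev)
qed

section \<open>Menger's theorem\<close>

definition separates :: "('a \<Rightarrow> 'a \<Rightarrow> bool) \<Rightarrow> 'a set \<Rightarrow> 'a set \<Rightarrow> 'a set \<Rightarrow> 'a set \<Rightarrow> bool" where
  "separates E U A B X \<longleftrightarrow> X \<subseteq> U \<and> (\<forall>p. dipath E U p \<longrightarrow> hd p \<in> A \<longrightarrow> last p \<in> B \<longrightarrow> set p \<inter> X \<noteq> {})"

text \<open>Disjoint nonempty paths have distinct last vertices, so indexing the family by vertices
  costs no generality; it lets a family be renamed by its own end vertices without leaving the
  definition.\<close>

definition linked :: "('a \<Rightarrow> 'a \<Rightarrow> bool) \<Rightarrow> 'a set \<Rightarrow> 'a set \<Rightarrow> 'a set \<Rightarrow> nat \<Rightarrow> bool" where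
  "linked E U A B k \<longleftrightarrow> (\<exists>I f. finite (I :: 'a set) \<and> card I = k \<and>
    (\<forall>i\<in>I. dipath E U (f i) \<and> hd (f i) \<in> A \<and> last (f i) \<in> B) \<and>
    (\<forall>i\<in>I. \<forall>j\<in>I. i \<noteq> j \<longrightarrow> set (f i) \<inter> set (f j) = {}))"

lemma linked_converse:
  fixes E :: "'a \<Rightarrow> 'a \<Rightarrow> bool"
  shows "linked (\<lambda>u v. E v u) U B A k \<longleftrightarrow> linked E U A B k"
proof -
  have *: "linked E U A B k" if l: "linked (\<lambda>u v. E v u) U B A k" for E :: "'a \<Rightarrow> 'a \<Rightarrow> bool" and A B
  proof -
    from l obtain I :: "'a set" and f where If: "finite I" "card I = k"
       "\<forall>i\<in>I. dipath (\<lambda>u v. E v u) U (f i) \<and> hd (f i) \<in> B \<and> last (f i) \<in> A"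
       "\<forall>i\<in>I. \<forall>j\<in>I. i \<noteq> j \<longrightarrow> set (f i) \<inter> set (f j) = {}"
      unfolding linked_def by blast
    have "dipath E U (rev (f i))" "hd (rev (f i)) \<in> A" "last (rev (f i)) \<in> B" if "i \<in> I" for i
      using If(3) that dipath_rev_ex[of E U "f i"] by auto
    then show ?thesis unfolding linked_def
      by (intro exI[of _ I] exI[of _ "\<lambda>i. rev (f i)"]) (use If in simp)
  qed
  show ?thesis using *[where E = E and A = A and B = B] *[where E = "\<lambda>u v. E v u" and A = B and B = A] by blast

qed

lemma linked_card_le:
  fixes E :: "'a \<Rightarrow> 'a \<Rightarrow> bool"
  assumes "linked E U A B k" "finite B"
  shows "k \<le> card B"
proof -
  obtain I :: "'a set" and f where I: "finite I" "card I = k"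
    "\<And>i. i \<in> I \<Longrightarrow> dipath E U (f i) \<and> last (f i) \<in> B"
    "\<And>i j. i \<in> I \<Longrightarrow> j \<in> I \<Longrightarrow> i \<noteq> j \<Longrightarrow> set (f i) \<inter> set (f j) = {}"
    using assms(1) unfolding linked_def by blast
  have "last (f i) \<in> set (f i)" if "i \<in> I" for i
    using I(3)[OF that] by (auto simp: dipath_def)
  then have "inj_on (\<lambda>i. last (f i)) I"
    using I(4) by (intro inj_onI) (metis disjoint_iff)
  then show ?thesis
    using card_inj_on_le[of "\<lambda>i. last (f i)" I B] I assms(2) by auto
qed

text \<open>\<open>card B\<close> disjoint paths into \<open>B\<close> use every vertex of
  \<open>B\<close> as an end, so they can be indexed by it. Disjointness then keeps each path from
  meeting \<open>B\<close> before its end.\<close>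

lemma linked_index_last:
  fixes E :: "'a \<Rightarrow> 'a \<Rightarrow> bool"
  assumes "linked E U A B (card B)" "finite B"
  shows "\<exists>f. (\<forall>b\<in>B. dipath E U (f b) \<and> hd (f b) \<in> A \<and> last (f b) = b) \<and>
    (\<forall>b\<in>B. \<forall>c\<in>B. b \<noteq> c \<longrightarrow> set (f b) \<inter> set (f c) = {}) \<and>
    (\<forall>b\<in>B. \<forall>c\<in>B. c \<in> set (f b) \<longrightarrow> c = b)"
proof -
  from assms(1) obtain I :: "'a set" and g where I: "finite I" "card I = card B"
    "\<And>i. i \<in> I \<Longrightarrow> dipath E U (g i) \<and> hd (g i) \<in> A \<and> last (g i) \<in> B"
    "\<And>i j. i \<in> I \<Longrightarrow> j \<in> I \<Longrightarrow> i \<noteq> j \<Longrightarrow> set (g i) \<inter> set (g j) = {}"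
    unfolding linked_def by blast
  have inset: "last (g i) \<in> set (g i)" if "i \<in> I" for i
    using I(3)[OF that] by (auto simp: dipath_def)
  have inj: "inj_on (\<lambda>i. last (g i)) I"
    using I(4) inset by (intro inj_onI) (metis disjoint_iff)
  have "(\<lambda>i. last (g i)) ` I = B"
    using I inj assms(2) by (intro card_subset_eq) (auto simp: card_image)
  then have bij: "bij_betw (\<lambda>i. last (g i)) I B" using inj by (simp add: bij_betw_def)
  define h where "h = inv_into I (\<lambda>i. last (g i))"
  have h: "h b \<in> I" "last (g (h b)) = b" if "b \<in> B" for b
    using bij that unfolding h_def bij_betw_def
    by (metis inv_into_into, metis f_inv_into_f)
  have 1: "set (g (h b)) \<inter> set (g (h c)) = {}" if "b \<in> B" "c \<in> B" "b \<noteq> c" for b c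
    using I(4)[of "h b" "h c"] h that by metis
  have 2: "c = b" if "b \<in> B" "c \<in> B" "c \<in> set (g (h b))" for b c
    using 1[OF that(1,2)] that h inset[OF h(1), of c] by (metis disjoint_iff)
  show ?thesis using 1 2 h I(3) by (intro exI[of _ "\<lambda>b. g (h b)"]) blast
qed

lemma linked_mono:
  fixes E :: "'a \<Rightarrow> 'a \<Rightarrow> bool"
  assumes "linked E U A B k" "\<And>u v. E u v \<Longrightarrow> E' u v"
  shows "linked E' U A B k"
proof -
  have "dipath E' U p" if "dipath E U p" for p
    using that assms(2) unfolding dipath_def by (blast intro: successively_mono)
  moreover obtain I :: "'a set" and f where "finite I" "card I = k"
    "\<forall>i\<in>I. dipath E U (f i) \<and> hd (f i) \<in> A \<and> last (f i) \<in> B"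
    "\<forall>i\<in>I. \<forall>j\<in>I. i \<noteq> j \<longrightarrow> set (f i) \<inter> set (f j) = {}"
    using assms(1) unfolding linked_def by blast
  ultimately show ?thesis unfolding linked_def by (intro exI[of _ I] exI[of _ f]) simp
qed

text \<open>The gluing step of Menger's theorem, applied with \<open>E'\<close> as \<open>E\<close>
  without the arc from \<open>x\<close> to \<open>y\<close>. The paths into
  \<open>insert x X0\<close> and those out of \<open>insert y X0\<close> meet only in common ends,
  since any other meeting would yield a walk around the separator \<open>X0\<close>.\<close>

lemma linked_combine:
  assumes fin: "finite X0" "x \<notin> X0" "y \<notin> X0" and xy: "E x y" "x \<noteq> y"
    and sep: "separates E' U A B X0" and sub: "\<And>u v. E' u v \<Longrightarrow> E u v"
    and f: "\<And>b. b \<in> insert x X0 \<Longrightarrow> dipath E' U (f b)" "\<And>b. b \<in> insert x X0 \<Longrightarrow> hd (f b) \<in> A"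
    "\<And>b. b \<in> insert x X0 \<Longrightarrow> last (f b) = b"
    "\<And>b c. b \<in> insert x X0 \<Longrightarrow> c \<in> insert x X0 \<Longrightarrow> b \<noteq> c \<Longrightarrow> set (f b) \<inter> set (f c) = {}"
    "\<And>b c. b \<in> insert x X0 \<Longrightarrow> c \<in> insert x X0 \<Longrightarrow> c \<in> set (f b) \<Longrightarrow> c = b"
    and g: "\<And>b. b \<in> insert y X0 \<Longrightarrow> dipath E' U (g b)" "\<And>b. b \<in> insert y X0 \<Longrightarrow> hd (g b) = b"
    "\<And>b. b \<in> insert y X0 \<Longrightarrow> last (g b) \<in> B"
    "\<And>b c. b \<in> insert y X0 \<Longrightarrow> c \<in> insert y X0 \<Longrightarrow> b \<noteq> c \<Longrightarrow> set (g b) \<inter> set (g c) = {}"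
    "\<And>b c. b \<in> insert y X0 \<Longrightarrow> c \<in> insert y X0 \<Longrightarrow> c \<in> set (g b) \<Longrightarrow> c = b"
  shows "linked E U A B (card (insert x X0))"
proof -
  have meet: "v = b \<and> v = c \<and> v \<in> X0"
    if b: "b \<in> insert x X0" and c: "c \<in> insert y X0" and v: "v \<in> set (f b)" "v \<in> set (g c)" for b c v
  proof -
    obtain p1 p2 where p: "f b = p1 @ v # p2" using v by (meson split_list)
    obtain q1 q2 where q: "g c = q1 @ v # q2" using v by (meson split_list)
    \<comment> \<open>Follow \<open>f b\<close> to \<open>v\<close> and then \<open>g c\<close>.
      This walk must meet \<open>X0\<close>, but \<open>f b\<close> meets \<open>X0\<close> at most
      in its end \<open>b\<close> and \<open>g c\<close> at most in its start \<open>c\<close>, so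
      it does so at \<open>v\<close>.\<close>
    let ?w = "p1 @ v # q2"
    have "successively E' ?w" "set ?w \<subseteq> U"
      using f(1)[OF b] g(1)[OF c] unfolding p q
      by (auto simp: dipath_def successively_append_iff successively_Cons)
    then obtain r where r: "dipath E' U r" "hd r = hd ?w" "last r = last ?w" "set r \<subseteq> set ?w"
      using walk_imp_dipath[of ?w E' U] by blast
    have "hd r \<in> A" using f(2)[OF b] r by (cases p1) (auto simp: p)
    moreover have "last r \<in> B" using g(3)[OF c] r by (auto simp: q)
    ultimately obtain w where w: "w \<in> X0" "w \<in> set r" using sep r(1) unfolding separates_def by blast
    then have "w \<in> set (p1 @ [v]) \<or> w \<in> set (v # q2)" using r(4) by auto
    then show ?thesis
    proof
      assume w1: "w \<in> set (p1 @ [v])"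
      then have "w \<in> set (f b)" by (auto simp: p)
      then have wb: "w = b" using f(5)[OF b, of w] w by auto
      have "last (f b) = b" using f(3)[OF b] .
      then have "p2 = [] \<and> w = v"
        using f(1)[OF b] w1 wb unfolding p dipath_def by (cases p2 rule: rev_cases) auto
      then show ?thesis using wb w g(5)[OF c, of v] v by auto
    next
      assume w1: "w \<in> set (v # q2)"
      then have "w \<in> set (g c)" by (auto simp: q)
      then have wc: "w = c" using g(5)[OF c, of w] w by auto
      have "hd (g c) = c" using g(2)[OF c] .
      then have "w = v"
        using g(1)[OF c] w1 wc unfolding q dipath_def by (cases q1) auto
      then show ?thesis using wc w f(5)[OF b, of v] v by auto
    qed
  qed
  have nemp: "g c \<noteq> []" "f b \<noteq> []" if "c \<in> insert y X0" "b \<in> insert x X0" for b c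
    using f(1) g(1) that by (auto simp: dipath_def)
  \<comment> \<open>Only the path ending in \<open>x\<close> uses the arc to \<open>y\<close>. The
    others pass through a shared vertex of \<open>X0\<close>, which \<open>tl\<close> keeps from
    being doubled.\<close>
  define h where "h b = (if b = x then f x @ g y else f b @ tl (g b))" for b
  have E'E: "dipath E U p" if "dipath E' U p" for p
    using that sub unfolding dipath_def by (blast intro: successively_mono)
  have hx: "dipath E U (h x)" "hd (h x) \<in> A" "last (h x) \<in> B"
  proof -
    have "set (f x) \<inter> set (g y) = {}" using meet[of x y] fin by blast
    then show "dipath E U (h x)"
      using f(1,3)[of x] g(1,2)[of y] xy nemp[of y x] E'E by (simp add: h_def dipath_append)
    show "hd (h x) \<in> A" "last (h x) \<in> B" using f(2)[of x] g(3)[of y] nemp[of y x] by (auto simp: h_def)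
  qed
  have hb: "dipath E U (h b)" "hd (h b) \<in> A" "last (h b) \<in> B" if b: "b \<in> X0" for b
  proof -
    have bx: "b \<noteq> x" using b fin by auto
    obtain q where q: "g b = b # q" using nemp[of b b] g(2)[of b] b by (cases "g b") auto
    have "set (f b) \<inter> set q = {}" using meet[of b b] b g(1)[of b] q by (fastforce simp: dipath_def)
    then show "dipath E U (h b)"
      using E'E[OF f(1)[of b]] E'E[OF g(1)[of b]] f(3)[of b] b bx q
      by (cases "q = []") (auto simp: h_def dipath_def successively_append_iff successively_Cons)
    show "hd (h b) \<in> A" using f(2)[of b] nemp[of b b] b bx by (auto simp: h_def)
    show "last (h b) \<in> B" using g(3)[of b] f(3)[of b] b bx q nemp[of b b]
      by (cases "q = []") (auto simp: h_def)
  qed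
  have hset: "set (h b) \<subseteq> set (f b) \<union> set (g (if b = x then y else b))" if "b \<in> insert x X0" for b
    using that nemp[of b b] by (auto simp: h_def dest: list.set_sel(2)[rotated])
  have "set (h b) \<inter> set (h c) = {}" if bc: "b \<in> insert x X0" "c \<in> insert x X0" "b \<noteq> c" for b c
  proof (rule ccontr)
    assume "set (h b) \<inter> set (h c) \<noteq> {}"
    then obtain v where v: "v \<in> set (h b)" "v \<in> set (h c)" by blast
    let ?b = "if b = x then y else b" and ?c = "if c = x then y else c"
    have in': "?b \<in> insert y X0" "?c \<in> insert y X0" "?b \<noteq> ?c" using bc fin by auto
    have "v \<in> set (f b) \<or> v \<in> set (g ?b)" "v \<in> set (f c) \<or> v \<in> set (g ?c)"
      using hset[OF bc(1)] hset[OF bc(2)] v by blast+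
    moreover have "\<not> (v \<in> set (f b) \<and> v \<in> set (f c))" using f(4)[OF bc] by blast
    moreover have "\<not> (v \<in> set (g ?b) \<and> v \<in> set (g ?c))" using g(4)[OF in'] by blast
    ultimately have "v \<in> set (f b) \<and> v \<in> set (g ?c) \<or> v \<in> set (f c) \<and> v \<in> set (g ?b)" by blast
    then show False
      using meet[OF bc(1) in'(2), of v] meet[OF bc(2) in'(1), of v] bc fin by (auto split: if_splits)
  qed
  then show ?thesis unfolding linked_def
    by (intro exI[of _ "insert x X0"] exI[of _ h]) (use fin hx hb in auto)
qed

text \<open>A path of \<open>E\<close> from \<open>A\<close> to \<open>B\<close> is cut at its first
  vertex in \<open>insert x X0\<close>. Up to there no arc leaves \<open>x\<close>, so the piece
  lies in \<open>E'\<close> and meets \<open>Z\<close>; a path without such a vertex would lie in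
  \<open>E'\<close> and contradict \<open>X0\<close>.\<close>

lemma separates_extend:
  assumes Z: "separates E' U A (insert x X0) Z" and X0: "separates E' U A B X0"
    and E: "\<And>u v. E u v \<Longrightarrow> E' u v \<or> u = x"
  shows "separates E U A B Z"
  unfolding separates_def
proof (intro conjI allI impI)
  show "Z \<subseteq> U" using Z by (simp add: separates_def)
  fix p assume p: "dipath E U p" "hd p \<in> A" "last p \<in> B"
  \<comment> \<open>Only arcs leaving \<open>x\<close> can be new, so \<open>x\<close> may still be
    the last vertex of \<open>q\<close>.\<close>
  have E': "successively E' q" if "successively E (q @ r)" "x \<notin> set (butlast q)" for q r
    using that
  proof (induction q)
    case (Cons a q)
    then show ?case using E by (cases q) (auto split: if_splits)
  qed simp
  show "set p \<inter> Z \<noteq> {}"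
  proof (cases "set p \<inter> insert x X0 = {}")
    case True
    then have "dipath E' U p" using p(1) E'[of p "[]"] by (auto simp: dipath_def dest: in_set_butlastD)
    then show ?thesis using p X0 True unfolding separates_def by blast
  next
    case False
    then have "\<exists>v\<in>set p. v \<in> insert x X0" by blast
    from split_list_first_prop[OF this] obtain as v bs
      where s: "p = as @ v # bs" "v \<in> insert x X0" "\<forall>z\<in>set as. z \<notin> insert x X0" by blast
    have "successively E ((as @ [v]) @ bs)" using p(1) s by (simp add: dipath_def)
    then have "successively E' (as @ [v])" using s by (intro E') auto
    then have "dipath E' U (as @ [v])" using p(1) s by (auto simp: dipath_def)
    moreover have "hd (as @ [v]) = hd p" by (cases as) (auto simp: s)
    ultimately have "set (as @ [v]) \<inter> Z \<noteq> {}"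
      using Z p(2) s(2) unfolding separates_def by (metis last_snoc)
    then show ?thesis by (auto simp: s)
  qed
qed

lemma separates_converse: "separates (\<lambda>u v. E v u) U B A X \<longleftrightarrow> separates E U A B X"
proof -
  have *: "separates E U A B X" if s: "separates (\<lambda>u v. E v u) U B A X" for E :: "'a \<Rightarrow> 'a \<Rightarrow> bool" and A B
    unfolding separates_def
  proof (intro conjI allI impI)
    show "X \<subseteq> U" using s by (simp add: separates_def)
    fix p assume "dipath E U p" "hd p \<in> A" "last p \<in> B"
    then show "set p \<inter> X \<noteq> {}"
      using s dipath_rev[of E U p] unfolding separates_def by (metis hd_rev last_rev set_rev)
  qed
  show ?thesis using *[where E = E and A = A and B = B] *[where E = "\<lambda>u v. E v u" and A = B and B = A] by blast

qed

text \<open>Goering's induction on the number of arcs.\<close>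

theorem menger:
  fixes E :: "'a \<Rightarrow> 'a \<Rightarrow> bool"
  assumes "finite U" and "\<And>X. separates E U A B X \<Longrightarrow> k \<le> card X"
  shows "linked E U A B k"
proof -
  \<comment> \<open>The arcs form a finite set here to allow induction; \<open>A\<close> and
    \<open>B\<close> vary because the hypothesis is applied with \<open>insert x X0\<close> as
    target and with \<open>insert y X0\<close> as source.\<close>
  have "linked (\<lambda>u v. (u, v) \<in> F) U A B k"
    if "finite F" "F \<subseteq> {(u, v). u \<noteq> v}" "\<And>X. separates (\<lambda>u v. (u, v) \<in> F) U A B X \<Longrightarrow> k \<le> card X"
    for F :: "('a \<times> 'a) set" and A B
    using that
  proof (induction F arbitrary: A B rule: finite_induct)
    case empty
    \<comment> \<open>Without arcs every path is a single vertex.\<close>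
    have "separates (\<lambda>u v. (u, v) \<in> {}) U A B (A \<inter> B \<inter> U)"
      unfolding separates_def
    proof (intro conjI allI impI)
      fix p assume p: "dipath (\<lambda>u v. (u, v) \<in> {}) U p" "hd p \<in> A" "last p \<in> B"
      then obtain v where "p = [v]" by (auto simp: dipath_def successively_Cons neq_Nil_conv)
      then show "set p \<inter> (A \<inter> B \<inter> U) \<noteq> {}" using p by (auto simp: dipath_def)
    qed auto
    then have "k \<le> card (A \<inter> B \<inter> U)" using empty by blast
    then obtain I where "I \<subseteq> A \<inter> B \<inter> U" "card I = k" "finite I"
      by (meson obtain_subset_with_card_n)
    then show ?case unfolding linked_def
      by (intro exI[of _ I] exI[of _ "\<lambda>v. [v]"]) (auto simp: dipath_def)
  next
    case (insert e F)
    obtain x y where e: "e = (x, y)" by force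
    have xy: "x \<noteq> y" using insert.prems e by auto
    let ?E = "\<lambda>u v. (u, v) \<in> insert e F" and ?E' = "\<lambda>u v. (u, v) \<in> F"
    show ?case
    proof (cases "\<forall>X. separates ?E' U A B X \<longrightarrow> k \<le> card X")
      case True
      then have "linked ?E' U A B k" using insert.IH insert.prems(1) by blast
      then show ?thesis by (rule linked_mono) auto
    next
      case False
      then obtain X0 where X0: "separates ?E' U A B X0" "card X0 < k" by auto
      have fX: "finite X0" using X0 assms(1) by (auto simp: separates_def intro: finite_subset)
      have 1: "k \<le> card Z" if "separates ?E' U A (insert x X0) Z" for Z
        by (rule insert.prems(2), rule separates_extend[OF that X0(1)]) (auto simp: e)
      have 2: "k \<le> card Z" if "separates ?E' U (insert y X0) B Z" for Z
      proof (rule insert.prems(2))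
        have "separates (\<lambda>u v. ?E' v u) U B (insert y X0) Z" "separates (\<lambda>u v. ?E' v u) U B A X0"
          using that X0(1) separates_converse[of ?E' U] by blast+
        then have "separates (\<lambda>u v. ?E v u) U B A Z" by (rule separates_extend) (auto simp: e)
        then show "separates ?E U A B Z" using separates_converse[of ?E U] by blast
      qed
      have l1: "linked ?E' U A (insert x X0) k" using insert.IH[OF _ 1] insert.prems(1) by blast
      have l2: "linked ?E' U (insert y X0) B k" using insert.IH[OF _ 2] insert.prems(1) by blast
      have l2': "linked (\<lambda>u v. ?E' v u) U B (insert y X0) k"
        using l2 linked_converse[where E = ?E' and A = "insert y X0" and B = B] by blast
      have c1: "k \<le> card (insert x X0)" "k \<le> card (insert y X0)"
        using linked_card_le[OF l1] linked_card_le[OF l2'] fX by auto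
      \<comment> \<open>\<open>X0\<close> has fewer than \<open>k\<close> elements, but
        \<open>k\<close> disjoint paths end in \<open>insert x X0\<close> and \<open>k\<close> start
        in \<open>insert y X0\<close>; so both sets have exactly \<open>k\<close> elements.\<close>
      have nx: "x \<notin> X0" "y \<notin> X0" using c1 X0(2) by (auto simp: insert_absorb)
      have k: "card (insert x X0) = k" "card (insert y X0) = k" using c1 X0(2) fX nx by auto
      have lf: "linked ?E' U A (insert x X0) (card (insert x X0))"
        and lg: "linked (\<lambda>u v. ?E' v u) U B (insert y X0) (card (insert y X0))"
        using l1 l2' k by simp_all
      have fin: "finite (insert x X0)" "finite (insert y X0)" using fX by simp_all
      obtain f where f: "\<forall>b\<in>insert x X0. dipath ?E' U (f b) \<and> hd (f b) \<in> A \<and> last (f b) = b"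
        "\<forall>b\<in>insert x X0. \<forall>c\<in>insert x X0. b \<noteq> c \<longrightarrow> set (f b) \<inter> set (f c) = {}"
        "\<forall>b\<in>insert x X0. \<forall>c\<in>insert x X0. c \<in> set (f b) \<longrightarrow> c = b"
        using linked_index_last[OF lf fin(1)] by blast
      obtain g where g: "\<forall>b\<in>insert y X0. dipath (\<lambda>u v. ?E' v u) U (g b) \<and> hd (g b) \<in> B \<and> last (g b) = b"
        "\<forall>b\<in>insert y X0. \<forall>c\<in>insert y X0. b \<noteq> c \<longrightarrow> set (g b) \<inter> set (g c) = {}"
        "\<forall>b\<in>insert y X0. \<forall>c\<in>insert y X0. c \<in> set (g b) \<longrightarrow> c = b"
        using linked_index_last[OF lg fin(2)] by blast
      have g': "dipath ?E' U (rev (g b))" "hd (rev (g b)) = b" "last (rev (g b)) \<in> B" if "b \<in> insert y X0" for b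
        using bspec[OF g(1) that] dipath_rev_ex[of ?E' U "g b"] by auto
      have "linked ?E U A B (card (insert x X0))"
      proof (rule linked_combine[of X0 x y ?E ?E' U A B f "\<lambda>b. rev (g b)"])
        show "set (rev (g b)) \<inter> set (rev (g c)) = {}"
          if "b \<in> insert y X0" "c \<in> insert y X0" "b \<noteq> c" for b c
          unfolding set_rev using g(2) that by blast
        show "c = b" if "b \<in> insert y X0" "c \<in> insert y X0" "c \<in> set (rev (g b))" for b c
          using g(3) that unfolding set_rev by blast
        show "c = b" if "b \<in> insert x X0" "c \<in> insert x X0" "c \<in> set (f b)" for b c
          using f(3) that by blast
        show "set (f b) \<inter> set (f c) = {}"
          if "b \<in> insert x X0" "c \<in> insert x X0" "b \<noteq> c" for b c using f(2) that by blast
        show "dipath ?E' U (f b)" "hd (f b) \<in> A" "last (f b) = b" if "b \<in> insert x X0" for b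
          using f(1) that by blast+
        show "?E u v" if "?E' u v" for u v using that by simp
        show "?E x y" by (simp add: e)
      qed (fact g' X0(1) nx fX xy)+
      then show ?thesis using k by simp
    qed
  qed
  note * = this
  \<comment> \<open>Paths in \<open>U\<close> are distinct lists, so only the finitely many non-loop
    arcs inside \<open>U\<close> matter.\<close>
  let ?F = "{(u, v). u \<in> U \<and> v \<in> U \<and> u \<noteq> v \<and> E u v}"
  have eq: "dipath (\<lambda>u v. (u, v) \<in> ?F) U p \<longleftrightarrow> dipath E U p" for p
  proof -
    have "successively (\<lambda>u v. (u, v) \<in> ?F) p" if "successively E p" "set p \<subseteq> U" "distinct p"
      using that by (induction p rule: induct_list012) auto
    moreover have "successively E p" if "successively (\<lambda>u v. (u, v) \<in> ?F) p"
      using that by (rule successively_mono) auto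
    ultimately show ?thesis unfolding dipath_def by blast
  qed
  have "finite ?F" by (rule finite_subset[of _ "U \<times> U"]) (use assms(1) in auto)
  moreover have "k \<le> card X" if "separates (\<lambda>u v. (u, v) \<in> ?F) U A B X" for X
    using assms(2) that unfolding separates_def eq by blast
  ultimately have "linked (\<lambda>u v. (u, v) \<in> ?F) U A B k" by (intro *) auto
  then show ?thesis unfolding linked_def eq .
qed

section \<open>Bipolar orders\<close>

text \<open>\<open>S\<close> collects what supports the next vertex: the initial sources and all
  out-neighbours of vertices already read. With \<open>S\<close> the out-neighbours of
  \<open>x\<close>, a list can be judged before \<open>x\<close> is put in front of it.\<close>

fun fwd :: "('a \<Rightarrow> 'a \<Rightarrow> bool) \<Rightarrow> 'a set \<Rightarrow> 'a list \<Rightarrow> bool" where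
  "fwd E S [] = True"
| "fwd E S (v # vs) = (v \<in> S \<and> fwd E (S \<union> {w. E v w}) vs)"

abbreviation bwd :: "('a \<Rightarrow> 'a \<Rightarrow> bool) \<Rightarrow> 'a set \<Rightarrow> 'a list \<Rightarrow> bool" where
  "bwd E T vs \<equiv> fwd (\<lambda>u v. E v u) T (rev vs)"

definition bipolar :: "('a \<Rightarrow> 'a \<Rightarrow> bool) \<Rightarrow> 'a set \<Rightarrow> 'a set \<Rightarrow> 'a list \<Rightarrow> bool" where
  "bipolar E S T vs \<longleftrightarrow> distinct vs \<and> fwd E S vs \<and> bwd E T vs"

lemma fwd_append: "fwd E S (as @ bs) \<longleftrightarrow> fwd E S as \<and> fwd E (S \<union> {w. \<exists>v\<in>set as. E v w}) bs"
proof (induction as arbitrary: S)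
  case (Cons a as)
  have "S \<union> {w. E a w} \<union> {w. \<exists>v\<in>set as. E v w} = S \<union> {w. \<exists>v\<in>set (a # as). E v w}" by auto
  then show ?case using Cons by auto
qed simp

lemma fwd_mono: "fwd E S vs \<Longrightarrow> S \<subseteq> S' \<Longrightarrow> fwd E S' vs"
proof (induction vs arbitrary: S S')
  case (Cons v vs)
  then have "fwd E (S \<union> {w. E v w}) vs" "S \<union> {w. E v w} \<subseteq> S' \<union> {w. E v w}" "v \<in> S'" by auto
  then show ?case using Cons.IH by auto
qed simp

lemma fwd_path: "successively E p \<Longrightarrow> (p \<noteq> [] \<Longrightarrow> hd p \<in> S) \<Longrightarrow> fwd E S p"
  by (induction p arbitrary: S rule: induct_list012) auto

lemma fwd_nth:
  assumes "fwd E S vs" "i < length vs"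
  shows "vs ! i \<in> S \<or> (\<exists>j<i. E (vs ! j) (vs ! i))"
proof -
  have "fwd E S (take i vs @ vs ! i # drop (Suc i) vs)"
    using assms by (metis id_take_nth_drop)
  then have "vs ! i \<in> S \<or> (\<exists>v\<in>set (take i vs). E v (vs ! i))"
    unfolding fwd_append by simp
  then show ?thesis
    using assms(2) by (auto simp: in_set_conv_nth)
qed

locale multipartite =
  fixes V :: "'a set" and E :: "'a \<Rightarrow> 'a \<Rightarrow> bool" and cls :: "'a \<Rightarrow> 'c"
  assumes finite_V: "finite V"
    and adj: "\<lbrakk>u \<in> V; v \<in> V\<rbrakk> \<Longrightarrow> (E u v \<or> E v u) \<longleftrightarrow> cls u \<noteq> cls v"
    and two: "\<lbrakk>u \<in> V; v \<in> V; w \<in> V; cls u = cls v; cls v = cls w\<rbrakk> \<Longrightarrow> u = v \<or> v = w \<or> u = w"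
begin

lemma multipartite_converse: "multipartite V (\<lambda>u v. E v u) cls"
proof
  show "finite V" by (rule finite_V)
  show "E v u \<or> E u v \<longleftrightarrow> cls u \<noteq> cls v" if "u \<in> V" "v \<in> V" for u v
    using adj[OF that] by blast
qed (rule two)

text \<open>Induction on \<open>card W\<close>: take away \<open>x\<close>, choose a new first
  vertex dominated by \<open>x\<close>, restore the conditions for the rest, and put
  \<open>x\<close> in front of the path obtained. Integer ranks instead of list positions allow
  vertices to be moved to the front by a mere update, even below the rank of the old first vertex.
  As classes have at most two vertices, the only obstacle is the classmate of the new first
  vertex.\<close>

lemma bipolar_rank:
  fixes r :: "'a \<Rightarrow> int"
  assumes "W \<subseteq> V" "inj_on r W" "x \<in> W" "y \<in> W"
    and "\<And>v. v \<in> W \<Longrightarrow> v \<noteq> x \<Longrightarrow> \<exists>u\<in>W. r u < r v \<and> E u v"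
    and "\<And>v. v \<in> W \<Longrightarrow> v \<noteq> y \<Longrightarrow> \<exists>w\<in>W. r v < r w \<and> E v w"
  shows "\<exists>p. dipath E W p \<and> hd p = x \<and> last p = y \<and> cls ` set p = cls ` W"
  using assms
proof (induction "card W" arbitrary: W r x rule: less_induct)
  case less
  note W = less.prems(1) and inj = less.prems(2) and xW = less.prems(3) and yW = less.prems(4)
    and pred = less.prems(5) and succ = less.prems(6)
  have fW: "finite W" using W finite_V finite_subset by blast
  have minex: "\<exists>m\<in>A. \<forall>v\<in>A. r m \<le> r v" if "A \<subseteq> W" "A \<noteq> {}" for A
  proof -
    have "Min (r ` A) \<in> r ` A" using that fW by (intro Min_in) (auto intro: finite_subset)
    then obtain m where "m \<in> A" "r m = Min (r ` A)" by auto
    then show ?thesis using that fW by (metis Min_le finite_imageI finite_subset imageI)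
  qed
  have maxex: "\<exists>m\<in>A. \<forall>v\<in>A. r v \<le> r m" if "A \<subseteq> W" "A \<noteq> {}" for A
  proof -
    have "Max (r ` A) \<in> r ` A" using that fW by (intro Max_in) (auto intro: finite_subset)
    then obtain m where "m \<in> A" "r m = Max (r ` A)" by auto
    then show ?thesis using that fW by (metis Max_ge finite_imageI finite_subset imageI)
  qed
  have xmin: "r x < r v" if "v \<in> W" "v \<noteq> x" for v
  proof -
    obtain m where m: "m \<in> W" "\<forall>v\<in>W. r m \<le> r v" using minex[of W] xW by blast
    then have "m = x" using pred[of m] by force
    then show ?thesis using m that inj xW by (metis inj_onD order_less_le)
  qed
  have ymax: "r v < r y" if "v \<in> W" "v \<noteq> y" for v
  proof -
    obtain m where m: "m \<in> W" "\<forall>v\<in>W. r v \<le> r m" using maxex[of W] xW by blast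
    then have "m = y" using succ[of m] by force
    then show ?thesis using m that inj yW by (metis inj_onD order_less_le)
  qed
  show ?case
  proof (cases "W \<subseteq> {x, y}")
    case True
    show ?thesis
    proof (cases "x = y")
      case True
      then have "W = {x}" using \<open>W \<subseteq> {x, y}\<close> xW by auto
      then show ?thesis using True by (intro exI[of _ "[x]"]) (simp add: dipath_single)
    next
      case False
      then have "W = {x, y}" using \<open>W \<subseteq> {x, y}\<close> xW yW by auto
      moreover have "E x y" using pred[of y] False yW calculation by auto
      ultimately show ?thesis using False by (intro exI[of _ "[x, y]"]) (auto simp: dipath_def)
    qed
  next
    case False
    have xy: "x \<noteq> y"
      using False xmin ymax xW by (metis insertCI order_less_asym subsetI)
    \<comment> \<open>The last vertex whose only earlier in-neighbour is \<open>x\<close> becomes the new first vertex.\<close>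
    define J where "J = {j \<in> W - {x}. \<forall>i\<in>W. r i < r j \<and> E i j \<longrightarrow> i = x}"
    have "J \<noteq> {}"
    proof -
      obtain m where m: "m \<in> W - {x}" "\<forall>v\<in>W - {x}. r m \<le> r v"
        using minex[of "W - {x}"] False by auto
      then have "m \<in> J" unfolding J_def by force
      then show ?thesis by blast
    qed
    then obtain j where j: "j \<in> J" "\<And>k. k \<in> J \<Longrightarrow> r k \<le> r j"
      using maxex[of J] unfolding J_def by blast
    have pen: "\<exists>v. v \<in> W \<and> v \<noteq> y \<and> E v y \<and> (\<forall>u\<in>W - {y}. r u \<le> r v)"
    proof -
      obtain v where v: "v \<in> W - {y}" "\<forall>u\<in>W - {y}. r u \<le> r v"
        using maxex[of "W - {y}"] xW xy by blast
      then obtain w where "w \<in> W" "r v < r w" "E v w" using succ[of v] by blast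
      then have "E v y" using v by force
      then show ?thesis using v by blast
    qed
    \<comment> \<open>The vertex just before \<open>y\<close> has an arc to \<open>y\<close>; were
      it \<open>x\<close>, no other vertices would be left.\<close>
    have yJ: "y \<notin> J"
    proof
      assume y: "y \<in> J"
      obtain v where v: "v \<in> W" "v \<noteq> y" "E v y" "\<forall>u\<in>W - {y}. r u \<le> r v" using pen by blast
      then have "v = x" using y ymax unfolding J_def by blast
      then have "W \<subseteq> {x, y}" using v(4) xmin by force
      then show False using False by simp
    qed
    have jW: "j \<in> W" "j \<noteq> x" "j \<noteq> y" using j yJ by (auto simp: J_def)
    have Exj: "E x j" using pred[OF jW(1,2)] j(1) unfolding J_def by blast
    have noEj: "\<not> E k j" if "k \<in> W" "k \<noteq> x" "r k < r j" for k
      using j(1) that unfolding J_def by blast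
    have Jlt: "r k < r j" if "k \<in> J" "k \<noteq> j" for k
      using j(2)[OF that(1)] that j(1) inj unfolding J_def
      by (metis (no_types, lifting) DiffD1 inj_onD mem_Collect_eq order_less_le)
    \<comment> \<open>No earlier vertex except \<open>x\<close> dominates \<open>j\<close>, so arcs
      between \<open>j\<close> and earlier members of \<open>J\<close> leave \<open>j\<close>. Hence
      \<open>j\<close> takes over the role of \<open>x\<close> for \<open>J\<close>.\<close>
    have JE: "E j k" if "k \<in> J" "k \<noteq> j" "cls k \<noteq> cls j" for k
    proof -
      have k: "k \<in> W" "k \<noteq> x" using that(1) by (auto simp: J_def)
      then show ?thesis using noEj[OF k Jlt[OF that(1,2)]] that adj[of j k] W jW by auto
    qed
    \<comment> \<open>The classmate is the one vertex that \<open>j\<close> cannot support. If it is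
      dropped, its class is still met by \<open>j\<close>.\<close>
    define D where "D = {i \<in> J. i \<noteq> j \<and> cls i = cls j}"
    have D1: "i = i'" if "i \<in> D" "i' \<in> D" for i i'
    proof -
      have "i \<in> V" "i' \<in> V" "j \<in> V" using that W jW unfolding D_def J_def by blast+
      moreover have "i \<noteq> j" "i' \<noteq> j" "cls i = cls j" "cls j = cls i'" using that unfolding D_def by simp_all
      ultimately show ?thesis using two[of i j i'] by blast
    qed
    have nonJ: "\<exists>m\<in>W - {x}. r m < r k \<and> E m k" if "k \<in> W" "k \<noteq> x" "k \<notin> J" for k
      using that unfolding J_def by blast
    have noED: "\<not> E k i" if "i \<in> J" "k \<in> W" "k \<noteq> x" "r k < r i" for i k
      using that unfolding J_def by blast
    show ?thesis
    proof (cases "\<forall>k\<in>W - {x} - J. (\<exists>m\<in>W - {x} - D. r m < r k \<and> E m k) \<or> E j k")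
      case drop: True
      \<comment> \<open>Nothing depends on \<open>D\<close> alone: it is dropped with
        \<open>x\<close>, and \<open>j\<close> inherits the rank of \<open>x\<close>, so that it
        precedes everything else.\<close>
      define W' where "W' = W - {x} - D"
      define r' where "r' = r(j := r x)"
      have r': "r' k = r k" if "k \<noteq> j" for k using that by (simp add: r'_def)
      have r'j: "r' j < r' k" if "k \<in> W'" "k \<noteq> j" for k
        using that xmin by (auto simp: W'_def r'_def)
      have jW': "j \<in> W'" "y \<in> W'" using jW yW yJ xy by (auto simp: W'_def D_def)
      have "\<exists>p. dipath E W' p \<and> hd p = j \<and> last p = y \<and> cls ` set p = cls ` W'"
      proof (rule less.hyps[where r = r'])
        show "card W' < card W" using fW xW by (intro psubset_card_mono) (auto simp: W'_def)
        show "W' \<subseteq> V" using W by (auto simp: W'_def)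
        show "inj_on r' W'"
        proof (rule inj_onI)
          fix u v assume uv: "u \<in> W'" "v \<in> W'" "r' u = r' v"
          show "u = v"
          proof (cases "u = j \<or> v = j")
            case True then show ?thesis using uv r'j by (metis order_less_irrefl)
          next
            case False then show ?thesis using uv r' inj by (auto simp: W'_def inj_on_def)
          qed
        qed
        show "j \<in> W'" "y \<in> W'" using jW' by auto
        show "\<exists>u\<in>W'. r' u < r' k \<and> E u k" if k: "k \<in> W'" "k \<noteq> j" for k
        proof (cases "E j k")
          case True
          then show ?thesis using r'j[OF k] jW' by blast
        next
          case False
          then have "k \<notin> J" using JE[of k] k unfolding W'_def D_def by blast
          then obtain m where m: "m \<in> W - {x} - D" "r m < r k" "E m k"
            using drop k False unfolding W'_def by blast
          then have "m \<noteq> j" using False by blast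
          then show ?thesis using m r' k by (intro bexI[of _ m]) (auto simp: W'_def)
        qed
        show "\<exists>w\<in>W'. r' k < r' w \<and> E k w" if k: "k \<in> W'" "k \<noteq> y" for k
        proof -
          obtain w where w: "w \<in> W" "r k < r w" "E k w" using succ[of k] k by (auto simp: W'_def)
          have kx: "k \<noteq> x" "k \<in> W" using k by (auto simp: W'_def)
          then have "w \<noteq> x" using w xmin by force
          \<comment> \<open>A member of \<open>J\<close> has no earlier in-neighbour but
            \<open>x\<close>, so the later out-neighbour of \<open>k\<close> is neither dropped nor
            moved.\<close>
          moreover have "w \<notin> J" using noED[of w k] w kx by blast
          ultimately have "w \<in> W'" "w \<noteq> j" using w j by (auto simp: W'_def D_def)
          then show ?thesis using w r' r'j[of w] by (cases "k = j") (auto intro!: bexI[of _ w])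
        qed
      qed
      then obtain p where p: "dipath E W' p" "hd p = j" "last p = y" "cls ` set p = cls ` W'" by blast
      have pne: "p \<noteq> []" using p by (simp add: dipath_def)
      have "dipath E W ([x] @ p)"
        using p pne Exj xW by (subst dipath_append) (auto simp: dipath_def W'_def)
      moreover have "cls ` set ([x] @ p) = cls ` W"
      proof -
        have "cls ` D \<subseteq> cls ` W'" using jW' by (auto simp: D_def)
        moreover have "W = insert x (W' \<union> D)" using xW unfolding W'_def D_def J_def by blast
        ultimately show ?thesis using p(4) by auto
      qed
      ultimately show ?thesis using p pne by (intro exI[of _ "[x] @ p"]) auto
    next
      case nodrop: False
      \<comment> \<open>\<open>k0\<close> depends on the classmate \<open>i\<close> of
        \<open>j\<close> alone. It is not in their class and \<open>j\<close> does not dominate it,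
        so \<open>k0\<close> dominates \<open>j\<close>: then \<open>i\<close>, \<open>k0\<close>,
        \<open>j\<close> can form the new beginning.\<close>
      then obtain k0 where k0: "k0 \<in> W" "k0 \<noteq> x" "k0 \<notin> J" "\<not> E j k0"
        "\<And>m. m \<in> W - {x} - D \<Longrightarrow> r m < r k0 \<Longrightarrow> \<not> E m k0" by blast
      obtain i where i: "i \<in> W" "i \<noteq> x" "r i < r k0" "E i k0" using nonJ[OF k0(1-3)] by blast
      then have iD: "i \<in> D" using k0(5) by blast
      then have iJ: "i \<in> J" "i \<noteq> j" "cls i = cls j" by (auto simp: D_def)
      have only: "m = i" if "m \<in> W" "m \<noteq> x" "r m < r k0" "E m k0" for m
        using k0(5)[of m] that D1[OF _ iD] by blast
      have k0j: "k0 \<noteq> j" using k0 j by blast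
      have "cls k0 \<noteq> cls j" using adj[of i k0] i k0(1) subsetD[OF W] iJ(3) by auto
      then have Ek0j: "E k0 j" using adj[of k0 j] k0 jW subsetD[OF W] by auto
      have ij: "r i < r j" using Jlt iJ by blast
      have k0y: "k0 \<noteq> y"
      proof
        assume "k0 = y"
        moreover obtain v where v: "v \<in> W" "v \<noteq> y" "E v y" "\<forall>u\<in>W - {y}. r u \<le> r v" using pen by blast
        ultimately have "v = x \<or> v = i" using only[of v] ymax by blast
        moreover have "r j \<le> r v" using v(4) jW by blast
        ultimately show False using ij xmin[OF jW(1,2)] by auto
      qed
      have Exi: "E x i" using pred[OF i(1,2)] iJ(1) unfolding J_def by blast
      define W' where "W' = W - {x}"
      \<comment> \<open>The new order starts with \<open>i\<close>, \<open>k0\<close>,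
        \<open>j\<close>; all other vertices of \<open>W'\<close> keep ranks above
        \<open>r x\<close>.\<close>
      define r' where "r' = r(j := r x, k0 := r x - 1, i := r x - 2)"
      have ik0: "i \<noteq> k0" using i by auto
      have r': "r' k = r k" if "k \<noteq> j" "k \<noteq> k0" "k \<noteq> i" for k using that by (simp add: r'_def)
      have r's: "r' j = r x" "r' k0 = r x - 1" "r' i = r x - 2" using iJ(2) k0j ik0 by (auto simp: r'_def)
      have big: "r x < r' k" if "k \<in> W'" "k \<notin> {i, j, k0}" for k
        using that xmin r'[of k] by (auto simp: W'_def)
      have inW': "i \<in> W'" "j \<in> W'" "k0 \<in> W'" "y \<in> W'" using i jW k0 yW xy by (auto simp: W'_def)
      have "\<exists>p. dipath E W' p \<and> hd p = i \<and> last p = y \<and> cls ` set p = cls ` W'"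
      proof (rule less.hyps[where r = r'])
        show "card W' < card W" using fW xW by (intro psubset_card_mono) (auto simp: W'_def)
        show "W' \<subseteq> V" using W by (auto simp: W'_def)
        show "inj_on r' W'"
        proof (rule inj_onI)
          fix u v assume uv: "u \<in> W'" "v \<in> W'" "r' u = r' v"
          have small: "r' w \<le> r x" if "w \<in> {i, j, k0}" for w using that r's by auto
          show "u = v"
          proof (cases "u \<in> {i, j, k0}")
            case True
            then have "v \<in> {i, j, k0}" using small[of u] big[of v] uv by fastforce
            with True show ?thesis using uv(3) r's by safe simp_all
          next
            case False
            then have "v \<notin> {i, j, k0}" using small[of v] big[of u] uv by fastforce
            then have "r u = r v" using uv(3) False r'[of u] r'[of v] by simp
            then show ?thesis using uv inj by (simp add: W'_def inj_on_def)
          qed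
        qed
        show "i \<in> W'" "y \<in> W'" using inW' by auto
        show "\<exists>u\<in>W'. r' u < r' k \<and> E u k" if k: "k \<in> W'" "k \<noteq> i" for k
        proof -
          consider "k = k0" | "k = j" | "k \<noteq> k0" "k \<noteq> j" "k \<in> J" | "k \<noteq> k0" "k \<noteq> j" "k \<notin> J" by blast
          then show ?thesis
          proof cases
            case 1 then show ?thesis using i(4) r's inW' by (intro bexI[of _ i]) auto
          next
            case 2 then show ?thesis using Ek0j r's inW' by (intro bexI[of _ k0]) auto
          next
            case 3
            have "k \<notin> D" using D1[OF _ iD] k by blast
            then have "E j k" using JE 3 unfolding D_def by blast
            then show ?thesis using r's big[of k] 3 k inW' by (intro bexI[of _ j]) auto
          next
            case 4
            then obtain m where m: "m \<in> W - {x}" "r m < r k" "E m k" using nonJ[of k] k by (auto simp: W'_def)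
            then have mW: "m \<in> W'" by (simp add: W'_def)
            have "r x < r' k" using big[of k] 4 k by simp
            moreover have "r' m \<le> r x \<or> r' m = r m" using r'[of m] r's by fastforce
            moreover have "r' k = r k" using r'[of k] 4 k by simp
            ultimately have "r' m < r' k" using m(2) by linarith
            then show ?thesis using m mW by blast
          qed
        qed
        show "\<exists>w\<in>W'. r' k < r' w \<and> E k w" if k: "k \<in> W'" "k \<noteq> y" for k
        proof -
          obtain w where w: "w \<in> W" "r k < r w" "E k w" using succ[of k] k by (auto simp: W'_def)
          have kx: "k \<noteq> x" "k \<in> W" using k by (auto simp: W'_def)
          have wx: "w \<noteq> x" using w xmin kx by force
          consider "k = i" | "k = k0" | "k \<noteq> i" "k \<noteq> k0" by blast
          then show ?thesis
          proof cases
            case 1 then show ?thesis using i(4) r's inW' by (intro bexI[of _ k0]) auto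
          next
            case 2 then show ?thesis using Ek0j r's inW' by (intro bexI[of _ j]) auto
          next
            case 3
            \<comment> \<open>Apart from \<open>x\<close>, only \<open>i\<close> dominates
              \<open>k0\<close> from before, so no other vertex loses its later out-neighbour when
              \<open>k0\<close> moves.\<close>
            have "w \<noteq> k0" using only[of k] kx w 3 by blast
            moreover have "w \<notin> J" using noED[of w k] w kx by blast
            ultimately have ww: "w \<in> W'" "w \<notin> {i,j,k0}" using w wx j iJ by (auto simp: W'_def)
            have "r' w = r w" "r x < r' w" using r'[of w] big[of w] ww by simp_all
            moreover have "r' k = r k \<or> r' k = r x" using r'[of k] r's(1) 3 by blast
            ultimately have "r' k < r' w" using w(2) by auto
            then show ?thesis using w ww by blast
          qed
        qed
      qed
      then obtain p where p: "dipath E W' p" "hd p = i" "last p = y" "cls ` set p = cls ` W'" by blast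
      have pne: "p \<noteq> []" using p by (simp add: dipath_def)
      have "dipath E W ([x] @ p)"
        using p pne Exi xW by (subst dipath_append) (auto simp: dipath_def W'_def)
      moreover have "cls ` set ([x] @ p) = cls ` W"
      proof -
        have "W = insert x W'" using xW unfolding W'_def by blast
        then show ?thesis using p(4) by auto
      qed
      ultimately show ?thesis using p pne by (intro exI[of _ "[x] @ p"]) auto
    qed
  qed
qed

theorem bipolar_imp_path:
  assumes vs: "vs \<noteq> []" "set vs \<subseteq> V" and bip: "bipolar E {hd vs} {last vs} vs"
  shows "\<exists>p. dipath E (set vs) p \<and> hd p = hd vs \<and> last p = last vs \<and> cls ` set p = cls ` set vs"
proof -
  have d: "distinct vs" using bip by (simp add: bipolar_def)
  define r where "r v = int (THE i. i < length vs \<and> vs ! i = v)" for v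
  have r: "r (vs ! i) = int i" if "i < length vs" for i
  proof -
    have "(THE k. k < length vs \<and> vs ! k = vs ! i) = i"
      by (rule the_equality) (use that d nth_eq_iff_index_eq[of vs _ i] in blast)+
    then show ?thesis unfolding r_def by simp
  qed
  have f: "fwd E {hd vs} vs" and b: "bwd E {last vs} vs" using bip by (simp_all add: bipolar_def)
  have F: "vs ! i = hd vs \<or> (\<exists>j<i. E (vs ! j) (vs ! i))" if "i < length vs" for i
    using fwd_nth[OF f that] by blast
  have B: "vs ! i = last vs \<or> (\<exists>j<length vs. i < j \<and> E (vs ! i) (vs ! j))" if i: "i < length vs" for i
  proof -
    let ?i = "length vs - Suc i"
    have ri: "rev vs ! ?i = vs ! i" using i by (simp add: rev_nth Suc_diff_Suc)
    have "?i < length (rev vs)" using i by simp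
    then have "rev vs ! ?i \<in> {last vs} \<or> (\<exists>j<?i. E (rev vs ! ?i) (rev vs ! j))"
      by (rule fwd_nth[OF b])
    then consider "vs ! i = last vs" | j where "j < ?i" "E (vs ! i) (rev vs ! j)" unfolding ri by blast
    then show ?thesis
    proof cases
      case 2
      then have "rev vs ! j = vs ! (length vs - Suc j)" "length vs - Suc j < length vs" "i < length vs - Suc j"
        by (auto simp: rev_nth)
      then show ?thesis using 2 by auto
    qed simp
  qed
  show ?thesis
  proof (rule bipolar_rank[where r = r])
    show "inj_on r (set vs)"
    proof (rule inj_onI)
      fix u v assume "u \<in> set vs" "v \<in> set vs" and uv: "r u = r v"
      then obtain i k where "i < length vs" "u = vs ! i" "k < length vs" "v = vs ! k"
        unfolding in_set_conv_nth by blast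
      then show "u = v" using uv r[of i] r[of k] by simp
    qed
    show "hd vs \<in> set vs" "last vs \<in> set vs" using vs by auto
    show "\<exists>u\<in>set vs. r u < r v \<and> E u v" if v: "v \<in> set vs" "v \<noteq> hd vs" for v
    proof -
      obtain i where i: "i < length vs" "vs ! i = v" using v by (auto simp: in_set_conv_nth)
      then obtain j where "j < i" "E (vs ! j) v" using F[of i] v by auto
      then show ?thesis using i r[of i] r[of j] by (intro bexI[of _ "vs ! j"]) auto
    qed
    show "\<exists>w\<in>set vs. r v < r w \<and> E v w" if v: "v \<in> set vs" "v \<noteq> last vs" for v
    proof -
      obtain i where i: "i < length vs" "vs ! i = v" using v by (auto simp: in_set_conv_nth)
      then obtain j where "j < length vs" "i < j" "E v (vs ! j)" using B[of i] v by auto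
      then show ?thesis using i r[of i] r[of j] by (intro bexI[of _ "vs ! j"]) auto
    qed
  qed (use vs in auto)
qed

end

section \<open>Paths that meet every colour class\<close>

text \<open>Place \<open>u\<close> just before the first vertex after \<open>a\<close> that it
  dominates. The predecessor of that vertex is \<open>a\<close> or a vertex not dominated by
  \<open>u\<close>, and so dominates \<open>u\<close>.\<close>

lemma dipath_insert:
  assumes p: "dipath E U (as @ a # bs)" and u: "u \<in> U" "u \<notin> set (as @ a # bs)"
    and adj: "\<And>v. v \<in> set bs \<Longrightarrow> E u v \<or> E v u" and a: "E a u" and b: "b \<in> set bs" "E u b"
  shows "\<exists>q. dipath E U q \<and> hd q = hd (as @ a # bs) \<and> last q = last (as @ a # bs) \<and>
    set q = insert u (set (as @ a # bs))"
proof -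
  have "\<exists>v\<in>set bs. E u v" using b by blast
  from split_list_first_prop[OF this] obtain cs c ds
    where s: "bs = cs @ c # ds" "E u c" "\<forall>v\<in>set cs. \<not> E u v" by blast
  let ?l = "as @ a # cs"
  have l: "E (last ?l) u" using a adj s by (cases cs rule: rev_cases) auto
  have "dipath E U (?l @ (c # ds))" using p s by simp
  then have d: "dipath E U ?l" "dipath E U (c # ds)" "set ?l \<inter> set (c # ds) = {}"
    by (subst (asm) dipath_append; simp)+
  have "dipath E U (?l @ [u])"
    using d(1) l u s by (subst dipath_append) (auto simp: dipath_single)
  then have "dipath E U ((?l @ [u]) @ (c # ds))"
    using d s u by (subst dipath_append) auto
  moreover have "hd ((?l @ [u]) @ (c # ds)) = hd (as @ a # bs)" by (cases as) auto
  ultimately show ?thesis using s by (intro exI[of _ "(?l @ [u]) @ (c # ds)"]) auto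
qed

context multipartite
begin

lemma card_cls_grow:
  assumes "cls ` A \<subseteq> cls ` B" "u \<in> B" "cls u \<notin> cls ` A" "finite B"
  shows "card (cls ` A) < card (cls ` B)"
  using assms by (intro psubset_card_mono) auto

lemma adj_uncovered:
  assumes "U \<subseteq> V" "set p \<subseteq> U" "u \<in> U" "cls u \<notin> cls ` set p" "v \<in> set p"
  shows "E u v \<or> E v u"
  using assms adj[of u v] by (metis image_eqI subsetD)

text \<open>If \<open>u\<close> fits neither at the end nor in between, it dominates all of
  \<open>p\<close>. Then a path from \<open>A\<close> to \<open>u\<close> either avoids
  \<open>p\<close> and can be followed by \<open>p\<close>, or leaves \<open>p\<close> for the last
  time at some \<open>c\<close>; the detour from \<open>c\<close> to \<open>u\<close> returns to the
  vertex after \<open>c\<close>. If \<open>c\<close> is the last vertex, the new path ends in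
  \<open>u\<close>, which is allowed because \<open>u\<close> is in \<open>B\<close>.\<close>

lemma extend_cover_path:
  assumes U: "U \<subseteq> V" and p: "dipath E U p" "hd p \<in> A" "last p \<in> B"
    and u: "u \<in> U" "u \<in> B" "cls u \<notin> cls ` set p" and e: "e \<in> A" "reach E U e u"
  shows "\<exists>q. dipath E U q \<and> hd q \<in> A \<and> last q \<in> B \<and> set p \<subseteq> set q \<and> u \<in> set q"
proof -
  have pne: "p \<noteq> []" and pU: "set p \<subseteq> U" using p by (auto simp: dipath_def)
  have up: "u \<notin> set p" using u by blast
  have adju: "E u v \<or> E v u" if "v \<in> set p" for v using adj_uncovered[OF U pU u(1,3) that] .
  show ?thesis
  proof (cases "E (last p) u")
    case True
    then have "dipath E U (p @ [u])" using p pne u up by (subst dipath_append) (auto simp: dipath_single)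
    then show ?thesis using p pne u by (intro exI[of _ "p @ [u]"]) auto
  next
    case nlast: False
    then have ulast: "E u (last p)" using adju[of "last p"] pne by auto
    show ?thesis
    proof (cases "\<exists>a\<in>set p. E a u")
      case True
      then obtain a as bs where s: "p = as @ a # bs" "E a u" by (meson split_list)
      have bs: "bs \<noteq> []" using nlast s by auto
      then have "last p \<in> set bs" using s by auto
      then have "\<exists>q. dipath E U q \<and> hd q = hd p \<and> last q = last p \<and> set q = insert u (set p)"
        using dipath_insert[of E U as a bs u "last p"] p u(1) up adju ulast s by auto
      then show ?thesis using p by (metis insertCI subset_insertI)
    next
      case False
      then have all: "E u v" if "v \<in> set p" for v using adju that by blast
      obtain w where w: "dipath E U w" "hd w = e" "last w = u" using e by (auto simp: reach_def)
      have wne: "w \<noteq> []" using w by (simp add: dipath_def)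
      show ?thesis
      proof (cases "set w \<inter> set p = {}")
        case True
        then have "dipath E U (w @ p)" using w p wne pne all by (subst dipath_append) auto
        moreover have "u \<in> set w" using w wne by auto
        ultimately show ?thesis using w p wne pne e by (intro exI[of _ "w @ p"]) auto
      next
        case hit: False
        obtain c q where c: "c \<in> set p" "c \<in> U" "dipath E (U - set p) q" "E c (hd q)" "last q = last w"
          using dipath_last_exit[OF w(1) hit] w(3) up by metis
        have qne: "q \<noteq> []" and uq: "u \<in> set q" using c w by (auto simp: dipath_def)
        have q: "dipath E U q" "set q \<inter> set p = {}" using c(3) by (auto simp: dipath_def)
        obtain as bs where s: "p = as @ c # bs" using c(1) by (meson split_list)
        show ?thesis
        proof (cases "bs = []")
          case True
          then have "dipath E U (p @ q)" using p q pne qne c s by (subst dipath_append) auto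
          then show ?thesis using p pne qne uq c w u by (intro exI[of _ "p @ q"]) auto
        next
          case False
          have "dipath E U ((as @ [c]) @ bs)" using p s by simp
          then have d: "dipath E U (as @ [c])" "dipath E U bs" "set (as @ [c]) \<inter> set bs = {}"
            using False by (subst (asm) dipath_append; simp)+
          have "dipath E U ((as @ [c]) @ q)" using d q c qne s by (subst dipath_append) auto
          then have "dipath E U (((as @ [c]) @ q) @ bs)"
            using d False q qne s all c w by (subst dipath_append) auto
          moreover have "hd (((as @ [c]) @ q) @ bs) = hd p" by (cases as) (auto simp: s)
          ultimately show ?thesis using p False uq s by (intro exI[of _ "((as @ [c]) @ q) @ bs"]) auto
        qed
      qed
    qed
  qed
qed

text \<open>A path meeting the most classes meets all. \<open>U \<subseteq> A \<union> B\<close> is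
  what permits the extension by any vertex of a missed class: directly if it is in \<open>B\<close>,
  after reversing all arcs if it is in \<open>A\<close>.\<close>

lemma cover_path:
  assumes U: "U \<subseteq> V" "U \<noteq> {}" and AB: "A \<subseteq> U" "B \<subseteq> U" "U \<subseteq> A \<union> B"
    and A: "\<And>v. v \<in> U \<Longrightarrow> \<exists>e\<in>A. reach E U e v" and B: "\<And>v. v \<in> U \<Longrightarrow> \<exists>x\<in>B. reach E U v x"
  shows "\<exists>p. dipath E U p \<and> hd p \<in> A \<and> last p \<in> B \<and> cls ` set p = cls ` U"
proof -
  interpret conv: multipartite V "\<lambda>u v. E v u" cls by (rule multipartite_converse)
  let ?P = "\<lambda>p. dipath E U p \<and> hd p \<in> A \<and> last p \<in> B" and ?f = "\<lambda>p. card (cls ` set p)"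
  have fU: "finite U" using U finite_V finite_subset by blast
  obtain a where "a \<in> A" using U A by blast
  then obtain b where "b \<in> B" "reach E U a b" using B[of a] AB by blast
  then obtain p0 where "?P p0" using \<open>a \<in> A\<close> by (auto simp: reach_def)
  moreover have "\<forall>q. ?P q \<longrightarrow> ?f q < Suc (card (cls ` U))"
    using fU by (auto simp: dipath_def less_Suc_eq_le intro!: card_mono image_mono)
  ultimately obtain p where p: "?P p" and max: "\<And>q. ?P q \<Longrightarrow> ?f q \<le> ?f p"
    using ex_has_greatest_nat[of ?P p0 ?f] by blast
  have "cls ` U \<subseteq> cls ` set p"
  proof (rule ccontr)
    assume "\<not> cls ` U \<subseteq> cls ` set p"
    then obtain u where u: "u \<in> U" "cls u \<notin> cls ` set p" by blast
    have "\<exists>q. ?P q \<and> set p \<subseteq> set q \<and> u \<in> set q"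
    proof (cases "u \<in> B")
      case True
      then show ?thesis using extend_cover_path[OF U(1), of p A B u] p u A[OF u(1)] by blast
    next
      case False
      then have "u \<in> A" using u AB by blast
      moreover obtain x where "x \<in> B" "reach E U u x" using B[OF u(1)] by blast
      moreover have "dipath (\<lambda>u v. E v u) U (rev p)" using p by (simp add: dipath_rev)
      moreover have "hd (rev p) \<in> B" "last (rev p) \<in> A" using p by (simp_all add: hd_rev last_rev)
      moreover have "cls u \<notin> cls ` set (rev p)" using u by simp
      ultimately obtain q where "dipath (\<lambda>u v. E v u) U q" "hd q \<in> B" "last q \<in> A"
        "set (rev p) \<subseteq> set q" "u \<in> set q"
        using conv.extend_cover_path[OF U(1), of "rev p" B A u x] u(1) reach_converse[of E U x u] by blast
      then show ?thesis using dipath_rev_ex[of E U q] by (intro exI[of _ "rev q"]) auto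
    qed
    then obtain q where q: "?P q" "set p \<subseteq> set q" "u \<in> set q" by blast
    then have "?f p < ?f q" using u by (intro card_cls_grow) auto
    then show False using max[OF q(1)] by simp
  qed
  then show ?thesis using p by (intro exI[of _ p]) (auto simp: dipath_def)
qed

section \<open>Three disjoint paths\<close>

definition en :: "'a list \<Rightarrow> 'a \<Rightarrow> bool" where "en p q \<longleftrightarrow> (\<exists>v\<in>set p. E v q)"
definition ex :: "'a \<Rightarrow> 'a list \<Rightarrow> bool" where "ex q p \<longleftrightarrow> (\<exists>v\<in>set p. E q v)"

definition three_paths :: "'a set \<Rightarrow> 'a set \<Rightarrow> 'a set \<Rightarrow> 'a list \<Rightarrow> 'a list \<Rightarrow> 'a list \<Rightarrow> bool" where
  "three_paths G S T P Q R \<longleftrightarrow> dipath E G P \<and> dipath E G Q \<and> dipath E G R \<and>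
    hd P \<in> S \<and> hd Q \<in> S \<and> hd R \<in> S \<and> last P \<in> T \<and> last Q \<in> T \<and> last R \<in> T \<and>
    set P \<inter> set Q = {} \<and> set P \<inter> set R = {} \<and> set Q \<inter> set R = {}"

lemma three_paths_perm:
  assumes "three_paths G S T P Q R"
  shows "three_paths G S T P R Q" "three_paths G S T Q P R" "three_paths G S T Q R P"
    "three_paths G S T R P Q" "three_paths G S T R Q P"
  using assms by (simp_all add: three_paths_def Int_commute)

text \<open>Each of the three paths is supported by itself from \<open>S\<close> and towards
  \<open>T\<close>, so only the two ends of \<open>q\<close> need a neighbour on the correct
  side.\<close>

lemma bipolar_between:
  assumes P: "three_paths G S T P1 P2 P3" and q: "dipath E (G - (set P1 \<union> set P2 \<union> set P3)) q"
    and e: "en P1 (hd q)" "ex (last q) P2"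
  shows "bipolar E S T (P1 @ q @ P2 @ P3)"
proof -
  have s: "successively E P1" "successively E P2" "successively E P3" "successively E q"
    and d: "distinct (P1 @ q @ P2 @ P3)"
    using P q unfolding three_paths_def dipath_def by (auto simp: Int_commute)
  have h: "hd P1 \<in> S" "hd P2 \<in> S" "hd P3 \<in> S" "last P1 \<in> T" "last P2 \<in> T" "last P3 \<in> T"
    using P unfolding three_paths_def by simp_all
  have "fwd E S (P1 @ q @ P2 @ P3)"
    unfolding fwd_append using s h e(1) by (intro conjI fwd_path) (simp_all add: en_def bex_Un)
  moreover have "bwd E T (P1 @ q @ P2 @ P3)"
    unfolding rev_append fwd_append using s h e(2)
    by (intro conjI fwd_path) (simp_all add: ex_def hd_rev bex_Un)
  ultimately show ?thesis using d by (simp add: bipolar_def)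
qed

text \<open>Serves for the two pieces of a path that cannot be placed as a whole: they go to the two
  sides of \<open>P1\<close>.\<close>

lemma bipolar_two_detours:
  assumes P: "three_paths G S T P1 P2 P3" and q1: "dipath E (G - (set P1 \<union> set P2 \<union> set P3)) q1"
    and q2: "dipath E (G - (set P1 \<union> set P2 \<union> set P3)) q2" and disj: "set q1 \<inter> set q2 = {}"
    and e: "en P1 (hd q1)" "ex (last q1) P2" "en P3 (hd q2)" "ex (last q2) P1"
  shows "bipolar E S T (P3 @ q2 @ P1 @ q1 @ P2)"
proof -
  have s: "successively E P1" "successively E P2" "successively E P3" "successively E q1" "successively E q2"
    and d: "distinct (P3 @ q2 @ P1 @ q1 @ P2)"
    using P q1 q2 disj unfolding three_paths_def dipath_def by (auto simp: Int_commute)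
  have h: "hd P1 \<in> S" "hd P2 \<in> S" "hd P3 \<in> S" "last P1 \<in> T" "last P2 \<in> T" "last P3 \<in> T"
    using P unfolding three_paths_def by simp_all
  have "fwd E S (P3 @ q2 @ P1 @ q1 @ P2)"
    unfolding fwd_append using s h e(1,3) by (intro conjI fwd_path) (simp_all add: en_def bex_Un)
  moreover have "bwd E T (P3 @ q2 @ P1 @ q1 @ P2)"
    unfolding rev_append fwd_append using s h e(2,4)
    by (intro conjI fwd_path) (simp_all add: ex_def hd_rev bex_Un)
  ultimately show ?thesis using d by (simp add: bipolar_def)
qed

text \<open>Without arcs to or from \<open>q\<close>, all vertices of \<open>P\<close> are
  classmates of \<open>q\<close>, and a class has room for only one.\<close>

lemma en_or_ex:
  assumes "P \<noteq> []" "distinct P" "set P \<subseteq> V" "q \<in> V" "q \<notin> set P" "\<not> en P q" "\<not> ex q P"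
  shows "\<exists>p. P = [p] \<and> cls p = cls q"
proof -
  have c: "cls v = cls q" if "v \<in> set P" for v
    using assms adj[of v q] that unfolding en_def ex_def by blast
  obtain v P' where P: "P = v # P'" using assms by (cases P) auto
  have "P' = []"
  proof (rule ccontr)
    assume "P' \<noteq> []"
    then obtain w where "w \<in> set P'" by (cases P') auto
    then show False using two[of v w q] c[of v] c[of w] assms P by auto
  qed
  then show ?thesis using c P by auto
qed

text \<open>The awkward case: \<open>q\<close> starts and ends at the same path \<open>P1\<close>.
  If \<open>q\<close> never leads to the other two paths, one of them leads to its head and
  \<open>q\<close> is placed between that path and \<open>P1\<close>. Otherwise \<open>q\<close> is
  cut after its last vertex leading to one of them. Only the classes of \<open>q\<close> are
  covered, because one vertex may have to be dropped.\<close>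

lemma three_paths_same_end:
  assumes G: "G \<subseteq> V" and P: "three_paths G S T P1 P2 P3"
    and q: "dipath E (G - (set P1 \<union> set P2 \<union> set P3)) q"
    and e: "en P1 (hd q)" "ex (last q) P1"
  shows "\<exists>vs. bipolar E S T vs \<and> set vs \<subseteq> G \<and> set P1 \<union> set P2 \<union> set P3 \<subseteq> set vs \<and> cls ` set q \<subseteq> cls ` set vs"
proof -
  have PG: "set P1 \<subseteq> G" "set P2 \<subseteq> G" "set P3 \<subseteq> G" and Pd: "distinct P2" "distinct P3"
    and Pne: "P1 \<noteq> []" "P2 \<noteq> []" "P3 \<noteq> []" and P23: "set P2 \<inter> set P3 = {}"
    using P by (auto simp: three_paths_def dipath_def)
  have qG: "set q \<subseteq> G" and qne: "q \<noteq> []" and qs: "successively E q"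
    and qP: "\<And>v. v \<in> set q \<Longrightarrow> v \<notin> set P1 \<and> v \<notin> set P2 \<and> v \<notin> set P3" using q by (auto simp: dipath_def)
  let ?R = "\<lambda>vs. bipolar E S T vs \<and> set vs \<subseteq> G \<and> set P1 \<union> set P2 \<union> set P3 \<subseteq> set vs \<and> cls ` set q \<subseteq> cls ` set vs"
  have nb: "en P2 v \<or> ex v P2 \<or> (\<exists>p. P2 = [p] \<and> cls p = cls v)" "en P3 v \<or> ex v P3 \<or> (\<exists>p. P3 = [p] \<and> cls p = cls v)"
    if "v \<in> set q" for v
    using en_or_ex[of P2 v] en_or_ex[of P3 v] that Pne Pd PG qG qP[OF that] G by blast+
  have ntwice: "\<not> ((\<exists>p. P2 = [p] \<and> cls p = cls v) \<and> (\<exists>p. P3 = [p] \<and> cls p = cls v))" if v: "v \<in> set q" for v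
  proof
    assume "(\<exists>p. P2 = [p] \<and> cls p = cls v) \<and> (\<exists>p. P3 = [p] \<and> cls p = cls v)"
    then obtain p2 p3 where pp: "P2 = [p2]" "P3 = [p3]" "cls p2 = cls v" "cls p3 = cls v" by blast
    then have "p2 \<in> V" "p3 \<in> V" "v \<in> V" "p2 \<noteq> p3" "v \<noteq> p2" "v \<noteq> p3"
      using PG G qG v P23 qP[OF v] by auto
    then show False using two[of p2 p3 v] pp by auto
  qed
  show ?thesis
  proof (cases "ex (last q) P2 \<or> ex (last q) P3")
    case True
    then show ?thesis
    proof
      assume "ex (last q) P2"
      then have "bipolar E S T (P1 @ q @ P2 @ P3)" using bipolar_between[OF P q e(1)] by blast
      then show ?thesis using PG qG by (intro exI[of _ "P1 @ q @ P2 @ P3"]) auto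
    next
      assume "ex (last q) P3"
      then have "bipolar E S T (P1 @ q @ P3 @ P2)"
        using bipolar_between[OF three_paths_perm(1)[OF P], of q] q e(1) by (simp add: Un_ac)
      then show ?thesis using PG qG by (intro exI[of _ "P1 @ q @ P3 @ P2"]) auto
    qed
  next
    case nlast: False
    show ?thesis
    proof (cases "\<exists>v\<in>set q. ex v P2 \<or> ex v P3")
      case False
      then have "en P2 (hd q) \<or> en P3 (hd q)" using nb[of "hd q"] ntwice[of "hd q"] qne by auto
      then show ?thesis
      proof
        assume "en P2 (hd q)"
        then have "bipolar E S T (P2 @ q @ P1 @ P3)"
          using bipolar_between[OF three_paths_perm(2)[OF P], of q] q e(2) by (simp add: Un_ac)
        then show ?thesis using PG qG by (intro exI[of _ "P2 @ q @ P1 @ P3"]) auto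
      next
        assume "en P3 (hd q)"
        then have "bipolar E S T (P3 @ q @ P1 @ P2)"
          using bipolar_between[OF three_paths_perm(4)[OF P], of q] q e(2) by (simp add: Un_ac)
        then show ?thesis using PG qG by (intro exI[of _ "P3 @ q @ P1 @ P2"]) auto
      qed
    next
      case True
      \<comment> \<open>After \<open>g\<close>, every vertex is entered from each of
        \<open>P2\<close> and \<open>P3\<close>, unless that path is a single classmate.\<close>
      from split_list_last_prop[OF this] obtain as g q2
        where s: "q = as @ g # q2" "ex g P2 \<or> ex g P3" "\<forall>v\<in>set q2. \<not> (ex v P2 \<or> ex v P3)" by blast
      have q2ne: "q2 \<noteq> []" using nlast s by auto
      then obtain z q3 where z: "q2 = z # q3" by (cases q2) auto
      define q1 where "q1 = as @ [g]"
      have q12: "q = q1 @ q2" "q1 \<noteq> []" "last q1 = g" "hd q1 = hd q" "last q2 = last q"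
        using s q2ne by (cases as; auto simp: q1_def)+
      have dq: "dipath E (G - (set P1 \<union> set P2 \<union> set P3)) q1" "dipath E (G - (set P1 \<union> set P2 \<union> set P3)) q2"
        "set q1 \<inter> set q2 = {}"
        using q q12 q2ne dipath_append[of q1 q2] by auto
      \<comment> \<open>\<open>A\<close> is the path that \<open>g\<close> leads to and
        \<open>B\<close> the other one: \<open>q1\<close> is placed between \<open>P1\<close> and
        \<open>A\<close>, and \<open>q2\<close> between \<open>B\<close> and
        \<open>P1\<close>.\<close>
      have main: ?thesis if P': "three_paths G S T P1 A B" "{A, B} = {P2, P3}" and gA: "ex g A" for A B
      proof -
        have U: "set P1 \<union> set A \<union> set B = set P1 \<union> set P2 \<union> set P3" using P'(2) by (auto simp: doubleton_eq_iff)
        have B: "B = P2 \<or> B = P3" using P'(2) by auto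
        have dqU: "dipath E (G - (set P1 \<union> set A \<union> set B)) q1"
          "dipath E (G - (set P1 \<union> set A \<union> set B)) q2"
          unfolding U by (fact dq)+
        have e': "en P1 (hd q1)" "ex (last q2) P1" "ex (last q1) A" using e gA by (simp_all only: q12(3-5))
        have q1G: "set q1 \<subseteq> G" "set q2 \<subseteq> G" "set q = set q1 \<union> set q2" using qG q12(1) by auto
        have nbB: "en B v \<or> (\<exists>p. B = [p] \<and> cls p = cls v)" if "v \<in> set q2" for v
          using nb[of v] B s that by auto
        show ?thesis
        proof (cases "en B z")
          case True
          have "bipolar E S T (B @ q2 @ P1 @ q1 @ A)"
          proof (rule bipolar_two_detours[OF P'(1) dqU dq(3)])
            show "en P1 (hd q1)" "ex (last q1) A" "en B (hd q2)" "ex (last q2) P1"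
              using True z e' by simp_all
          qed
          moreover have "set (B @ q2 @ P1 @ q1 @ A) = set P1 \<union> set P2 \<union> set P3 \<union> set q"
            unfolding U[symmetric] q1G(3) by auto
          ultimately show ?thesis using PG qG by (intro exI[of _ "B @ q2 @ P1 @ q1 @ A"]) auto
        next
          case False
          \<comment> \<open>Only a classmate of \<open>z\<close> stands in the way. Then
            \<open>z\<close> is dropped, since \<open>b\<close> meets its class; the next vertex, if
            any, has another class and is entered from \<open>b\<close>.\<close>
          then obtain b where b: "B = [b]" "cls b = cls z" using nbB[of z] z by auto
          show ?thesis
          proof (cases q3)
            case Nil
            have "bipolar E S T (P1 @ q1 @ A @ B)"
              using bipolar_between[OF P'(1) dqU(1)] e' by blast
            moreover have "cls ` set q \<subseteq> cls ` set (P1 @ q1 @ A @ B)" using q1G(3) z Nil b by auto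
            moreover have "set (P1 @ q1 @ A @ B) = set P1 \<union> set P2 \<union> set P3 \<union> set q1"
              unfolding U[symmetric] by auto
            ultimately show ?thesis using PG q1G by (intro exI[of _ "P1 @ q1 @ A @ B"]) auto
          next
            case (Cons z' q4)
            have zz': "E z z'" using qs unfolding s z Cons by (auto simp: successively_append_iff)
            have zin: "z \<in> V" "z' \<in> V" "b \<in> V" using qG G PG B b unfolding s z Cons by auto
            then have "cls z \<noteq> cls z'" using adj zz' by blast
            then have "en B z'" using nbB[of z'] z Cons b by auto
            moreover have "dipath E (G - (set P1 \<union> set A \<union> set B)) q3" "last q3 = last q2"
              using dqU(2) unfolding z Cons by (auto simp: dipath_def)
            moreover have "set q1 \<inter> set q3 = {}" using dq(3) z by auto
            ultimately have "bipolar E S T (B @ q3 @ P1 @ q1 @ A)"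
            proof (intro bipolar_two_detours[OF P'(1) dqU(1)])
              show "en P1 (hd q1)" "ex (last q1) A" using e' by simp_all
            qed (use Cons e' in simp_all)
            moreover have "cls ` set q \<subseteq> cls ` set (B @ q3 @ P1 @ q1 @ A)" using q1G(3) z b by auto
            moreover have "set (B @ q3 @ P1 @ q1 @ A) = set P1 \<union> set P2 \<union> set P3 \<union> set q1 \<union> set q3"
              unfolding U[symmetric] by auto
            moreover have "set q3 \<subseteq> G" using q1G(2) z by auto
            ultimately show ?thesis using PG q1G by (intro exI[of _ "B @ q3 @ P1 @ q1 @ A"]) auto
          qed
        qed
      qed
      show ?thesis using s(2) main[OF P] main[OF three_paths_perm(1)[OF P]] by blast
    qed
  qed
qed

end

context multipartite
begin

text \<open>Cut a path from \<open>S\<close> to \<open>v\<close> after its last vertex in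
  \<open>Z\<close>.\<close>

lemma entry_reach:
  assumes "v \<in> G" "v \<notin> Z" and S: "\<exists>s\<in>S. reach E G s v"
  shows "\<exists>e. e \<in> G - Z \<and> (e \<in> S \<or> (\<exists>z\<in>Z. E z e)) \<and> reach E (G - Z) e v"
proof -
  obtain s w where w: "s \<in> S" "dipath E G w" "hd w = s" "last w = v" using S by (auto simp: reach_def)
  show ?thesis
  proof (cases "set w \<inter> Z = {}")
    case True
    then have "dipath E (G - Z) w" using w by (auto simp: dipath_def)
    then have "reach E (G - Z) s v" using w by (auto simp: reach_def)
    then show ?thesis using w reach_in[of E "G - Z" s v] by blast
  next
    case False
    obtain c q where "c \<in> Z" "dipath E (G - Z) q" "E c (hd q)" "last q = last w"
      using dipath_last_exit[OF w(2) False] w(4) assms(2) by metis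
    then have "reach E (G - Z) (hd q) v" "E c (hd q)" "c \<in> Z" using w by (auto simp: reach_def)
    then show ?thesis using reach_in[of E "G - Z" "hd q" v] by blast
  qed
qed

lemma exit_reach:
  assumes "v \<in> G" "v \<notin> Z" and T: "\<exists>t\<in>T. reach E G v t"
  shows "\<exists>e. e \<in> G - Z \<and> (e \<in> T \<or> (\<exists>z\<in>Z. E e z)) \<and> reach E (G - Z) v e"
proof -
  interpret conv: multipartite V "\<lambda>u v. E v u" cls by (rule multipartite_converse)
  have "\<exists>t\<in>T. reach (\<lambda>u v. E v u) G t v" using T reach_converse[of E G] by blast
  from conv.entry_reach[OF assms(1,2) this] show ?thesis using reach_converse[of E "G - Z"] by blast
qed

lemma bipolar_entry_first:
  assumes P: "three_paths G S T P1 P2 P3" and q: "dipath E (G - (set P1 \<union> set P2 \<union> set P3)) q"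
    and e: "hd q \<in> S" "last q \<in> T \<or> (\<exists>z\<in>set P1 \<union> set P2 \<union> set P3. E (last q) z)"
  shows "bipolar E S T (q @ P1 @ P2 @ P3)"
proof -
  have s: "successively E P1" "successively E P2" "successively E P3" "successively E q"
    and d: "distinct (q @ P1 @ P2 @ P3)"
    using P q unfolding three_paths_def dipath_def by (auto simp: Int_commute)
  have h: "hd P1 \<in> S" "hd P2 \<in> S" "hd P3 \<in> S" "last P1 \<in> T" "last P2 \<in> T" "last P3 \<in> T"
    using P unfolding three_paths_def by simp_all
  have "fwd E S (q @ P1 @ P2 @ P3)"
    unfolding fwd_append using s h e(1) by (intro conjI fwd_path) simp_all
  moreover have "bwd E T (q @ P1 @ P2 @ P3)"
    unfolding rev_append fwd_append using s h e(2)
    by (intro conjI fwd_path) (simp_all add: hd_rev bex_Un disj_ac)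
  ultimately show ?thesis using d by (simp add: bipolar_def)
qed

lemma bipolar_exit_last:
  assumes P: "three_paths G S T P1 P2 P3" and q: "dipath E (G - (set P1 \<union> set P2 \<union> set P3)) q"
    and e: "last q \<in> T" "\<exists>z\<in>set P1 \<union> set P2 \<union> set P3. E z (hd q)"
  shows "bipolar E S T (P1 @ P2 @ P3 @ q)"
proof -
  have s: "successively E P1" "successively E P2" "successively E P3" "successively E q"
    and d: "distinct (P1 @ P2 @ P3 @ q)"
    using P q unfolding three_paths_def dipath_def by (auto simp: Int_commute)
  have h: "hd P1 \<in> S" "hd P2 \<in> S" "hd P3 \<in> S" "last P1 \<in> T" "last P2 \<in> T" "last P3 \<in> T"
    using P unfolding three_paths_def by simp_all
  have "fwd E S (P1 @ P2 @ P3 @ q)"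
    unfolding fwd_append using s h e(2) by (intro conjI fwd_path) (simp_all add: bex_Un disj_ac)
  moreover have "bwd E T (P1 @ P2 @ P3 @ q)"
    unfolding rev_append fwd_append using s h e(1)
    by (intro conjI fwd_path) (simp_all add: hd_rev)
  ultimately show ?thesis using d by (simp add: bipolar_def)
qed

text \<open>\<open>cover_path\<close> yields a path \<open>q\<close> off the three paths between
  vertices that can be entered (\<open>A\<close>) and vertices that can be left (\<open>B\<close>).
  Where the ends of \<open>q\<close> attach decides where it is placed in the ordering.\<close>

theorem three_paths_cover:
  assumes G: "G \<subseteq> V" and P: "three_paths G S T P1 P2 P3"
    and S: "\<And>v. v \<in> G \<Longrightarrow> \<exists>s\<in>S. reach E G s v" and T: "\<And>v. v \<in> G \<Longrightarrow> \<exists>t\<in>T. reach E G v t"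
  shows "\<exists>vs. bipolar E S T vs \<and> set vs \<subseteq> G \<and> set P1 \<union> set P2 \<union> set P3 \<subseteq> set vs \<and> cls ` set vs = cls ` G"
proof -
  let ?Z = "set P1 \<union> set P2 \<union> set P3"
  have PG: "set P1 \<subseteq> G" "set P2 \<subseteq> G" "set P3 \<subseteq> G" and Pd: "distinct P1" "distinct P2" "distinct P3"
    and Pne: "P1 \<noteq> []" "P2 \<noteq> []" "P3 \<noteq> []" and Pdis: "set P1 \<inter> set P2 = {}"
    using P by (auto simp: three_paths_def dipath_def)
  have ZG: "?Z \<subseteq> G" using PG by blast
  define U where "U = G - ?Z"
  have UV: "U \<subseteq> V" using G by (auto simp: U_def)
  let ?R = "\<lambda>vs. bipolar E S T vs \<and> set vs \<subseteq> G \<and> ?Z \<subseteq> set vs \<and> cls ` U \<subseteq> cls ` set vs"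
  have "\<exists>vs. ?R vs"
  proof (cases "U = {}")
    case True
    have "bipolar E S T (P1 @ P2 @ P3)"
      using P unfolding bipolar_def three_paths_def dipath_def
      by (auto simp: fwd_append hd_rev Int_commute intro!: fwd_path)
    then show ?thesis using True ZG by (intro exI[of _ "P1 @ P2 @ P3"]) auto
  next
    case False
    define A where "A = {q \<in> U. q \<in> S \<or> (\<exists>z\<in>?Z. E z q)}"
    define B where "B = {q \<in> U. q \<in> T \<or> (\<exists>z\<in>?Z. E q z)}"
    \<comment> \<open>A vertex in neither set would be a classmate of both \<open>P1\<close> and
      \<open>P2\<close>, which makes three vertices in one class.\<close>
    have "U \<subseteq> A \<union> B"
    proof
      fix v assume v: "v \<in> U"
      show "v \<in> A \<union> B"
      proof (rule ccontr)
        assume n: "v \<notin> A \<union> B"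
        then have "\<not> en P1 v" "\<not> ex v P1" "\<not> en P2 v" "\<not> ex v P2" "v \<notin> set P1" "v \<notin> set P2" "v \<in> V"
          using v UV unfolding A_def B_def en_def ex_def U_def by blast+
        then obtain p1 p2 where p: "P1 = [p1]" "cls p1 = cls v" "P2 = [p2]" "cls p2 = cls v"
          using en_or_ex[of P1 v] en_or_ex[of P2 v] Pne Pd PG G by blast
        then have "p1 \<in> V" "p2 \<in> V" "v \<in> V" "p1 \<noteq> p2" "v \<noteq> p1" "v \<noteq> p2"
          using PG G v UV Pdis unfolding U_def by auto
        then show False using two[of p1 p2 v] p by auto
      qed
    qed
    moreover have "\<exists>e\<in>A. reach E U e v" if "v \<in> U" for v
      using entry_reach[of v G ?Z S] that S unfolding A_def U_def by blast
    moreover have "\<exists>e\<in>B. reach E U v e" if "v \<in> U" for v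
      using exit_reach[of v G ?Z T] that T unfolding B_def U_def by blast
    moreover have "A \<subseteq> U" "B \<subseteq> U" by (auto simp: A_def B_def)
    ultimately obtain q where q: "dipath E U q" "hd q \<in> A" "last q \<in> B" "cls ` set q = cls ` U"
      using cover_path[OF UV False, of A B] by blast
    have qd: "dipath E (G - ?Z) q" using q(1) by (simp add: U_def)
    have qG: "set q \<subseteq> G" using qd by (auto simp: dipath_def)
    have fin: ?thesis if "bipolar E S T vs" "set vs = ?Z \<union> set q" for vs
    proof -
      have "cls ` U \<subseteq> cls ` set vs" unfolding that(2) q(4)[symmetric] by (rule image_mono) blast
      moreover have "set vs \<subseteq> G" "?Z \<subseteq> set vs" unfolding that(2) using ZG qG by blast+
      ultimately show ?thesis using that(1) by blast
    qed
    have main: ?thesis if P': "three_paths G S T X Y W" and eq: "set X \<union> set Y \<union> set W = ?Z"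
      and e: "en X (hd q)" "ex (last q) X \<or> ex (last q) Y" for X Y W
    proof -
      have qd': "dipath E (G - (set X \<union> set Y \<union> set W)) q" unfolding eq by (rule qd)
      from e(2) show ?thesis
      proof
        assume "ex (last q) X"
        then obtain vs where "bipolar E S T vs" "set vs \<subseteq> G" "set X \<union> set Y \<union> set W \<subseteq> set vs" "cls ` set q \<subseteq> cls ` set vs"
          using three_paths_same_end[OF G P' qd' e(1)] by blast
        then show ?thesis unfolding eq q(4) by blast
      next
        assume "ex (last q) Y"
        then have "bipolar E S T (X @ q @ Y @ W)" using bipolar_between[OF P' qd' e(1)] by blast
        moreover have "set (X @ q @ Y @ W) = ?Z \<union> set q" unfolding eq[symmetric] by auto
        ultimately show ?thesis by (rule fin)
      qed
    qed
    show ?thesis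
    proof (cases "hd q \<in> S")
      case True
      have "bipolar E S T (q @ P1 @ P2 @ P3)"
        using bipolar_entry_first[OF P qd True] q(3) unfolding B_def by blast
      then show ?thesis by (rule fin) (simp add: Un_ac)
    next
      case nS: False
      show ?thesis
      proof (cases "last q \<in> T")
        case True
        have "bipolar E S T (P1 @ P2 @ P3 @ q)"
          using bipolar_exit_last[OF P qd True] q(2) nS unfolding A_def by blast
        then show ?thesis by (rule fin) (simp add: Un_ac)
      next
        case False
        have e: "en P1 (hd q) \<or> en P2 (hd q) \<or> en P3 (hd q)" "ex (last q) P1 \<or> ex (last q) P2 \<or> ex (last q) P3"
          using q(2,3) False nS unfolding A_def B_def en_def ex_def by blast+
        note perm = three_paths_perm[OF P]
        have u: "set P1 \<union> set P3 \<union> set P2 = ?Z" "set P2 \<union> set P1 \<union> set P3 = ?Z" "set P2 \<union> set P3 \<union> set P1 = ?Z"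
          "set P3 \<union> set P1 \<union> set P2 = ?Z" "set P3 \<union> set P2 \<union> set P1 = ?Z" by blast+
        show ?thesis
          using e main[OF P refl] main[OF perm(1) u(1)] main[OF perm(2) u(2)] main[OF perm(3) u(3)]
            main[OF perm(4) u(4)] main[OF perm(5) u(5)] by blast
      qed
    qed
  qed
  then obtain vs where vs: "bipolar E S T vs" "set vs \<subseteq> G" "?Z \<subseteq> set vs" "cls ` U \<subseteq> cls ` set vs"
    by (elim exE conjE)
  have "cls ` G \<subseteq> cls ` set vs"
  proof -
    have "G = U \<union> ?Z" using ZG by (auto simp: U_def)
    then have "cls ` G = cls ` U \<union> cls ` ?Z" by (metis image_Un)
    moreover have "cls ` ?Z \<subseteq> cls ` set vs" using vs(3) by (rule image_mono)
    ultimately show ?thesis using vs(4) by simp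
  qed
  moreover have "cls ` set vs \<subseteq> cls ` G" using vs(2) by (rule image_mono)
  ultimately have "cls ` set vs = cls ` G" by (rule subset_antisym[rotated])
  then show ?thesis using vs(1-3) by (intro exI[of _ vs] conjI)
qed

section \<open>Cycles that meet every colour class\<close>

definition dicycle :: "'a set \<Rightarrow> 'a list \<Rightarrow> bool" where
  "dicycle U c \<longleftrightarrow> dipath E U c \<and> E (last c) (hd c)"

lemma dicycle_rotate:
  assumes "dicycle U (as @ bs)" shows "dicycle U (bs @ as)"
proof (cases "as = [] \<or> bs = []")
  case False
  then show ?thesis using assms
    by (auto simp: dicycle_def dipath_def successively_append_iff)
qed (use assms in auto)

lemma dicycle_start:
  assumes "dicycle U c" "v \<in> set c"
  obtains bs where "dicycle U (v # bs)" "set (v # bs) = set c"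
proof -
  obtain as bs where "c = as @ v # bs" using assms by (meson split_list)
  then have "dicycle U ((v # bs) @ as)" "set ((v # bs) @ as) = set c"
    using assms dicycle_rotate[of U as "v # bs"] by auto
  then show ?thesis using that[of "bs @ as"] by simp
qed

text \<open>If a vertex of the cycle dominates \<open>u\<close>, then \<open>u\<close> fits into it.
  Otherwise \<open>u\<close> dominates the whole cycle; a path to \<open>u\<close> leaves the cycle
  for the last time at some \<open>b\<close>, and the cycle is opened after \<open>b\<close> and
  closed again through \<open>u\<close>.\<close>

lemma extend_cycle:
  assumes U: "U \<subseteq> V" and c: "dicycle U c"
    and u: "u \<in> U" "cls u \<notin> cls ` set c" and strong: "\<And>v. v \<in> U \<Longrightarrow> reach E U v u"
    and a: "a \<in> set c" "E u a"
  shows "\<exists>q. dicycle U q \<and> set c \<subseteq> set q \<and> u \<in> set q"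
proof -
  have cU: "set c \<subseteq> U" using c by (auto simp: dicycle_def dipath_def)
  have uc: "u \<notin> set c" using u by blast
  have adju: "E u v \<or> E v u" if "v \<in> set c" for v using adj_uncovered[OF U cU u that] .
  show ?thesis
  proof (cases "\<exists>b\<in>set c. E b u")
    case True
    then obtain b where b: "b \<in> set c" "E b u" by blast
    obtain bs where bs: "dicycle U (b # bs)" "set (b # bs) = set c" using dicycle_start[OF c b(1)] .
    show ?thesis
    proof (cases "\<exists>v\<in>set bs. E u v")
      case True
      then obtain v where v: "v \<in> set bs" "E u v" by blast
      have d: "dipath E U ([] @ b # bs)" using bs by (simp add: dicycle_def)
      obtain q where q: "dipath E U q" "hd q = b" "last q = last (b # bs)" "set q = insert u (set c)"
        using dipath_insert[OF d u(1) _ _ b(2) v] uc adju bs(2) by auto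
      then have "dicycle U q" using bs by (auto simp: dicycle_def)
      then show ?thesis using q by blast
    next
      case False
      then have ub: "E u b" using a bs by auto
      have "E (last (b # bs)) u"
      proof (cases "bs = []")
        case True then show ?thesis using b by simp
      next
        case nb: False
        then have "last bs \<in> set bs" by simp
        moreover from this have "last bs \<in> set c" using bs(2) by auto
        ultimately show ?thesis using False adju[of "last bs"] nb by auto
      qed
      then have "dipath E U ((b # bs) @ [u])"
        using bs u uc by (subst dipath_append) (auto simp: dicycle_def dipath_single)
      then have "dicycle U ((b # bs) @ [u])" using ub by (simp add: dicycle_def)
      then show ?thesis using bs(2) by (intro exI[of _ "(b # bs) @ [u]"]) auto
    qed
  next
    case False
    then have all: "E u v" if "v \<in> set c" for v using adju that by blast
    obtain w where w: "dipath E U w" "hd w = a" "last w = u"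
      using strong[of a] a cU by (auto simp: reach_def)
    have "hd w \<in> set w" using w(1) by (simp add: dipath_def)
    then have hit: "set w \<inter> set c \<noteq> {}" using w(2) a(1) by blast
    obtain b q where b: "b \<in> set c" "dipath E (U - set c) q" "E b (hd q)" "last q = u"
      using dipath_last_exit[OF w(1) hit] w(3) uc by metis
    obtain as bs where s: "c = as @ b # bs" using b(1) by (meson split_list)
    let ?r = "bs @ as @ [b]"
    have "dicycle U ?r" using dicycle_rotate[of U "as @ [b]" bs] c s by simp
    then have r: "dipath E U ?r" by (simp add: dicycle_def)
    have q: "dipath E U q" "set q \<inter> set ?r = {}" "q \<noteq> []" using b s by (auto simp: dipath_def)
    have "dipath E U (?r @ q)" using r q b by (subst dipath_append) auto
    moreover have "hd (?r @ q) \<in> set c" using s by (cases bs; cases as) auto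
    ultimately have "dicycle U (?r @ q)" using all q b by (simp add: dicycle_def)
    moreover have "u \<in> set q" using q b by auto
    ultimately show ?thesis using s by (intro exI[of _ "?r @ q"]) auto
  qed
qed

text \<open>Two classes give an arc, strong connection closes it to a cycle, and a cycle meeting the
  most classes meets all. The arc between \<open>hd c\<close> and a missed vertex decides whether
  \<open>c\<close> or its reversal is extended.\<close>

lemma cover_cycle:
  assumes U: "U \<subseteq> V" and strong: "\<And>u v. u \<in> U \<Longrightarrow> v \<in> U \<Longrightarrow> reach E U u v"
    and uv: "u0 \<in> U" "v0 \<in> U" "cls u0 \<noteq> cls v0"
  shows "\<exists>c. dicycle U c \<and> cls ` set c = cls ` U"
proof -
  interpret conv: multipartite V "\<lambda>u v. E v u" cls by (rule multipartite_converse)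
  have conv: "conv.dicycle U (rev c) \<longleftrightarrow> dicycle U c" if "c \<noteq> []" for c
    using that by (auto simp: conv.dicycle_def dicycle_def dipath_rev hd_rev last_rev)
  let ?f = "\<lambda>p. card (cls ` set p)"
  have fU: "finite U" using U finite_V finite_subset by blast
  have "\<exists>c. dicycle U c"
  proof -
    have "E u0 v0 \<or> E v0 u0" using adj[of u0 v0] uv U by blast
    then obtain a b where ab: "a \<in> U" "b \<in> U" "E a b" using uv by blast
    then obtain p where "dipath E U p" "hd p = b" "last p = a" using strong[of b a] by (auto simp: reach_def)
    then show ?thesis using ab by (auto simp: dicycle_def)
  qed
  then obtain c0 where "dicycle U c0" by blast
  moreover have "\<forall>q. dicycle U q \<longrightarrow> ?f q < Suc (card (cls ` U))"
    using fU by (auto simp: dicycle_def dipath_def less_Suc_eq_le intro!: card_mono image_mono)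
  ultimately obtain c where c: "dicycle U c" and max: "\<And>q. dicycle U q \<Longrightarrow> ?f q \<le> ?f c"
    using ex_has_greatest_nat[of "dicycle U" c0 ?f] by blast
  have cU: "set c \<subseteq> U" "c \<noteq> []" using c by (auto simp: dicycle_def dipath_def)
  have "cls ` U \<subseteq> cls ` set c"
  proof (rule ccontr)
    assume "\<not> cls ` U \<subseteq> cls ` set c"
    then obtain u where u: "u \<in> U" "cls u \<notin> cls ` set c" by blast
    have "\<exists>q. dicycle U q \<and> set c \<subseteq> set q \<and> u \<in> set q"
    proof -
      have hc: "hd c \<in> set c" using cU by simp
      have "E u (hd c) \<or> E (hd c) u" using adj_uncovered[OF U cU(1) u hc] .
      then show ?thesis
      proof
        assume "E u (hd c)"
        then show ?thesis using extend_cycle[OF U c u _ hc] strong u by blast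
      next
        assume "E (hd c) u"
        moreover have "conv.dicycle U (rev c)" using c conv cU by blast
        ultimately obtain q where q: "conv.dicycle U q" "set c \<subseteq> set q" "u \<in> set q"
          using conv.extend_cycle[OF U, of "rev c" u "hd c"] u hc strong reach_converse[of E U] unfolding set_rev by blast
        have "q \<noteq> []" using q by auto
        then have "dicycle U (rev q)" using q conv[of "rev q"] by simp
        then show ?thesis using q by (intro exI[of _ "rev q"]) auto
      qed
    qed
    then obtain q where q: "dicycle U q" "set c \<subseteq> set q" "u \<in> set q" by blast
    then have "?f c < ?f q" using u by (intro card_cls_grow) auto
    then show False using max[OF q(1)] by simp
  qed
  then show ?thesis using c cU by (intro exI[of _ c]) auto
qed

end

context multipartite
begin

section \<open>Strong and non-strong remainders\<close>

text \<open>If \<open>u\<close> does not fit between two vertices of \<open>p\<close>, it is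
  dominated by all of \<open>p\<close> or dominates all of \<open>p\<close>. A path from
  \<open>u\<close> to \<open>t\<close>, or from \<open>s\<close> to \<open>u\<close>, then supplies
  a detour; as \<open>t\<close> does not reach \<open>s\<close>, the detour can neither return at
  \<open>s\<close> nor leave at \<open>t\<close>, so both ends of \<open>p\<close> are kept.\<close>

lemma extend_terminal_path:
  assumes U: "U \<subseteq> V" and p: "dipath E U p" "hd p = s" "last p = t" and nts: "\<not> reach E U t s"
    and u: "u \<in> U" "cls u \<notin> cls ` set p" "reach E U s u" "reach E U u t"
  shows "\<exists>q. dipath E U q \<and> hd q = s \<and> last q = t \<and> set p \<subseteq> set q \<and> u \<in> set q"
proof -
  have pne: "p \<noteq> []" and pU: "set p \<subseteq> U" using p by (auto simp: dipath_def)
  have up: "u \<notin> set p" using u by blast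
  have adju: "E u v \<or> E v u" if "v \<in> set p" for v using adj_uncovered[OF U pU u(1,2) that] .
  have st: "s \<in> set p" "t \<in> set p" using p pne by auto
  have ins: ?thesis if "p = as @ a # bs" "E a u" "v \<in> set bs" "E u v" for as a bs v
  proof -
    have "\<exists>q. dipath E U q \<and> hd q = hd (as @ a # bs) \<and> last q = last (as @ a # bs) \<and>
      set q = insert u (set (as @ a # bs))"
      by (rule dipath_insert) (use that p u(1) up adju in auto)
    then show ?thesis using p that(1) by blast
  qed
  have splice: ?thesis if s: "p = (as @ [a]) @ b # bs" and q: "dipath E (U - set p) q" "E a (hd q)" "E (last q) b" "u \<in> set q"
    for as a b bs q
  proof -
    have d: "dipath E U (as @ [a])" "dipath E U (b # bs)" "set (as @ [a]) \<inter> set (b # bs) = {}"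
      using p(1) unfolding s by (subst (asm) dipath_append; simp)+
    have q': "dipath E U q" "set q \<inter> set p = {}" "q \<noteq> []" using q by (auto simp: dipath_def)
    have "dipath E U ((as @ [a]) @ q)" using d q q' s by (subst dipath_append) auto
    then have "dipath E U (((as @ [a]) @ q) @ b # bs)" using d q q' s by (subst dipath_append) auto
    moreover have "hd (((as @ [a]) @ q) @ b # bs) = s" using p(2) s by (cases as) auto
    moreover have "last (((as @ [a]) @ q) @ b # bs) = t" using p(3) s by auto
    ultimately show ?thesis using q s by (intro exI[of _ "((as @ [a]) @ q) @ b # bs"]) auto
  qed
  have tU: "t \<in> U" "s \<in> U" using st pU by auto
  show ?thesis
  proof (cases "E t u")
    case True
    have tu: "reach E U t u" using True tU u by (simp add: reach_arc)
    have "\<not> E u s"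
    proof
      assume "E u s"
      then have "reach E U u s" using tU u by (simp add: reach_arc)
      then show False using reach_trans[OF tu] nts by blast
    qed
    then have su: "E s u" using adju[OF st(1)] by blast
    obtain bs where s: "p = [] @ s # bs" using p pne by (cases p) auto
    show ?thesis
    proof (cases "\<exists>v\<in>set p. E u v")
      case True
      then obtain v where "v \<in> set p" "E u v" by blast
      then have "v \<in> set bs" using s \<open>\<not> E u s\<close> by auto
      then show ?thesis using ins[OF s su _ \<open>E u v\<close>] by blast
    next
      case False
      then have all: "E v u" if "v \<in> set p" for v using adju that by blast
      obtain w where w: "dipath E U w" "hd w = u" "last w = t" using u(4) by (auto simp: reach_def)
      have "t \<in> set w" using w by (auto simp: dipath_def)
      then have hit: "set w \<inter> set p \<noteq> {}" using st by blast
      obtain c q where c: "c \<in> set p" "dipath E (U - set p) q" "E (last q) c" "hd q = u"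
        using dipath_first_entry[OF w(1) hit] w(2) up by metis
      have qne: "q \<noteq> []" and qd: "dipath E U q" using c(2) by (auto simp: dipath_def)
      \<comment> \<open>A return at \<open>s\<close> would let \<open>t\<close> reach
        \<open>s\<close> through \<open>u\<close>. So \<open>c\<close> has a predecessor on
        \<open>p\<close>, and this predecessor dominates \<open>u\<close>.\<close>
      have "c \<noteq> s"
      proof
        assume "c = s"
        then have "dipath E U (q @ [s])" using qd qne c tU st(1)
          by (subst dipath_append) (auto simp: dipath_single dipath_def)
        then have "reach E U u s" using c qne by (auto simp: reach_def intro!: exI[of _ "q @ [s]"])
        then show False using reach_trans[OF tu] nts by blast
      qed
      then have "c \<in> set bs" using c(1) s by auto
      then obtain xs ys where xy: "bs = xs @ c # ys" by (meson split_list)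
      obtain as a where a: "s # xs = as @ [a]" by (metis append_butlast_last_id list.discI)
      have s': "p = (as @ [a]) @ c # ys" using s xy a by (metis append_Cons append_Nil)
      have "u \<in> set q" using c(4) qne by auto
      then show ?thesis using splice[OF s' c(2) _ c(3)] all c(4) s' by auto
    qed
  next
    case False
    then have ut: "E u t" using adju[OF st(2)] by blast
    have rut: "reach E U u t" by (rule u)
    show ?thesis
    proof (cases "\<exists>a\<in>set p. E a u")
      case True
      then obtain a as bs where s: "p = as @ a # bs" "E a u" by (meson split_list)
      have "bs \<noteq> []" using False s p by auto
      then have "t \<in> set bs" using s p by auto
      then show ?thesis using ins[OF s _ ut] by blast
    next
      case none: False
      then have all: "E u v" if "v \<in> set p" for v using adju that by blast
      have us: "reach E U u s" using all[OF st(1)] u tU by (simp add: reach_arc)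
      obtain w where w: "dipath E U w" "hd w = s" "last w = u" using u(3) by (auto simp: reach_def)
      have "s \<in> set w" using w by (auto simp: dipath_def)
      then have hit: "set w \<inter> set p \<noteq> {}" using st by blast
      obtain c q where c: "c \<in> set p" "dipath E (U - set p) q" "E c (hd q)" "last q = u"
        using dipath_last_exit[OF w(1) hit] w(3) up by metis
      have qne: "q \<noteq> []" and qd: "dipath E U q" using c(2) by (auto simp: dipath_def)
      have "c \<noteq> t"
      proof
        assume "c = t"
        then have "dipath E U ([t] @ q)" using qd qne c tU st(2)
          by (subst dipath_append) (auto simp: dipath_single dipath_def)
        then have "reach E U t u" using c qne by (auto simp: reach_def intro!: exI[of _ "[t] @ q"])
        then show False using reach_trans[OF _ us] nts by blast
      qed
      obtain as bs where s: "p = as @ c # bs" using c(1) by (meson split_list)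
      have "bs \<noteq> []" using \<open>c \<noteq> t\<close> s p by auto
      then obtain b bs' where b: "bs = b # bs'" by (cases bs) auto
      have s': "p = (as @ [c]) @ b # bs'" using s b by simp
      have "u \<in> set q" using c(4) qne by auto
      then show ?thesis using splice[OF s' c(2,3)] all c(4) s' by auto
    qed
  qed
qed

text \<open>The hypotheses put \<open>s\<close> in an initial and \<open>t\<close> in a terminal
  strong component. A vertex of a missed class is adjacent to both, hence reachable from
  \<open>s\<close> and able to reach \<open>t\<close>, and a path meeting the most classes can be
  extended by it.\<close>

lemma cover_path_nonstrong:
  assumes U: "U \<subseteq> V" and st: "reach E U s t" "\<not> reach E U t s"
    and s: "\<And>v. reach E U v s \<Longrightarrow> reach E U s v" and t: "\<And>v. reach E U t v \<Longrightarrow> reach E U v t"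
  shows "\<exists>p. dipath E U p \<and> hd p = s \<and> last p = t \<and> cls ` set p = cls ` U"
proof -
  let ?P = "\<lambda>p. dipath E U p \<and> hd p = s \<and> last p = t" and ?f = "\<lambda>p. card (cls ` set p)"
  have fU: "finite U" using U finite_V finite_subset by blast
  obtain p0 where "?P p0" using st by (auto simp: reach_def)
  moreover have "\<forall>q. ?P q \<longrightarrow> ?f q < Suc (card (cls ` U))"
    using fU by (auto simp: dipath_def less_Suc_eq_le intro!: card_mono image_mono)
  ultimately obtain p where p: "?P p" and max: "\<And>q. ?P q \<Longrightarrow> ?f q \<le> ?f p"
    using ex_has_greatest_nat[of ?P p0 ?f] by blast
  have pst: "s \<in> set p" "t \<in> set p" "set p \<subseteq> U" using p by (auto simp: dipath_def)
  have "cls ` U \<subseteq> cls ` set p"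
  proof (rule ccontr)
    assume "\<not> cls ` U \<subseteq> cls ` set p"
    then obtain u where u: "u \<in> U" "cls u \<notin> cls ` set p" by blast
    have "reach E U s u"
    proof -
      have "E u s \<or> E s u" using adj_uncovered[OF U pst(3) u pst(1)] .
      then show ?thesis using s reach_arc[of u U s E] reach_arc[of s U u E] pst u by blast
    qed
    moreover have "reach E U u t"
    proof -
      have "E u t \<or> E t u" using adj_uncovered[OF U pst(3) u pst(2)] .
      then show ?thesis using t reach_arc[of u U t E] reach_arc[of t U u E] pst u by blast
    qed
    ultimately obtain q where q: "?P q" "set p \<subseteq> set q" "u \<in> set q"
      using extend_terminal_path[OF U, of p s t u] p st u by blast
    then have "?f p < ?f q" using u by (intro card_cls_grow) auto
    then show False using max[OF q(1)] by simp
  qed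
  then show ?thesis using p by (intro exI[of _ p]) (auto simp: dipath_def)
qed

text \<open>\<open>s\<close> reaches the most vertices, and \<open>t\<close> the fewest among those
  reached from \<open>s\<close>. If \<open>t\<close> reached \<open>s\<close>, no arc would join the
  vertices reached from \<open>s\<close> to the others, so that \<open>U\<close> would be strong or
  lie in one class.\<close>

lemma nonstrong_ends:
  assumes U: "U \<subseteq> V" and uv: "u0 \<in> U" "v0 \<in> U" "cls u0 \<noteq> cls v0"
    and ns: "\<not> (\<forall>u\<in>U. \<forall>v\<in>U. reach E U u v)"
  obtains s t where "s \<in> U" "t \<in> U" "reach E U s t" "\<not> reach E U t s"
    "\<And>v. reach E U v s \<Longrightarrow> reach E U s v" "\<And>v. reach E U t v \<Longrightarrow> reach E U v t"
proof -
  let ?R = "\<lambda>v. {w. reach E U v w}" let ?f = "\<lambda>v. card (?R v)"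
  have fU: "finite U" using U finite_V finite_subset by blast
  have fR: "finite (?R v)" for v
    by (rule finite_subset[OF _ fU]) (use reach_in in fast)
  have Rmono: "?R v \<subseteq> ?R u" if "reach E U u v" for u v using reach_trans[OF that] by blast
  have "\<forall>v. v \<in> U \<longrightarrow> ?f v < Suc (card U)"
    using card_mono[OF fU] reach_in by (metis (no_types, lifting) less_Suc_eq_le mem_Collect_eq subsetI)
  then obtain s where s: "s \<in> U" "\<And>v. v \<in> U \<Longrightarrow> ?f v \<le> ?f s"
    using ex_has_greatest_nat[of "\<lambda>v. v \<in> U" u0 ?f] uv by blast
  have sin: "reach E U s v" if "reach E U v s" for v
  proof -
    have "v \<in> U" using reach_in[OF that] by blast
    then have "?R s = ?R v" using card_seteq[OF fR Rmono[OF that]] s(2) by blast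
    then show ?thesis using reach_refl[OF \<open>v \<in> U\<close>, of E] by blast
  qed
  obtain t where t: "reach E U s t" "\<And>v. reach E U s v \<Longrightarrow> ?f t \<le> ?f v"
    using ex_has_least_nat[of "\<lambda>v. reach E U s v" s ?f] reach_refl[OF s(1), of E] by blast
  have tU: "t \<in> U" using reach_in[OF t(1)] by blast
  have tterm: "reach E U v t" if "reach E U t v" for v
  proof -
    have "?f t \<le> ?f v" using t(2)[OF reach_trans[OF t(1) that]] .
    then have "?R v = ?R t" using card_seteq[OF fR Rmono[OF that]] by blast
    then show ?thesis using reach_refl[OF tU, of E] by blast
  qed
  have "\<not> reach E U t s"
  proof
    assume ts: "reach E U t s"
    have ret: "reach E U v s" if "reach E U s v" for v
    proof -
      have "reach E U v t" by (rule tterm, rule reach_trans[OF ts that])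
      then show ?thesis by (rule reach_trans[OF _ ts])
    qed
    have sep: "cls v = cls w" if v: "v \<in> U" "\<not> reach E U s v" and w: "reach E U s w" for v w
    proof (rule ccontr)
      assume n: "cls v \<noteq> cls w"
      have wU: "w \<in> U" using reach_in[OF w] by blast
      then have "E v w \<or> E w v" using adj[of v w] subsetD[OF U v(1)] subsetD[OF U wU] n by simp
      then show False
      proof
        assume "E v w"
        then have "reach E U v w" using v(1) wU by (simp add: reach_arc)
        then have "reach E U v s" by (rule reach_trans[OF _ ret[OF w]])
        then show False using sin v(2) by simp
      next
        assume "E w v"
        then have "reach E U w v" using v(1) wU by (simp add: reach_arc)
        then show False using reach_trans[OF w] v(2) by simp
      qed
    qed
    have "\<exists>v\<in>U. \<not> reach E U s v"
    proof (rule ccontr)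
      assume n: "\<not> (\<exists>v\<in>U. \<not> reach E U s v)"
      have "reach E U u v" if "u \<in> U" "v \<in> U" for u v
      proof -
        have "reach E U s u" "reach E U s v" using n that by simp_all
        then show ?thesis using reach_trans[OF ret] by simp
      qed
      then show False using ns by simp
    qed
    then obtain v where v: "v \<in> U" "\<not> reach E U s v" by blast
    have vs: "cls v = cls s" using sep[OF v reach_refl[OF s(1)]] .
    have "cls w = cls s" if "w \<in> U" for w
    proof (cases "reach E U s w")
      case True then show ?thesis using sep[OF v True] vs by simp
    next
      case False then show ?thesis using sep[OF that False reach_refl[OF s(1)]] by simp
    qed
    then show False using uv by simp
  qed
  then show ?thesis by (rule that[OF s(1) tU t(1) _ sin tterm])
qed

text \<open>Go from \<open>e\<close> to the cycle and once around it, then cut after the last vertex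
  of \<open>N\<close> on the cycle.\<close>

lemma dipath_from_around:
  assumes c: "dicycle U c" and strong: "\<And>u v. u \<in> U \<Longrightarrow> v \<in> U \<Longrightarrow> reach E U u v"
    and e: "e \<in> U" and N: "N \<inter> set c \<noteq> {}"
  shows "\<exists>q. dipath E U q \<and> hd q = e \<and> last q \<in> N \<inter> set c \<and> N \<inter> set c \<subseteq> set q"
proof -
  have cU: "set c \<subseteq> U" using c by (auto simp: dicycle_def dipath_def)
  have "\<exists>r. dipath E U r \<and> hd r = e \<and> set c \<subseteq> set r"
  proof (cases "e \<in> set c")
    case True
    obtain bs where "dicycle U (e # bs)" "set (e # bs) = set c" using dicycle_start[OF c True] .
    then show ?thesis by (intro exI[of _ "e # bs"]) (auto simp: dicycle_def)
  next
    case False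
    obtain v where v: "v \<in> set c" using N by blast
    obtain w where w: "dipath E U w" "hd w = e" "last w = v" using strong[of e v] v e cU by (auto simp: reach_def)
    have "v \<in> set w" using w by (auto simp: dipath_def)
    then have hit: "set w \<inter> set c \<noteq> {}" using v by blast
    obtain b q where b: "b \<in> set c" "dipath E (U - set c) q" "E (last q) b" "hd q = e"
      using dipath_first_entry[OF w(1) hit] w(2) False by metis
    obtain bs where bs: "dicycle U (b # bs)" "set (b # bs) = set c" using dicycle_start[OF c b(1)] .
    have q: "dipath E U q" "q \<noteq> []" "set q \<inter> set c = {}" using b(2) by (auto simp: dipath_def)
    have "dipath E U (q @ (b # bs))" using q b bs by (subst dipath_append) (auto simp: dicycle_def)
    then show ?thesis using q b bs by (intro exI[of _ "q @ (b # bs)"]) auto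
  qed
  then obtain r where r: "dipath E U r" "hd r = e" "set c \<subseteq> set r" by blast
  have "\<exists>v\<in>set r. v \<in> N \<inter> set c" using N r by blast
  from split_list_last_prop[OF this] obtain as v bs
    where s: "r = as @ v # bs" "v \<in> N \<inter> set c" "\<forall>z\<in>set bs. z \<notin> N \<inter> set c" by blast
  have "dipath E U (as @ [v])" using r(1) s by (auto simp: dipath_def successively_append_iff)
  moreover have "hd (as @ [v]) = e" using r(2) s by (cases as) auto
  moreover have "N \<inter> set c \<subseteq> set (as @ [v])" using r(3) s by auto
  ultimately show ?thesis using s by (intro exI[of _ "as @ [v]"]) auto
qed

lemma dipath_around_to:
  assumes c: "dicycle U c" and strong: "\<And>u v. u \<in> U \<Longrightarrow> v \<in> U \<Longrightarrow> reach E U u v"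
    and e: "e \<in> U" and N: "N \<inter> set c \<noteq> {}"
  shows "\<exists>q. dipath E U q \<and> last q = e \<and> hd q \<in> N \<inter> set c \<and> N \<inter> set c \<subseteq> set q"
proof -
  interpret conv: multipartite V "\<lambda>u v. E v u" cls by (rule multipartite_converse)
  have "conv.dicycle U (rev c)"
    using c by (auto simp: conv.dicycle_def dicycle_def dipath_rev hd_rev last_rev dipath_def)
  then obtain q where q: "dipath (\<lambda>u v. E v u) U q" "hd q = e" "last q \<in> N \<inter> set c" "N \<inter> set c \<subseteq> set q"
    using conv.dipath_from_around[of U "rev c" e N] strong e N reach_converse[of E U] unfolding set_rev by blast
  then show ?thesis using dipath_rev_ex[OF q(1)] by (intro exI[of _ "rev q"]) auto
qed

end

section \<open>Two short disjoint paths\<close>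

text \<open>A rail is one vertex of \<open>S \<inter> T\<close> or an arc from \<open>S\<close> to
  \<open>T\<close>. By the last two assumptions, deleting one vertex of \<open>H\<close> cuts
  nothing off from \<open>S\<close> or \<open>T\<close>; this is what the 2-strength of
  \<open>D - y\<close> and \<open>D - x\<close> provides.\<close>

locale two_rails = multipartite V E cls
  for V :: "'a set" and E :: "'a \<Rightarrow> 'a \<Rightarrow> bool" and cls :: "'a \<Rightarrow> 'c" +
  fixes H S T :: "'a set" and r1 r2 :: "'a list"
  assumes HV: "H \<subseteq> V" and SH: "S \<subseteq> H" and TH: "T \<subseteq> H"
    and r1: "dipath E H r1" "hd r1 \<in> S" "last r1 \<in> T" "length r1 \<le> 2"
    and r2: "dipath E H r2" "hd r2 \<in> S" "last r2 \<in> T" "length r2 \<le> 2"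
    and disj: "set r1 \<inter> set r2 = {}"
    and from_S: "\<And>v w. v \<in> H \<Longrightarrow> w \<in> H \<Longrightarrow> v \<noteq> w \<Longrightarrow> \<exists>s\<in>S - {v}. reach E (H - {v}) s w"
    and to_T: "\<And>v w. v \<in> H \<Longrightarrow> w \<in> H \<Longrightarrow> v \<noteq> w \<Longrightarrow> \<exists>t\<in>T - {v}. reach E (H - {v}) w t"
begin

definition R where "R = set r1 \<union> set r2"
definition U where "U = H - R"

definition covered where
  "covered \<longleftrightarrow> (\<exists>vs. bipolar E S T vs \<and> set vs \<subseteq> H \<and> cls ` set vs = cls ` H)"

text \<open>A path in \<open>U\<close> from \<open>s\<close> to \<open>p\<close> can be merged with the two rails into a bipolar ordering.\<close>

definition good :: "'a \<Rightarrow> 'a \<Rightarrow> bool" where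
  "good s p \<longleftrightarrow> (en r1 s \<and> ex p r2) \<or> (en r2 s \<and> ex p r1) \<or>
    (s \<in> S \<and> (p \<in> T \<or> ex p r1 \<or> ex p r2)) \<or> (p \<in> T \<and> (en r1 s \<or> en r2 s)) \<or>
    (length r1 = 2 \<and> E (hd r1) s \<and> E p (last r1)) \<or> (length r2 = 2 \<and> E (hd r2) s \<and> E p (last r2))"

lemma swap: "two_rails V E cls H S T r2 r1"
proof
  show "set r2 \<inter> set r1 = {}" using disj by blast
qed (fact HV SH TH r1 r2 from_S to_T)+

lemma good_swap: "two_rails.good E S T r2 r1 s p \<longleftrightarrow> good s p"
proof -
  interpret sw: two_rails V E cls H S T r2 r1 by (rule swap)
  show ?thesis unfolding good_def sw.good_def by argo
qed

lemma RH: "R \<subseteq> H" using r1 r2 by (auto simp: R_def dipath_def)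
lemma UV: "U \<subseteq> V" using HV by (auto simp: U_def)
lemma r_ne: "r1 \<noteq> []" "r2 \<noteq> []" using r1 r2 by (auto simp: dipath_def)

lemma rail_cases:
  obtains (one) a where "r1 = [a]" | (two) a c where "r1 = [a, c]"
  using r1(4) r_ne(1) by (cases r1; cases "tl r1"; cases "tl (tl r1)") auto

lemma good_detour:
  assumes q: "dipath E U q" and g: "length r1 = 2" "E (hd r1) (hd q)" "E (last q) (last r1)"
  shows "\<exists>vs. bipolar E S T vs \<and> set vs = R \<union> set q"
proof -
  obtain a c where ac: "r1 = [a, c]" using rail_cases g(1) by (metis One_nat_def length_Cons list.size(3) n_not_Suc_n numeral_2_eq_2)
  have s: "successively E r2" "successively E q" "q \<noteq> []" using r2 q unfolding dipath_def by simp_all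
  have "distinct r1" "distinct r2" "distinct q" "set q \<inter> set r1 = {}" "set q \<inter> set r2 = {}"
    using r1 r2 q unfolding dipath_def U_def R_def by auto
  then have d: "distinct ([a] @ q @ [c] @ r2)" using disj unfolding ac by auto
  have e: "a \<in> S" "c \<in> T" "E a (hd q)" "E (last q) c" using r1(2,3) g(2,3) unfolding ac by simp_all
  have "fwd E S ([a] @ q @ [c] @ r2)"
    unfolding fwd_append using s e r2(2) by (intro conjI fwd_path) auto
  moreover have "bwd E T ([a] @ q @ [c] @ r2)"
    unfolding rev_append fwd_append using s e r2(3)
    by (intro conjI fwd_path) (auto simp: hd_rev)
  ultimately have "bipolar E S T ([a] @ q @ [c] @ r2)" using d by (simp add: bipolar_def)
  moreover have "set ([a] @ q @ [c] @ r2) = R \<union> set q" unfolding R_def unfolding ac by auto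
  ultimately show ?thesis by blast
qed

lemma good_through:
  assumes q: "dipath E U q" and g: "en r1 (hd q)" "ex (last q) r2"
  shows "\<exists>vs. bipolar E S T vs \<and> set vs = R \<union> set q"
proof -
  have s: "successively E r1" "successively E r2" "successively E q" and d: "distinct (r1 @ q @ r2)"
    using r1 r2 q disj unfolding dipath_def U_def R_def by auto
  have "fwd E S (r1 @ q @ r2)"
    unfolding fwd_append using s g(1) r1(2) r2(2) by (intro conjI fwd_path) (auto simp: en_def)
  moreover have "bwd E T (r1 @ q @ r2)"
    unfolding rev_append fwd_append using s g(2) r1(3) r2(3)
    by (intro conjI fwd_path) (auto simp: hd_rev ex_def)
  ultimately have "bipolar E S T (r1 @ q @ r2)" using d by (simp add: bipolar_def)
  then show ?thesis by (intro exI[of _ "r1 @ q @ r2"]) (auto simp: R_def)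
qed

lemma good_path:
  assumes q: "dipath E U q" and g: "good (hd q) (last q)"
  shows "\<exists>vs. bipolar E S T vs \<and> set vs = R \<union> set q"
proof -
  interpret sw: two_rails V E cls H S T r2 r1 by (rule swap)
  have R': "sw.R = R" "sw.U = U" by (auto simp: R_def sw.R_def U_def sw.U_def)
  have s: "successively E r1" "successively E r2" "successively E q"
    and d: "distinct (q @ r1 @ r2)" "distinct (r1 @ r2 @ q)"
    using r1 r2 q disj unfolding dipath_def U_def R_def by auto
  consider "en r1 (hd q)" "ex (last q) r2" | "en r2 (hd q)" "ex (last q) r1"
    | "hd q \<in> S" "last q \<in> T \<or> (\<exists>z\<in>R. E (last q) z)"
    | "last q \<in> T" "\<exists>z\<in>R. E z (hd q)"
    | "length r1 = 2" "E (hd r1) (hd q)" "E (last q) (last r1)"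
    | "length r2 = 2" "E (hd r2) (hd q)" "E (last q) (last r2)"
    using g unfolding good_def R_def en_def ex_def by blast
  then show ?thesis
  proof cases
    case 1 then show ?thesis using good_through[OF q] by blast
  next
    case 2 then show ?thesis using sw.good_through[unfolded R', OF q] by blast
  next
    case 3
    have "fwd E S (q @ r1 @ r2)"
      unfolding fwd_append using s 3(1) r1(2) r2(2) by (intro conjI fwd_path) auto
    moreover have "bwd E T (q @ r1 @ r2)"
      unfolding rev_append fwd_append using s 3(2) r1(3) r2(3)
      by (intro conjI fwd_path) (auto simp: hd_rev R_def)
    ultimately have "bipolar E S T (q @ r1 @ r2)" using d by (simp add: bipolar_def)
    then show ?thesis by (intro exI[of _ "q @ r1 @ r2"]) (auto simp: R_def)
  next
    case 4
    have "fwd E S (r1 @ r2 @ q)"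
      unfolding fwd_append using s 4(2) r1(2) r2(2) by (intro conjI fwd_path) (auto simp: R_def)
    moreover have "bwd E T (r1 @ r2 @ q)"
      unfolding rev_append fwd_append using s 4(1) r1(3) r2(3)
      by (intro conjI fwd_path) (auto simp: hd_rev)
    ultimately have "bipolar E S T (r1 @ r2 @ q)" using d by (simp add: bipolar_def)
    then show ?thesis by (intro exI[of _ "r1 @ r2 @ q"]) (auto simp: R_def)
  next
    case 5 then show ?thesis using good_detour[OF q] by blast
  next
    case 6 then show ?thesis using sw.good_detour[unfolded R', OF q] by blast
  qed
qed

lemma coveredI:
  assumes q: "dipath E U q" and g: "good (hd q) (last q)" and c: "cls ` U \<subseteq> cls ` R \<union> cls ` set q"
  shows covered
proof -
  obtain vs where vs: "bipolar E S T vs" "set vs = R \<union> set q" using good_path[OF q g] by blast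
  have qU: "set q \<subseteq> U" using q by (auto simp: dipath_def)
  have "H = U \<union> R" using RH by (auto simp: U_def)
  then have "cls ` H = cls ` U \<union> cls ` R" by (metis image_Un)
  moreover have "cls ` set vs = cls ` R \<union> cls ` set q" using vs(2) by (metis image_Un)
  moreover have "cls ` set q \<subseteq> cls ` U" using qU by (rule image_mono)
  moreover have "X \<union> Y = Z \<union> X" if "Y \<subseteq> Z" "Z \<subseteq> X \<union> Y" for X Y Z :: "'c set" using that by blast
  ultimately have "cls ` set vs = cls ` H" using c by metis
  moreover have "set vs \<subseteq> H" using vs(2) RH qU by (auto simp: U_def)
  ultimately show ?thesis using vs(1) unfolding covered_def by blast
qed

text \<open>Deleting \<open>v\<close> beforehand shows that no single rail vertex controls access to
  the remainder. \<open>good_ends_aux\<close> plays the free choice of \<open>v\<close> against the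
  first and the last vertex of a rail.\<close>

lemma entry:
  assumes "w \<in> U" "v \<in> R"
  shows "\<exists>e\<in>U. (e \<in> S \<or> (\<exists>z\<in>R - {v}. E z e)) \<and> reach E U e w"
proof -
  have "v \<in> H" "w \<in> H" "v \<noteq> w" using assms RH by (auto simp: U_def)
  then have "\<exists>s\<in>S - {v}. reach E (H - {v}) s w" by (rule from_S)
  then have "\<exists>e. e \<in> H - {v} - (R - {v}) \<and> (e \<in> S - {v} \<or> (\<exists>z\<in>R - {v}. E z e)) \<and> reach E (H - {v} - (R - {v})) e w"
    using assms by (intro entry_reach) (auto simp: U_def)
  moreover have "H - {v} - (R - {v}) = U" using assms by (auto simp: U_def)
  ultimately show ?thesis by auto
qed

lemma exit:
  assumes "w \<in> U" "v \<in> R"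
  shows "\<exists>e\<in>U. (e \<in> T \<or> (\<exists>z\<in>R - {v}. E e z)) \<and> reach E U w e"
proof -
  have "v \<in> H" "w \<in> H" "v \<noteq> w" using assms RH by (auto simp: U_def)
  then have "\<exists>t\<in>T - {v}. reach E (H - {v}) w t" by (rule to_T)
  then have "\<exists>e. e \<in> H - {v} - (R - {v}) \<and> (e \<in> T - {v} \<or> (\<exists>z\<in>R - {v}. E e z)) \<and> reach E (H - {v} - (R - {v})) w e"
    using assms by (intro exit_reach) (auto simp: U_def)
  moreover have "H - {v} - (R - {v}) = U" using assms by (auto simp: U_def)
  ultimately show ?thesis by auto
qed

text \<open>If \<open>s1\<close> is entered from \<open>r1\<close> and no pair is good, no vertex of
  \<open>F\<close> leads to \<open>r2\<close>, and so no vertex of \<open>I\<close> is entered from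
  \<open>r2\<close>. Excluding the first vertex of \<open>r1\<close> gives an exit to its second
  one, excluding the second an entry from the first: together a detour inside
  \<open>r1\<close>.\<close>

lemma good_ends_aux:
  assumes en: "\<And>v. v \<in> R \<Longrightarrow> \<exists>s\<in>I. \<exists>z\<in>R - {v}. E z s" and ex: "\<And>v. v \<in> R \<Longrightarrow> \<exists>t\<in>F. \<exists>z\<in>R - {v}. E t z"
    and s1: "s1 \<in> I" "en r1 s1"
  shows "\<exists>s\<in>I. \<exists>t\<in>F. good s t"
proof (rule ccontr)
  assume n: "\<not> (\<exists>s\<in>I. \<exists>t\<in>F. good s t)"
  then have nex: "\<not> ex t r2" if "t \<in> F" for t using s1 that unfolding good_def by blast
  have "hd r1 \<in> R" using r_ne by (simp add: R_def)
  then obtain t0 z0 where t0: "t0 \<in> F" "z0 \<in> R - {hd r1}" "E t0 z0" using ex by blast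
  then have "z0 \<in> set r1" using nex[OF t0(1)] by (auto simp: R_def ex_def)
  then have "ex t0 r1" using t0 by (auto simp: ex_def)
  then have nen: "\<not> en r2 s" if "s \<in> I" for s using n that t0(1) unfolding good_def by blast
  show False
  proof (cases rule: rail_cases)
    case (one a)
    then show ?thesis using t0 \<open>z0 \<in> set r1\<close> unfolding one by auto
  next
    case (two a c)
    then have "c \<in> R" "a \<in> R" unfolding R_def by simp_all
    then obtain s z where s: "s \<in> I" "z \<in> R - {c}" "E z s" using en by blast
    then have "z \<in> set r1" "z \<noteq> c" using nen[OF s(1)] by (auto simp: R_def en_def)
    then have "z = a" unfolding two by simp
    moreover have "z0 = c" using t0 \<open>z0 \<in> set r1\<close> unfolding two by auto
    ultimately have "good s t0" using s t0 two unfolding good_def by simp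
    then show ?thesis using n s(1) t0(1) by blast
  qed
qed

lemma good_ends:
  assumes en: "\<And>v. v \<in> R \<Longrightarrow> \<exists>s\<in>I. s \<in> S \<or> (\<exists>z\<in>R - {v}. E z s)"
    and ex: "\<And>v. v \<in> R \<Longrightarrow> \<exists>t\<in>F. t \<in> T \<or> (\<exists>z\<in>R - {v}. E t z)"
  shows "\<exists>s\<in>I. \<exists>t\<in>F. good s t"
proof (rule ccontr)
  interpret sw: two_rails V E cls H S T r2 r1 by (rule swap)
  have R': "sw.R = R" by (auto simp: R_def sw.R_def)
  assume n: "\<not> (\<exists>s\<in>I. \<exists>t\<in>F. good s t)"
  have h: "hd r1 \<in> R" using r_ne by (simp add: R_def)
  have "s \<notin> S" if s: "s \<in> I" for s
  proof
    assume "s \<in> S"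
    moreover obtain t where "t \<in> F" "t \<in> T \<or> ex t r1 \<or> ex t r2"
      using ex[OF h] unfolding ex_def R_def by blast
    ultimately show False using n s unfolding good_def by blast
  qed
  then have en': "\<exists>s\<in>I. \<exists>z\<in>R - {v}. E z s" if "v \<in> R" for v using en[OF that] by blast
  have "t \<notin> T" if t: "t \<in> F" for t
  proof
    assume "t \<in> T"
    moreover obtain s where "s \<in> I" "en r1 s \<or> en r2 s"
      using en'[OF h] unfolding en_def R_def by blast
    ultimately show False using n t unfolding good_def by blast
  qed
  then have ex': "\<exists>t\<in>F. \<exists>z\<in>R - {v}. E t z" if "v \<in> R" for v using ex[OF that] by blast
  obtain s where s: "s \<in> I" "en r1 s \<or> en r2 s" using en'[OF h] unfolding en_def R_def by blast
  then show False
    using n good_ends_aux[OF en' ex' s(1)] sw.good_ends_aux[unfolded R' good_swap, OF en' ex' s(1)] by blast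
qed

text \<open>Entries from which \<open>s0\<close> is reached and exits reached from \<open>t0\<close>
  lie in the components of \<open>s0\<close> and \<open>t0\<close>. So a good pair among them
  inherits the conditions of \<open>cover_path_nonstrong\<close>.\<close>

lemma covered_nonstrong:
  assumes ns: "\<not> (\<forall>u\<in>U. \<forall>v\<in>U. reach E U u v)" and uv: "u0 \<in> U" "v0 \<in> U" "cls u0 \<noteq> cls v0"
  shows covered
proof -
  obtain s0 t0 where st: "s0 \<in> U" "t0 \<in> U" "reach E U s0 t0" "\<not> reach E U t0 s0"
    "\<And>v. reach E U v s0 \<Longrightarrow> reach E U s0 v" "\<And>v. reach E U t0 v \<Longrightarrow> reach E U v t0"
    using nonstrong_ends[OF UV uv ns] by blast
  let ?I = "{s. reach E U s s0}" and ?F = "{t. reach E U t0 t}"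
  have "\<exists>s\<in>?I. \<exists>t\<in>?F. good s t"
    using entry[OF st(1)] exit[OF st(2)] by (intro good_ends) blast+
  then obtain s t where s: "reach E U s s0" and t: "reach E U t0 t" and g: "good s t" by blast
  have 1: "reach E U s t" by (rule reach_trans[OF s reach_trans[OF st(3) t]])
  have 2: "\<not> reach E U t s" using reach_trans[OF reach_trans[OF t]] s st(4) by blast
  have 3: "reach E U s v" if "reach E U v s" for v
    by (rule reach_trans[OF s], rule st(5), rule reach_trans[OF that s])
  have 4: "reach E U v t" if "reach E U t v" for v
    by (rule reach_trans[OF _ t], rule st(6), rule reach_trans[OF t that])
  obtain p where p: "dipath E U p" "hd p = s" "last p = t" "cls ` set p = cls ` U"
    using cover_path_nonstrong[OF UV 1 2 3 4] by blast
  then show ?thesis using g by (intro coveredI[OF p(1)]) auto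
qed

end

section \<open>Strong remainder: vertices of uncovered classes around a cycle\<close>

lemma filter_eq_append: "filter P xs = ys @ zs \<Longrightarrow> \<exists>us vs. xs = us @ vs \<and> filter P us = ys \<and> filter P vs = zs"
proof (induction ys arbitrary: xs)
  case Nil
  then show ?case by (intro exI[of _ "[]"] exI[of _ xs]) simp
next
  case (Cons y ys)
  then obtain us vs where s: "xs = us @ y # vs" "\<forall>u\<in>set us. \<not> P u" "P y" "ys @ zs = filter P vs"
    using filter_eq_ConsD[of P xs y "ys @ zs"] by auto
  then obtain us' vs' where "vs = us' @ vs'" "filter P us' = ys" "filter P vs' = zs"
    using Cons.IH[of vs] by auto
  then show ?case using s by (intro exI[of _ "us @ y # us'"] exI[of _ vs']) (simp add: filter_empty_conv)
qed

text \<open>Set up for contradiction: the remainder is strong and \<open>c\<close> is a cycle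
  through all its classes, but \<open>covered\<close> fails. Only \<open>N\<close>, the vertices of
  classes absent from the rails, has to be collected, and these are adjacent to every rail
  vertex.\<close>

locale cyclic_rails = two_rails V E cls H S T r1 r2
  for V :: "'a set" and E :: "'a \<Rightarrow> 'a \<Rightarrow> bool" and cls :: "'a \<Rightarrow> 'c" and H S T :: "'a set" and r1 r2 :: "'a list" +
  fixes c :: "'a list" and N :: "'a set"
  assumes c: "dicycle U c" "cls ` set c = cls ` U"
    and strong: "\<And>u v. u \<in> U \<Longrightarrow> v \<in> U \<Longrightarrow> reach E U u v"
    and N_def: "N = {v \<in> U. cls v \<notin> cls ` R}"
    and N_ne: "N \<noteq> {}"
    and not_covered: "\<not> covered"
begin

definition ds where "ds = filter (\<lambda>v. v \<in> N) c"
definition n where "n = length ds"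
text \<open>Indices are read modulo \<open>n\<close>. A step backwards is written
  \<open>k + n - 1\<close> or \<open>k + (n - 1)\<close>, because subtraction on naturals would stop
  at zero.\<close>

definition d where "d k = ds ! (k mod n)"

lemma cU: "set c \<subseteq> U" using c by (auto simp: dicycle_def dipath_def)

lemma set_ds: "set ds = N \<inter> set c" by (auto simp: ds_def)

lemma cls_N: "cls ` N = cls ` set ds"
proof
  show "cls ` N \<subseteq> cls ` set ds"
  proof
    fix x assume "x \<in> cls ` N"
    then obtain v where v: "v \<in> N" "x = cls v" by blast
    then have "cls v \<in> cls ` set c" using c(2) unfolding N_def by auto
    then obtain w where w: "w \<in> set c" "cls w = cls v" by auto
    then have "w \<in> N" using v(1) cU unfolding N_def by auto
    then have "w \<in> set ds" using w(1) set_ds by simp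
    then show "x \<in> cls ` set ds" using w(2) v(2) by (metis imageI)
  qed
qed (auto simp: set_ds)

lemma ds_ne: "ds \<noteq> []" using cls_N N_ne by auto
lemma n_pos: "0 < n" using ds_ne by (simp add: n_def)
lemma dist_ds: "distinct ds" using c by (auto simp: ds_def dicycle_def dipath_def)

lemma d_in: "d k \<in> N" "d k \<in> U" "d k \<in> set c"
proof -
  have "d k \<in> set ds" unfolding d_def n_def using n_pos by (simp add: n_def)
  then show "d k \<in> N" "d k \<in> U" "d k \<in> set c" using set_ds cU by auto
qed

lemma d_period: "d (k + n) = d k" by (simp add: d_def)

lemma d_eq: "d i = d j \<longleftrightarrow> i mod n = j mod n"
  using nth_eq_iff_index_eq[OF dist_ds] n_pos by (simp add: d_def n_def)

lemma set_ds_d: "v \<in> set ds \<longleftrightarrow> (\<exists>k. v = d k)"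
proof
  assume "v \<in> set ds"
  then obtain i where "i < n" "v = ds ! i" by (auto simp: in_set_conv_nth n_def)
  then show "\<exists>k. v = d k" by (intro exI[of _ i]) (simp add: d_def)
next
  assume "\<exists>k. v = d k"
  then show "v \<in> set ds" using d_in set_ds by auto
qed

lemma rotate_ds: "rotate k ds = map (\<lambda>j. d (k + j)) [0..<n]"
  by (rule nth_equalityI) (simp_all add: n_def d_def nth_rotate)

text \<open>Open the cycle just before \<open>d k\<close> and cut off what follows the last vertex
  of \<open>N\<close>; the vertices cut off lie in classes met by the rails.\<close>

lemma around: "\<exists>q. dipath E U q \<and> filter (\<lambda>v. v \<in> N) q = map (\<lambda>j. d (k + j)) [0..<n] \<and>
    hd q = d k \<and> last q = d (k + n - 1)"
proof -
  let ?P = "\<lambda>v. v \<in> N"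
  let ?i = "k mod n"
  have i: "?i < length ds" using n_pos by (simp add: n_def)
  have "filter ?P c = take ?i ds @ ds ! ?i # drop (Suc ?i) ds"
    using id_take_nth_drop[OF i] by (simp add: ds_def)
  then obtain us vs where uv: "c = us @ vs" "filter ?P us = take ?i ds" "filter ?P vs = ds ! ?i # drop (Suc ?i) ds"
    using filter_eq_append by blast
  then obtain us' bs where b: "vs = us' @ ds ! ?i # bs" "\<forall>u\<in>set us'. \<not> ?P u" "drop (Suc ?i) ds = filter ?P bs"
    using filter_eq_ConsD[OF uv(3)] by blast
  let ?c = "(ds ! ?i # bs) @ (us @ us')"
  have "c = (us @ us') @ (ds ! ?i # bs)" using uv(1) b(1) by simp
  then have "dicycle U ((us @ us') @ (ds ! ?i # bs))" using c(1) by (rule subst)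
  then have cc: "dicycle U ?c" by (rule dicycle_rotate)
  have dk: "ds ! ?i = d k" by (simp add: d_def)
  have "filter ?P us' = []" using b(2) by (simp add: filter_empty_conv)
  then have "filter ?P ?c = ds ! ?i # drop (Suc ?i) ds @ take ?i ds"
    using uv(2) b(3) d_in(1)[of k] dk by simp
  also have "\<dots> = drop ?i ds @ take ?i ds" using i by (metis Cons_nth_drop_Suc append_Cons)
  also have "\<dots> = rotate k ds" by (simp add: rotate_drop_take n_def)
  finally have f: "filter ?P ?c = map (\<lambda>j. d (k + j)) [0..<n]" by (simp add: rotate_ds)
  have "\<exists>v\<in>set ?c. ?P v" using d_in[of k] dk by auto
  from split_list_last_prop[OF this] obtain as w rs
    where s: "?c = as @ w # rs" "?P w" "\<forall>z\<in>set rs. \<not> ?P z" by blast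
  let ?q = "as @ [w]"
  have q: "dipath E U ?q" using cc unfolding s(1) dicycle_def by (auto simp: dipath_def successively_append_iff)
  have "filter ?P rs = []" using s(3) by (simp add: filter_empty_conv)
  then have fq: "filter ?P ?q = map (\<lambda>j. d (k + j)) [0..<n]" using f s(2) unfolding s(1) by simp
  have "hd ?q = hd ?c" unfolding s(1) by (cases as) auto
  then have h: "hd ?q = d k" using dk by simp
  have "last ?q = last (filter ?P ?q)" using s(2) by simp
  also have "\<dots> = d (k + (n - 1))" unfolding fq using n_pos by (simp add: last_map)
  also have "k + (n - 1) = k + n - 1" using n_pos by simp
  finally show ?thesis using q fq h by blast
qed

lemma not_good_cover:
  assumes q: "dipath E U q" and N: "cls ` set ds \<subseteq> cls ` set q"
  shows "\<not> good (hd q) (last q)"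
proof
  assume g: "good (hd q) (last q)"
  have "cls ` U \<subseteq> cls ` R \<union> cls ` set q"
  proof
    fix x assume "x \<in> cls ` U"
    then obtain v where v: "v \<in> U" "x = cls v" by blast
    show "x \<in> cls ` R \<union> cls ` set q"
    proof (cases "v \<in> N")
      case True
      then have "x \<in> cls ` N" using v by blast
      then show ?thesis using N unfolding cls_N by blast
    next
      case False then show ?thesis using v unfolding N_def by blast
    qed
  qed
  then show False using coveredI[OF q g] not_covered by blast
qed

text \<open>The tour from \<open>d (Suc k)\<close> around to \<open>d k\<close> collects all of
  \<open>ds\<close>, so good ends would make it a cover. This is the source of the alternation
  below.\<close>

lemma no_good_step: "\<not> good (d (Suc k)) (d k)"
proof -
  obtain q where q: "dipath E U q" "filter (\<lambda>v. v \<in> N) q = map (\<lambda>j. d (Suc k + j)) [0..<n]"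
    "hd q = d (Suc k)" "last q = d (Suc k + n - 1)" using around[of "Suc k"] by blast
  have "set ds = set (rotate (Suc k) ds)" by simp
  also have "\<dots> = set (filter (\<lambda>v. v \<in> N) q)" unfolding q(2) rotate_ds ..
  finally have "set ds \<subseteq> set q" by auto
  then have "\<not> good (hd q) (last q)" by (intro not_good_cover[OF q(1)] image_mono)
  moreover have "d (Suc k + n - 1) = d k" using d_period[of k] by simp
  ultimately show ?thesis using q by simp
qed

lemma normal_adj:
  assumes "v \<in> N" "z \<in> R" shows "E z v \<or> E v z"
proof -
  have "v \<in> V" "z \<in> V" using assms RH HV UV unfolding N_def by auto
  moreover have "cls z \<noteq> cls v" using assms unfolding N_def by (metis (mono_tags, lifting) imageI mem_Collect_eq)
  ultimately show ?thesis using adj[of z v] by blast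
qed

lemma en_ex1: "v \<in> N \<Longrightarrow> \<not> en r1 v \<Longrightarrow> z \<in> set r1 \<Longrightarrow> E v z"
  using normal_adj[of v z] unfolding R_def en_def by blast

lemma en_ex2: "v \<in> N \<Longrightarrow> \<not> en r2 v \<Longrightarrow> z \<in> set r2 \<Longrightarrow> E v z"
  using normal_adj[of v z] unfolding R_def en_def by blast

lemma ex_en1: "v \<in> N \<Longrightarrow> \<not> ex v r1 \<Longrightarrow> z \<in> set r1 \<Longrightarrow> E z v"
  using normal_adj[of v z] unfolding R_def ex_def by blast

lemma ex_en2: "v \<in> N \<Longrightarrow> \<not> ex v r2 \<Longrightarrow> z \<in> set r2 \<Longrightarrow> E z v"
  using normal_adj[of v z] unfolding R_def ex_def by blast

lemma hdlast_in: "hd r1 \<in> set r1" "hd r2 \<in> set r2" "last r1 \<in> set r1" "last r2 \<in> set r2"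
  using r_ne by auto

lemma not_en_imp_ex: "v \<in> N \<Longrightarrow> \<not> en r1 v \<Longrightarrow> ex v r1" "v \<in> N \<Longrightarrow> \<not> en r2 v \<Longrightarrow> ex v r2"
  using normal_adj[of v "hd r1"] normal_adj[of v "hd r2"] hdlast_in unfolding en_def ex_def R_def by blast+

lemma some_entry: "\<exists>e\<in>U. e \<in> S \<or> en r1 e \<or> en r2 e"
  and some_exit: "\<exists>e\<in>U. e \<in> T \<or> ex e r1 \<or> ex e r2"
proof -
  obtain w where w: "w \<in> U" using N_ne N_def by blast
  have h: "hd r1 \<in> R" using hdlast_in by (simp add: R_def)
  show "\<exists>e\<in>U. e \<in> S \<or> en r1 e \<or> en r2 e" using entry[OF w h] unfolding en_def R_def by blast
  show "\<exists>e\<in>U. e \<in> T \<or> ex e r1 \<or> ex e r2" using exit[OF w h] unfolding ex_def R_def by blast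
qed

lemma ds_meets: "N \<inter> set c \<noteq> {}" using ds_ne set_ds by auto

lemma from_entry:
  assumes "e \<in> U" obtains p where "p \<in> set ds" "\<not> good e p"
proof -
  obtain q where q: "dipath E U q" "hd q = e" "last q \<in> N \<inter> set c" "N \<inter> set c \<subseteq> set q"
    using dipath_from_around[OF c(1) strong assms ds_meets] by blast
  then have "\<not> good e (last q)" using not_good_cover[OF q(1)] set_ds by (metis image_mono)
  then show ?thesis using that[of "last q"] q set_ds by blast
qed

lemma to_exit:
  assumes "e \<in> U" obtains s where "s \<in> set ds" "\<not> good s e"
proof -
  obtain q where q: "dipath E U q" "last q = e" "hd q \<in> N \<inter> set c" "N \<inter> set c \<subseteq> set q"
    using dipath_around_to[OF c(1) strong assms ds_meets] by blast
  then have "\<not> good (hd q) e" using not_good_cover[OF q(1)] set_ds by (metis image_mono)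
  then show ?thesis using that[of "hd q"] q set_ds by blast
qed

text \<open>A vertex of \<open>N\<close> without entry dominates both rails; by
  \<open>no_good_step\<close> its successor then has no entry either, and so on around the cycle.
  But then a tour from any entry of \<open>U\<close> to any vertex of \<open>ds\<close> has good
  ends.\<close>

lemma has_entry: "en r1 (d k) \<or> en r2 (d k) \<or> d k \<in> S"
proof (rule ccontr)
  let ?NE = "\<lambda>v. \<not> en r1 v \<and> \<not> en r2 v \<and> v \<notin> S"
  assume "\<not> (en r1 (d k) \<or> en r2 (d k) \<or> d k \<in> S)"
  then have 0: "?NE (d (k + 0))" by simp
  have step: "?NE (d (Suc j))" if "?NE (d j)" for j
    using that not_en_imp_ex[OF d_in(1), of j] no_good_step[of j] unfolding good_def by blast
  have all: "?NE (d (k + j))" for j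
    by (induction j) (use 0 step in auto)
  have "?NE v" if vds: "v \<in> set ds" for v
  proof -
    obtain i where i: "v = d i" using vds unfolding set_ds_d by blast
    \<comment> \<open>Adding \<open>k * (n - 1)\<close> undoes the shift by \<open>k\<close> modulo
      \<open>n\<close>.\<close>
    have "(k + (i + k * (n - 1))) mod n = i mod n"
    proof -
      have "k + (i + k * (n - 1)) = i + k * n" using n_pos by (cases n) auto
      then show ?thesis by (metis mod_mult_self1)
    qed
    then have "d (k + (i + k * (n - 1))) = v" using i d_eq[of "k + (i + k * (n - 1))" i] by simp
    then show ?thesis using all by metis
  qed
  then have x: "ex v r1 \<and> ex v r2" if "v \<in> set ds" for v
    using that not_en_imp_ex[of v] unfolding set_ds by blast
  obtain e where e: "e \<in> U" "e \<in> S \<or> en r1 e \<or> en r2 e" using some_entry by blast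
  obtain p where "p \<in> set ds" "\<not> good e p" using from_entry[OF e(1)] .
  then show False using x e(2) unfolding good_def by blast
qed

lemma has_exit: "ex (d k) r1 \<or> ex (d k) r2 \<or> d k \<in> T"
proof (rule ccontr)
  let ?NX = "\<lambda>v. \<not> ex v r1 \<and> \<not> ex v r2 \<and> v \<notin> T"
  assume "\<not> (ex (d k) r1 \<or> ex (d k) r2 \<or> d k \<in> T)"
  then have 0: "?NX (d k)" by simp
  have step: "?NX (d j)" if "?NX (d (Suc j))" for j
    using that not_en_imp_ex[OF d_in(1), of "Suc j"] no_good_step[of j] unfolding good_def by blast
  have all: "?NX (d (m - j))" if "?NX (d m)" for j m
  proof (induction j)
    case (Suc j)
    show ?case
    proof (cases "m - j")
      case (Suc i)
      then have "m - Suc j = i" by simp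
      then show ?thesis using Suc.IH step[of i] Suc by simp
    qed (use Suc in simp)
  qed (use that in simp)
  have "?NX v" if vds: "v \<in> set ds" for v
  proof -
    obtain i where i: "v = d i" using vds unfolding set_ds_d by blast
    \<comment> \<open>The absence of exits moves backwards, so the start is first raised by
      \<open>i\<close> full turns, which puts its index at or above the target
      \<open>i\<close>.\<close>
    have "?NX (d (k + i * n))" using 0 d_eq[of "k + i * n" k] by simp
    then have "?NX (d (k + i * n - (k + i * n - i)))" by (rule all)
    moreover have "k + i * n - (k + i * n - i) = i" using n_pos by (simp add: trans_le_add2)
    ultimately show ?thesis using i by simp
  qed
  then have x: "en r1 v \<and> en r2 v" if "v \<in> set ds" for v
    using that not_en_imp_ex[of v] unfolding set_ds by blast
  obtain e where e: "e \<in> U" "e \<in> T \<or> ex e r1 \<or> ex e r2" using some_exit by blast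
  obtain p where "p \<in> set ds" "\<not> good p e" using to_exit[OF e(1)] .
  then show False using x e(2) unfolding good_def by blast
qed

text \<open>The two kinds of vertices in \<open>ds\<close>. Being adjacent to every rail vertex,
  \<open>d k\<close> of kind \<open>A\<close> is dominated by all of \<open>r1\<close> and dominates
  all of \<open>r2\<close>; kind \<open>B\<close> is the mirror image. Two vertices of equal kind
  are good ends.\<close>

definition A where "A k \<longleftrightarrow> en r1 (d k) \<and> ex (d k) r2 \<and> \<not> en r2 (d k) \<and> \<not> ex (d k) r1"
definition B where "B k \<longleftrightarrow> en r2 (d k) \<and> ex (d k) r1 \<and> \<not> en r1 (d k) \<and> \<not> ex (d k) r2"

text \<open>A vertex in \<open>S\<close> or \<open>T\<close>, one with entries from both rails, or
  one with exits to both rails would form a good pair with a cyclic neighbour. So would two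
  consecutive vertices of equal kind.\<close>

lemma AB: "A k \<or> B k" "\<not> (A k \<and> B k)" "A k \<Longrightarrow> B (Suc k)" "B k \<Longrightarrow> A (Suc k)"
proof -
  have nT: "d k \<notin> T" for k using no_good_step[of k] has_entry[of "Suc k"] unfolding good_def by blast
  have nS: "d k \<notin> S" for k
  proof -
    have "d (Suc (k + (n - 1))) = d k" using d_period[of k] n_pos by simp
    then show ?thesis using no_good_step[of "k + (n - 1)"] has_exit[of "k + (n - 1)"] unfolding good_def by metis
  qed
  have nx: "\<not> (ex (d k) r1 \<and> ex (d k) r2)" for k
    using no_good_step[of k] has_entry[of "Suc k"] unfolding good_def by blast
  have no_good_back: "\<not> good (d k) (d (k + (n - 1)))" for k
  proof -
    have "d (Suc (k + (n - 1))) = d k" using d_period[of k] n_pos by simp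
    then show ?thesis using no_good_step[of "k + (n - 1)"] by simp
  qed
  have nn: "\<not> (en r1 (d k) \<and> en r2 (d k))" for k
    using no_good_back[of k] has_exit[of "k + (n - 1)"] nT[of "k + (n - 1)"] unfolding good_def by blast
  show ab: "A k \<or> B k" for k
    using nT[of k] nS[of k] nx[of k] nn[of k] has_entry[of k] has_exit[of k] not_en_imp_ex[OF d_in(1), of k]
    unfolding A_def B_def by blast
  show "\<not> (A k \<and> B k)" unfolding A_def B_def by blast
  show "B (Suc k)" if "A k" using that ab[of "Suc k"] no_good_step[of k] unfolding A_def B_def good_def by blast
  show "A (Suc k)" if "B k" using that ab[of "Suc k"] no_good_step[of k] unfolding A_def B_def good_def by blast
qed

lemma A_period: "A (k + n) \<longleftrightarrow> A k" "B (k + n) \<longleftrightarrow> B k" by (simp_all add: A_def B_def d_period)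

text \<open>On a two-vertex rail the alternation offers a detour: some \<open>d k\<close> leads to
  its last vertex while \<open>d (Suc k)\<close> is entered from its first.\<close>

lemma single_rails: "length r1 = 1" "length r2 = 1"
proof -
  obtain k where k: "B k" using AB(1)[of 0] AB(3)[of 0] by blast
  have "length r1 \<noteq> 2"
  proof
    assume l: "length r1 = 2"
    have "E (d k) (last r1)" using en_ex1[OF d_in(1)] k hdlast_in unfolding B_def by blast
    moreover have "E (hd r1) (d (Suc k))"
      using ex_en1[OF d_in(1)] AB(4)[OF k] hdlast_in unfolding A_def by blast
    ultimately show False using no_good_step[of k] l unfolding good_def by blast
  qed
  moreover have "length r2 \<noteq> 2"
  proof
    assume l: "length r2 = 2"
    have k': "A (Suc k)" "B (Suc (Suc k))" using AB(4)[OF k] AB(3) by blast+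
    have "E (d (Suc k)) (last r2)" using en_ex2[OF d_in(1)] k' hdlast_in unfolding A_def by blast
    moreover have "E (hd r2) (d (Suc (Suc k)))"
      using ex_en2[OF d_in(1)] k' hdlast_in unfolding B_def by blast
    ultimately show False using no_good_step[of "Suc k"] l unfolding good_def by blast
  qed
  moreover have "length r1 \<noteq> 0" "length r2 \<noteq> 0" using r_ne by simp_all
  ultimately show "length r1 = 1" "length r2 = 1" using r1(4) r2(4) by linarith+
qed

text \<open>A vertex of \<open>S\<close> or \<open>T\<close> off the rails would be the end of a
  good tour, so both sets lie on the rails, and one-vertex rails lie in both sets. This is why the
  large count of classes is demanded only for \<open>S = T\<close>.\<close>

lemma S_eq_T: "S = T"
proof -
  have "S \<inter> U = {}"
  proof (rule ccontr)
    assume "S \<inter> U \<noteq> {}"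
    then obtain e where e: "e \<in> S" "e \<in> U" by blast
    obtain p where p: "p \<in> set ds" "\<not> good e p" using from_entry[OF e(2)] .
    obtain k where "p = d k" using p(1) unfolding set_ds_d by blast
    then show False using p e has_exit[of k] unfolding good_def by blast
  qed
  moreover have "T \<inter> U = {}"
  proof (rule ccontr)
    assume "T \<inter> U \<noteq> {}"
    then obtain e where e: "e \<in> T" "e \<in> U" by blast
    obtain p where p: "p \<in> set ds" "\<not> good p e" using to_exit[OF e(2)] .
    obtain k where "p = d k" using p(1) unfolding set_ds_d by blast
    then show False using p e has_entry[of k] unfolding good_def by blast
  qed
  ultimately have "S \<subseteq> R" "T \<subseteq> R" using SH TH by (auto simp: U_def)
  moreover have "R \<subseteq> S" "R \<subseteq> T"
    using r1 r2 single_rails unfolding R_def by (auto simp: length_Suc_conv)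
  ultimately show ?thesis by blast
qed

lemma B_prev: "A k \<Longrightarrow> B (k + n - 1)" "B k \<Longrightarrow> A (k + n - 1)"
proof -
  have s: "Suc (k + n - 1) = k + n" using n_pos by simp
  show "B (k + n - 1)" if "A k"
    using AB(1,2,3)[of "k + n - 1"] AB(2)[of k] that A_period[of k] unfolding s by blast
  show "A (k + n - 1)" if "B k"
    using AB(1,2,4)[of "k + n - 1"] AB(2)[of k] that A_period[of k] unfolding s by blast
qed

lemma good_same: "A i \<Longrightarrow> A j \<Longrightarrow> good (d i) (d j)" "B i \<Longrightarrow> B j \<Longrightarrow> good (d i) (d j)"
  unfolding A_def B_def good_def by blast+

text \<open>The two cyclic neighbours of \<open>d k\<close> have the same kind, so a tour omitting
  \<open>d k\<close> has good ends.\<close>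

lemma good_ends_around: "good (d (k + 1)) (d (k + n - 1))"
  using AB(1)[of k] AB(3,4)[of k] B_prev[of k] good_same[of "Suc k" "k + n - 1"] by auto

lemma set_ds_window: "set ds = d ` {k..<k + n}"
proof -
  have "set ds = set (rotate k ds)" by simp
  also have "\<dots> = (\<lambda>j. d (k + j)) ` {0..<n}" unfolding rotate_ds by simp
  also have "\<dots> = d ` {k..<k + n}"
  proof -
    have "(\<lambda>j. k + j) ` {0..<n} = {k..<k + n}" by (simp add: add.commute)
    then show ?thesis by (metis image_image)
  qed
  finally show ?thesis .
qed

lemma skip_one:
  assumes n1: "1 < n"
  shows "\<exists>p. dipath E U p \<and> filter (\<lambda>v. v \<in> N) p = map (\<lambda>j. d (k + j)) [1..<n] \<and> d k \<notin> set p \<and>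
    good (hd p) (last p)"
proof -
  let ?P = "\<lambda>v. v \<in> N"
  obtain q where q: "dipath E U q" "filter ?P q = map (\<lambda>j. d (k + j)) [0..<n]" "last q = d (k + n - 1)"
    using around[of k] by blast
  have "[0..<n] = 0 # 1 # [2..<n]" using n1 by (simp add: upt_conv_Cons numeral_2_eq_2)
  then have f: "filter ?P q = d k # d (k + 1) # map (\<lambda>j. d (k + j)) [2..<n]" using q(2) by simp
  obtain us q1 where q1: "q = us @ d k # q1" "d (k + 1) # map (\<lambda>j. d (k + j)) [2..<n] = filter ?P q1"
    using filter_eq_ConsD[OF f] by blast
  obtain us' q2 where q2: "q1 = us' @ d (k + 1) # q2" "map (\<lambda>j. d (k + j)) [2..<n] = filter ?P q2"
    using filter_eq_ConsD[OF q1(2)[symmetric]] by blast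
  let ?p = "d (k + 1) # q2"
  have qq: "q = (us @ d k # us') @ ?p" using q1 q2 by simp
  have "dipath E U ((us @ d k # us') @ ?p)" using q(1) qq by (rule subst[rotated])
  then have "dipath E U ?p" "d k \<notin> set ?p"
    using dipath_append[of "us @ d k # us'" ?p E U] by auto
  moreover have "filter ?P ?p = map (\<lambda>j. d (k + j)) [1..<n]"
  proof -
    have "[1..<n] = 1 # [2..<n]" using n1 by (simp add: upt_conv_Cons numeral_2_eq_2)
    then show ?thesis using q2(2) d_in(1)[of "k + 1"] by simp
  qed
  moreover have "last ?p = d (k + n - 1)" using q(3) unfolding qq by simp
  ultimately show ?thesis using good_ends_around[of k] by (intro exI[of _ ?p]) simp
qed

lemma no_good_superset:
  assumes "dipath E U q" "good (hd q) (last q)" shows "\<not> cls ` set ds \<subseteq> cls ` set q"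
  using not_good_cover[OF assms(1)] assms(2) by blast

text \<open>The tour omitting \<open>d k\<close> has good ends, so it must miss the class of
  \<open>d k\<close>, and \<open>d k\<close> must not fit into it. Thus among
  \<open>d (k + 1)\<close>, ..., \<open>d (k + n - 1)\<close> no vertex dominating
  \<open>d k\<close> precedes one dominated by it.\<close>

lemma insert_around:
  assumes ij: "1 \<le> i" "i < j" "j < n"
  shows "\<not> (E (d (k + i)) (d k) \<and> E (d k) (d (k + j)))" "cls (d k) \<noteq> cls (d (k + i))"
proof -
  let ?P = "\<lambda>v. v \<in> N"
  have "1 < n" using ij by simp
  then obtain p where p: "dipath E U p" "filter ?P p = map (\<lambda>j. d (k + j)) [1..<n]" "d k \<notin> set p"
    and g: "good (hd p) (last p)"
    using skip_one[of k] by blast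
  have sp: "d (k + m) \<in> set p" if "1 \<le> m" "m < n" for m
  proof -
    have "d (k + m) \<in> set (filter ?P p)" unfolding p(2) using that by auto
    then show ?thesis by simp
  qed
  have dsp: "set ds \<subseteq> insert (d k) (set p)"
  proof
    fix v assume "v \<in> set ds"
    then obtain m where m: "v = d m" "k \<le> m" "m < k + n" unfolding set_ds_window[of k] by auto
    then show "v \<in> insert (d k) (set p)" using sp[of "m - k"] by (cases "m = k") auto
  qed
  have nc: "cls (d k) \<notin> cls ` set p"
  proof
    assume "cls (d k) \<in> cls ` set p"
    then have "cls ` set ds \<subseteq> cls ` set p" using dsp by auto
    then show False using no_good_superset[OF p(1) g] by blast
  qed
  then show "cls (d k) \<noteq> cls (d (k + i))" using sp[of i] ij by force
  show "\<not> (E (d (k + i)) (d k) \<and> E (d k) (d (k + j)))"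
  proof
    assume e: "E (d (k + i)) (d k) \<and> E (d k) (d (k + j))"
    have "[1..<i + (n - i)] = [1..<i] @ [i..<i + (n - i)]" using ij(1) by (rule upt_add_eq_append)
    moreover have "i + (n - i) = n" "[i..<n] = i # [Suc i..<n]" using ij by (simp_all add: upt_conv_Cons)
    ultimately have "[1..<n] = [1..<i] @ i # [Suc i..<n]" by simp
    then have f: "filter ?P p = map (\<lambda>j. d (k + j)) [1..<i] @ d (k + i) # map (\<lambda>j. d (k + j)) [Suc i..<n]"
      using p(2) by simp
    obtain us vs where uv: "p = us @ vs" "filter ?P vs = d (k + i) # map (\<lambda>j. d (k + j)) [Suc i..<n]"
      using filter_eq_append[OF f] by blast
    obtain us' bs where b: "vs = us' @ d (k + i) # bs" "map (\<lambda>j. d (k + j)) [Suc i..<n] = filter ?P bs"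
      using filter_eq_ConsD[OF uv(2)] by blast
    have pp: "p = (us @ us') @ d (k + i) # bs" using uv b by simp
    have "d (k + j) \<in> set (filter ?P bs)" unfolding b(2)[symmetric] using ij by auto
    then have jb: "d (k + j) \<in> set bs" by simp
    have pU: "set p \<subseteq> U" using p(1) by (simp add: dipath_def)
    have "\<exists>q. dipath E U q \<and> hd q = hd ((us @ us') @ d (k + i) # bs) \<and>
      last q = last ((us @ us') @ d (k + i) # bs) \<and> set q = insert (d k) (set ((us @ us') @ d (k + i) # bs))"
    proof (rule dipath_insert)
      show "dipath E U ((us @ us') @ d (k + i) # bs)" using p(1) pp by simp
      show "d k \<notin> set ((us @ us') @ d (k + i) # bs)" using p(3) pp by simp
      show "E (d k) v \<or> E v (d k)" if "v \<in> set bs" for v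
        using adj_uncovered[OF UV pU d_in(2) nc, of v] that pp by simp
    qed (use d_in e jb in auto)
    then obtain q where q: "dipath E U q" "hd q = hd p" "last q = last p" "set q = insert (d k) (set p)"
      unfolding pp[symmetric] by blast
    have "cls ` set ds \<subseteq> cls ` set q" using dsp q(4) by (metis image_mono)
    then show False using no_good_superset[OF q(1)] g q by simp
  qed
qed

text \<open>Arcs from \<open>d k\<close> to \<open>d (k + 3)\<close> and from
  \<open>d (k + 2)\<close> to \<open>d (k + 4)\<close> would permit a tour from
  \<open>d (k + 1)\<close> that skips \<open>d (k + 3)\<close> and appends it after
  \<open>d k\<close>; its ends have equal kind and are good. For \<open>6 \<le> n\<close>,
  \<open>insert_around\<close> forces such a \<open>k\<close> to exist.\<close>

lemma n_less_6: "n < 6"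
proof (rule ccontr)
  let ?P = "\<lambda>v. v \<in> N"
  assume "\<not> n < 6"
  then have n6: "6 \<le> n" by simp
  have adjd: "E (d k) (d (k + i)) \<or> E (d (k + i)) (d k)" if "1 \<le> i" "i < n - 1" for k i
    using insert_around(2)[of i "n - 1" k] that adj[of "d k" "d (k + i)"] d_in UV by auto
  have adj2: "E (d (k + 2)) (d (k + 4)) \<or> E (d (k + 4)) (d (k + 2))" for k
  proof -
    have "1 \<le> (2::nat)" "2 < n - 1" "k + 2 + 2 = k + 4" using n6 by simp_all
    then show ?thesis using adjd[of 2 "k + 2"] by metis
  qed
  \<comment> \<open>Otherwise all arcs of step 3 point backwards. Then \<open>d (k + 3)\<close>
    dominates \<open>d k\<close>, which dominates \<open>d (k + (n - 3))\<close>: the forbidden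
    order for \<open>6 < n\<close>, and a contradictory arc of step 3 for
    \<open>n = 6\<close>.\<close>
  have ex1: "\<exists>k. E (d k) (d (k + 3))"
  proof (rule ccontr)
    assume a: "\<not> (\<exists>k. E (d k) (d (k + 3)))"
    then have b: "E (d (k + 3)) (d k)" for k using adjd[of 3 k] n6 by auto
    have "k + (n - 3) + 3 = k + n" for k using n6 by simp
    then have e: "E (d k) (d (k + (n - 3)))" for k using b[of "k + (n - 3)"] by (simp only: d_period)
    show False
    proof (cases "n = 6")
      case True
      then have "n - 3 = 3" by simp
      then show ?thesis using e[of 0] a by metis
    next
      case False
      then have "1 \<le> (3::nat)" "3 < n - 3" "n - 3 < n" using n6 by simp_all
      from insert_around(1)[OF this, of 0] show ?thesis using b[of 0] e[of 0] by blast
    qed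
  qed
  \<comment> \<open>\<open>d (k + 2)\<close> is also \<open>d (k + 4 + (n - 2))\<close>. As
    \<open>d (k + 4)\<close> dominates it, no vertex at a smaller distance after
    \<open>d (k + 4)\<close> can dominate \<open>d (k + 4)\<close>.\<close>
  have dom: "\<not> E (d (k + 4 + i)) (d (k + 4))" if "\<not> E (d (k + 2)) (d (k + 4))" "1 \<le> i" "i < n - 2" for k i
  proof -
    have "E (d (k + 4)) (d (k + 2))" using adj2[of k] that(1) by blast
    moreover have "k + 4 + (n - 2) = k + 2 + n" using n6 by simp
    ultimately have "E (d (k + 4)) (d (k + 4 + (n - 2)))" by (simp only: d_period)
    moreover have "n - 2 < n" using n6 by simp
    ultimately show ?thesis using insert_around(1)[OF that(2,3), of "k + 4"] by blast
  qed
  have dom': "E (d (k + 4)) (d (k + 4 + i))" if "\<not> E (d (k + 2)) (d (k + 4))" "1 \<le> i" "i < n - 2" for k i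
    using dom[OF that] adjd[of i "k + 4"] that(2,3) by (meson diff_le_mono2 less_le_trans one_le_numeral)
  have "\<exists>k. E (d k) (d (k + 3)) \<and> E (d (k + 2)) (d (k + 4))"
  proof (rule ccontr)
    assume no: "\<not> (\<exists>k. E (d k) (d (k + 3)) \<and> E (d (k + 2)) (d (k + 4)))"
    obtain k where k: "E (d k) (d (k + 3))" using ex1 by blast
    then have n1: "\<not> E (d (k + 2)) (d (k + 4))" using no by blast
    have "1 \<le> (3::nat)" "3 < n - 2" using n6 by simp_all
    from dom'[OF n1 this] have "E (d (k + 4)) (d (k + 4 + 3))" .
    then have n2: "\<not> E (d (k + 4 + 2)) (d (k + 4 + 4))" using no by blast
    \<comment> \<open>Seen from \<open>d (k + 8)\<close>, the vertex \<open>d (k + 4)\<close> is at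
      distance \<open>n - 4\<close>, so it must not dominate \<open>d (k + 8)\<close>. But it does:
      by \<open>dom'\<close> for \<open>6 < n\<close>, and for \<open>n = 6\<close> because
      \<open>d (k + 8)\<close> is \<open>d (k + 2)\<close>.\<close>
    have "k + 4 + 4 + (n - 4) = k + 4 + n" "1 \<le> n - 4" "n - 4 < n - 2" using n6 by simp_all
    then have x: "\<not> E (d (k + 4)) (d (k + 4 + 4))" using dom[OF n2, of "n - 4"] d_period[of "k + 4"] by metis
    show False
    proof (cases "n = 6")
      case True
      have "E (d (k + 4)) (d (k + 2))" using adj2[of k] n1 by blast
      moreover have "k + 4 + 4 = k + 2 + n" using True by simp
      ultimately show ?thesis using x d_period[of "k + 2"] by metis
    next
      case False
      then have "1 \<le> (4::nat)" "4 < n - 2" using n6 by simp_all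
      from dom'[OF n1 this] show ?thesis using x by blast
    qed
  qed
  then obtain k where k: "E (d k) (d (k + 3))" "E (d (k + 2)) (d (k + 4))" by blast
  obtain q where q: "dipath E U q" "filter ?P q = map (\<lambda>j. d (k + 1 + j)) [0..<n]" "hd q = d (k + 1)"
    "last q = d (k + 1 + n - 1)" using around[of "k + 1"] by blast
  have lq: "last q = d k" using q(4) d_period[of k] by simp
  have "[0..<n] = 0 # 1 # 2 # 3 # [4..<n]" using n6 by (simp add: upt_conv_Cons eval_nat_numeral)
  then have f: "filter ?P q = d (k + 1) # d (k + 2) # d (k + 3) # d (k + 4) # map (\<lambda>j. d (k + 1 + j)) [4..<n]"
    unfolding q(2)
  proof -
    assume l: "[0..<n] = 0 # 1 # 2 # 3 # [4..<n]"
    have "k + 1 + 0 = k + 1" "k + 1 + 1 = k + 2" "k + 1 + 2 = k + 3" "k + 1 + 3 = k + 4" by simp_all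
    then show "map (\<lambda>j. d (k + 1 + j)) [0..<n] =
      d (k + 1) # d (k + 2) # d (k + 3) # d (k + 4) # map (\<lambda>j. d (k + 1 + j)) [4..<n]"
      by (simp only: l list.map)
  qed
  obtain u1 q1 where 1: "q = u1 @ d (k + 1) # q1" "d (k + 2) # d (k + 3) # d (k + 4) # map (\<lambda>j. d (k + 1 + j)) [4..<n] = filter ?P q1"
    using filter_eq_ConsD[OF f] by blast
  obtain u2 q2 where 2: "q1 = u2 @ d (k + 2) # q2" "d (k + 3) # d (k + 4) # map (\<lambda>j. d (k + 1 + j)) [4..<n] = filter ?P q2"
    using filter_eq_ConsD[OF 1(2)[symmetric]] by blast
  obtain u3 q3 where 3: "q2 = u3 @ d (k + 3) # q3" "d (k + 4) # map (\<lambda>j. d (k + 1 + j)) [4..<n] = filter ?P q3"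
    using filter_eq_ConsD[OF 2(2)[symmetric]] by blast
  obtain u4 q4 where 4: "q3 = u4 @ d (k + 4) # q4" "map (\<lambda>j. d (k + 1 + j)) [4..<n] = filter ?P q4"
    using filter_eq_ConsD[OF 3(2)[symmetric]] by blast
  let ?A = "u1 @ d (k + 1) # u2 @ [d (k + 2)]" and ?C = "d (k + 4) # q4"
  have qq: "q = ?A @ (u3 @ d (k + 3) # u4) @ ?C" using 1 2 3 4 by simp
  have "dipath E U (?A @ (u3 @ d (k + 3) # u4) @ ?C)" using q(1) qq by (rule subst[rotated])
  then have "dipath E U ?A" "dipath E U ((u3 @ d (k + 3) # u4) @ ?C)"
    "set ?A \<inter> set ((u3 @ d (k + 3) # u4) @ ?C) = {}"
    using dipath_append[of ?A "(u3 @ d (k + 3) # u4) @ ?C" E U] by simp_all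
  moreover from this have "dipath E U ?C" "set (u3 @ d (k + 3) # u4) \<inter> set ?C = {}"
    using dipath_append[of "u3 @ d (k + 3) # u4" ?C E U] by simp_all
  ultimately have dA: "dipath E U ?A" and dC: "dipath E U ?C" and disj': "set ?A \<inter> set ?C = {}"
    and n3: "d (k + 3) \<notin> set ?A" "d (k + 3) \<notin> set ?C"
    by auto
  have lC: "last ?C = d k" using lq unfolding qq by simp
  \<comment> \<open>\<open>d (k + 3)\<close> is moved to the end of the path, so that both ends are of the same kind.\<close>
  let ?q = "(?A @ ?C) @ [d (k + 3)]"
  have "dipath E U (?A @ ?C)" using dA dC disj' k(2) by (subst dipath_append) auto
  moreover have "last (?A @ ?C) = d k" using lC by simp
  ultimately have dq: "dipath E U ?q"
    using n3 k(1) d_in by (subst dipath_append) (auto simp: dipath_single)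
  have "hd ?q = hd q" unfolding qq by (cases u1) auto
  moreover have "good (d (k + 1)) (d (k + 3))"
  proof -
    have "(A (k + 1) \<and> A (k + 3)) \<or> (B (k + 1) \<and> B (k + 3))"
      using AB(1)[of "k + 1"] AB(3,4)[of "k + 1"] AB(3,4)[of "k + 2"] by (auto simp: numeral_eq_Suc)
    then show ?thesis using good_same by blast
  qed
  ultimately have g: "good (hd ?q) (last ?q)" using q(3) by simp
  have "set (filter ?P q) \<subseteq> set ?q"
  proof -
    have "set (map (\<lambda>j. d (k + 1 + j)) [4..<n]) \<subseteq> set q4" unfolding 4(2) by auto
    then show ?thesis unfolding f by auto
  qed
  moreover have "set (filter ?P q) = set ds"
  proof -
    have "set (filter ?P q) = set (rotate (k + 1) ds)" unfolding rotate_ds q(2) ..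
    then show ?thesis by simp
  qed
  ultimately have "cls ` set ds \<subseteq> cls ` set ?q" by (metis image_mono)
  then show False using no_good_superset[OF dq g] by blast
qed

text \<open>The kinds alternate around a closed sequence of length \<open>n\<close>, which rules out
  the odd value 5.\<close>

lemma card_cls_N: "card (cls ` N) \<le> 4"
proof -
  have "n \<noteq> 5"
  proof
    assume n5: "n = 5"
    have "A 0 = B 5"
      using AB(1)[of 0] AB(2)[of 0] AB(2)[of 5] AB(3,4)[of 0] AB(3,4)[of 1] AB(3,4)[of 2] AB(3,4)[of 3] AB(3,4)[of 4]
      by (auto simp: numeral_eq_Suc)
    then show False using A_period[of 0] AB(1,2)[of 0] n5 by auto
  qed
  then have "n \<le> 4" using n_less_6 by simp
  moreover have "card (cls ` N) \<le> n" unfolding cls_N n_def by (metis List.finite_set card_image_le card_length le_trans)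
  ultimately show ?thesis by simp
qed

end

context two_rails
begin

text \<open>Two uncovered classes are what \<open>nonstrong_ends\<close> and
  \<open>cover_cycle\<close> require of the remainder. In the strong case a failure implies
  \<open>S = T\<close> and at most four uncovered classes; hence the bound 5.\<close>

theorem two_rails_cover:
  assumes two_cls: "2 \<le> card (cls ` H - cls ` R)" and big: "S = T \<Longrightarrow> 5 \<le> card (cls ` H - cls ` R)"
  shows "\<exists>vs. bipolar E S T vs \<and> set vs \<subseteq> H \<and> cls ` set vs = cls ` H"
proof -
  let ?N = "{v \<in> U. cls v \<notin> cls ` R}"
  have N: "cls ` ?N = cls ` H - cls ` R" using RH by (auto simp: U_def)
  have fin: "finite (cls ` ?N)" using finite_V UV by (auto intro: finite_subset)
  have "\<not> card (cls ` ?N) \<le> Suc 0" using two_cls unfolding N by simp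
  then obtain x y where "x \<in> cls ` ?N" "y \<in> cls ` ?N" "x \<noteq> y"
    unfolding card_le_Suc0_iff_eq[OF fin] by blast
  then obtain u0 v0 where uv: "u0 \<in> U" "v0 \<in> U" "cls u0 \<noteq> cls v0" and ne: "?N \<noteq> {}" by blast
  have covered
  proof (cases "\<forall>u\<in>U. \<forall>v\<in>U. reach E U u v")
    case False
    then show ?thesis using covered_nonstrong uv by blast
  next
    case True
    then obtain c where c: "dicycle U c" "cls ` set c = cls ` U"
      using cover_cycle[OF UV _ uv] by blast
    show ?thesis
    proof (rule ccontr)
      assume nc: "\<not> covered"
      interpret cyclic_rails V E cls H S T r1 r2 c ?N
        by unfold_locales (use c True ne nc in auto)
      show False using big S_eq_T card_cls_N unfolding N by simp
    qed
  qed
  then show ?thesis unfolding covered_def .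
qed

end

section \<open>From separators to the path\<close>

text \<open>One half of bipolarity. The other half is this lemma for the reversed arcs, with
  \<open>x\<close> and \<open>y\<close>, \<open>Bl\<close> and \<open>Cl\<close> exchanged and
  \<open>vs\<close> reversed.\<close>

lemma fwd_assemble:
  assumes vs: "fwd E S' vs" and Bl: "set Bl \<subseteq> {w. E x w}" and S': "S' \<subseteq> {w. E x w \<or> (\<exists>b\<in>set Bl. E b w)}"
    and Cl: "\<And>c. c \<in> set Cl \<Longrightarrow> \<exists>v\<in>set vs. E v c" and y: "\<exists>v\<in>set vs \<union> set Cl. E v y"
  shows "fwd E {x} ([x] @ Bl @ vs @ Cl @ [y])"
proof -
  have sub: "fwd E A zs" if "set zs \<subseteq> A" for A zs
    using that
  proof (induction zs arbitrary: A)
    case (Cons a zs)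
    then have "a \<in> A" "fwd E A zs" by auto
    then show ?case using fwd_mono[of E A zs "A \<union> Collect (E a)"] by simp
  qed simp
  show ?thesis unfolding fwd_append
  proof (intro conjI)
    show "fwd E {x} [x]" by simp
    show "fwd E ({x} \<union> {w. \<exists>v\<in>set [x]. E v w}) Bl" using Bl by (intro sub) auto
    show "fwd E ({x} \<union> {w. \<exists>v\<in>set [x]. E v w} \<union> {w. \<exists>v\<in>set Bl. E v w}) vs"
      by (rule fwd_mono[OF vs]) (use S' in auto)
    show "fwd E ({x} \<union> {w. \<exists>v\<in>set [x]. E v w} \<union> {w. \<exists>v\<in>set Bl. E v w} \<union> {w. \<exists>v\<in>set vs. E v w}) Cl"
      using Cl by (intro sub) auto
    show "fwd E ({x} \<union> {w. \<exists>v\<in>set [x]. E v w} \<union> {w. \<exists>v\<in>set Bl. E v w} \<union> {w. \<exists>v\<in>set vs. E v w} \<union>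
      {w. \<exists>v\<in>set Cl. E v w}) [y]"
      using y by (intro sub) auto
  qed
qed

text \<open>The assumptions are symmetric under reversing all arcs and exchanging \<open>x\<close>
  and \<open>y\<close>, so facts on \<open>T\<close> follow from those on \<open>S\<close>. The
  separator condition uses \<open>reach\<close>, the form in which it is confronted with Menger's
  theorem.\<close>

locale separated_pair = multipartite V E cls
  for V :: "'a set" and E :: "'a \<Rightarrow> 'a \<Rightarrow> bool" and cls :: "'a \<Rightarrow> 'c" +
  fixes x y :: 'a
  assumes xy: "x \<in> V" "y \<in> V" "x \<noteq> y" "\<not> E x y"
    and strong_x: "\<And>z u v. z \<in> V - {x} \<Longrightarrow> u \<in> V - {x} - {z} \<Longrightarrow> v \<in> V - {x} - {z} \<Longrightarrow> reach E (V - {x} - {z}) u v"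
    and strong_x0: "\<And>u v. u \<in> V - {x} \<Longrightarrow> v \<in> V - {x} \<Longrightarrow> reach E (V - {x}) u v"
    and strong_y: "\<And>z u v. z \<in> V - {y} \<Longrightarrow> u \<in> V - {y} - {z} \<Longrightarrow> v \<in> V - {y} - {z} \<Longrightarrow> reach E (V - {y} - {z}) u v"
    and strong_y0: "\<And>u v. u \<in> V - {y} \<Longrightarrow> v \<in> V - {y} \<Longrightarrow> reach E (V - {y}) u v"
    and separators: "\<And>X. X \<subseteq> V - {x, y} \<Longrightarrow> card X \<le> 2 \<Longrightarrow> \<not> reach E (V - X) x y \<Longrightarrow>
      {v \<in> V. E x v} \<subseteq> X \<or> {v \<in> V. E v y} \<subseteq> X"
    and large: "4 \<le> card V"
begin

definition H where "H = V - {x, y}"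
definition S where "S = {v \<in> V. E x v}"
definition T where "T = {v \<in> V. E v y}"

lemma no_loop: "v \<in> V \<Longrightarrow> \<not> E v v" using adj[of v v] by blast

lemma SH: "S \<subseteq> H" and TH: "T \<subseteq> H" and HV: "H \<subseteq> V"
  using no_loop xy by (auto simp: S_def T_def H_def)

lemma fin_H: "finite H" using HV finite_V finite_subset by blast

lemma converse_pair: "separated_pair V (\<lambda>u v. E v u) cls y x"
proof -
  interpret conv: multipartite V "\<lambda>u v. E v u" cls by (rule multipartite_converse)
  show ?thesis
  proof
    show "{v \<in> V. E v y} \<subseteq> X \<or> {v \<in> V. E x v} \<subseteq> X"
      if "X \<subseteq> V - {y, x}" "card X \<le> 2" "\<not> reach (\<lambda>u v. E v u) (V - X) y x" for X
      using separators[of X] that reach_converse[of E "V - X" y x] by (auto simp: insert_commute)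
  qed (use xy large strong_x strong_x0 strong_y strong_y0 reach_converse[of E] in simp_all)
qed

text \<open>A path from \<open>x\<close> does not return to \<open>x\<close>; without its first
  vertex it starts in \<open>S\<close> and avoids both \<open>x\<close> and
  \<open>y\<close>.\<close>

lemma after_x:
  assumes w: "w \<in> H - Z" and r: "reach E (V - {y} - Z) x w"
  shows "\<exists>s\<in>S - Z. reach E (H - Z) s w"
proof -
  obtain p where p: "dipath E (V - {y} - Z) p" "hd p = x" "last p = w" using r by (auto simp: reach_def)
  then obtain q where q: "p = x # q" by (cases p) (auto simp: dipath_def)
  have "q \<noteq> []" using p w by (auto simp: q H_def)
  then have d: "dipath E (H - Z) q" "E x (hd q)" "last q = w"
    using p by (auto simp: q dipath_def H_def successively_Cons)
  then have "hd q \<in> H - Z" by (metis dipath_def hd_in_set subsetD)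
  then have "hd q \<in> S - Z" using d HV by (auto simp: S_def)
  then show ?thesis using d by (auto simp: reach_def)
qed

lemma from_S: "v \<in> H \<Longrightarrow> w \<in> H \<Longrightarrow> v \<noteq> w \<Longrightarrow> \<exists>s\<in>S - {v}. reach E (H - {v}) s w"
  using after_x[of w "{v}"] strong_y[of v x w] xy by (auto simp: H_def)

lemma from_S0: "w \<in> H \<Longrightarrow> \<exists>s\<in>S. reach E H s w"
  using after_x[of w "{}"] strong_y0[of x w] xy by (auto simp: H_def)

lemma conv_sets: "separated_pair.H V y x = H" "separated_pair.S V (\<lambda>u v. E v u) y = T" "separated_pair.T V (\<lambda>u v. E v u) x = S"
proof -
  interpret conv: separated_pair V "\<lambda>u v. E v u" cls y x by (rule converse_pair)
  show "conv.H = H" "conv.S = T" "conv.T = S"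
    by (auto simp: conv.H_def conv.S_def conv.T_def H_def S_def T_def)
qed

lemma to_T: "v \<in> H \<Longrightarrow> w \<in> H \<Longrightarrow> v \<noteq> w \<Longrightarrow> \<exists>t\<in>T - {v}. reach E (H - {v}) w t"
proof -
  interpret conv: separated_pair V "\<lambda>u v. E v u" cls y x by (rule converse_pair)
  show "v \<in> H \<Longrightarrow> w \<in> H \<Longrightarrow> v \<noteq> w \<Longrightarrow> \<exists>t\<in>T - {v}. reach E (H - {v}) w t"
    using conv.from_S[unfolded conv_sets, of v w] reach_converse[of E "H - {v}"] by blast
qed

lemma to_T0: "w \<in> H \<Longrightarrow> \<exists>t\<in>T. reach E H w t"
proof -
  interpret conv: separated_pair V "\<lambda>u v. E v u" cls y x by (rule converse_pair)
  show "w \<in> H \<Longrightarrow> \<exists>t\<in>T. reach E H w t"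
    using conv.from_S0[unfolded conv_sets, of w] reach_converse[of E H] by blast
qed

text \<open>A single vertex of \<open>S\<close> could be deleted, and then no source would remain
  for the other vertices of \<open>H\<close>.\<close>

lemma card_S: "2 \<le> card S"
proof (rule ccontr)
  assume n: "\<not> 2 \<le> card S"
  have fS: "finite S" using SH fin_H finite_subset by blast
  have "card H = card V - 2" using xy finite_V by (simp add: H_def card_Diff_subset)
  then have cH: "2 \<le> card H" using large by simp
  have "card S \<le> Suc 0" using n by simp
  then have one: "s = s'" if "s \<in> S" "s' \<in> S" for s s' using that card_le_Suc0_iff_eq[OF fS] by blast
  have "H \<noteq> {}" using cH by auto
  then obtain s where s: "s \<in> S" using from_S0 by blast
  have "\<not> card H \<le> Suc 0" using cH by simp
  then obtain w where "w \<in> H" "w \<noteq> s" unfolding card_le_Suc0_iff_eq[OF fin_H] by metis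
  then show False using from_S[of s w] s SH one by blast
qed

definition ends where "ends p \<longleftrightarrow> dipath E V p \<and> hd p = x \<and> last p = y \<and> cls ` set p = cls ` V"

lemma ends_from_bipolar:
  assumes L: "bipolar E {x} {y} ([x] @ zs @ [y])" and zs: "set zs \<subseteq> H" "cls ` H \<subseteq> cls ` set zs"
  shows "\<exists>p. ends p"
proof -
  let ?L = "[x] @ zs @ [y]"
  have LV: "set ?L \<subseteq> V" using zs HV xy by auto
  have "\<exists>p. dipath E (set ?L) p \<and> hd p = hd ?L \<and> last p = last ?L \<and> cls ` set p = cls ` set ?L"
    by (rule bipolar_imp_path) (use L LV in simp_all)
  then obtain p where p: "dipath E (set ?L) p" "hd p = x" "last p = y" "cls ` set p = cls ` set ?L" by auto
  have "V = insert x (insert y H)" using xy by (auto simp: H_def)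
  then have "cls ` V = insert (cls x) (insert (cls y) (cls ` H))" by (metis image_insert)
  moreover have "cls ` set ?L = insert (cls x) (insert (cls y) (cls ` set zs))" by auto
  moreover have "cls ` set zs \<subseteq> cls ` H" using zs(1) by (rule image_mono)
  ultimately have "cls ` set p = cls ` V" using p(4) zs(2) by simp
  then show ?thesis using p dipath_mono[OF p(1) LV] unfolding ends_def by blast
qed

lemma bipolar_hd_last:
  assumes "bipolar E A B vs" "vs \<noteq> []" shows "hd vs \<in> A" "last vs \<in> B"
proof -
  show "hd vs \<in> A" using assms by (cases vs) (auto simp: bipolar_def)
  show "last vs \<in> B" using assms by (cases vs rule: rev_cases) (auto simp: bipolar_def)
qed

lemma ends_from_rails:
  assumes r: "dipath E H r1" "hd r1 \<in> S" "last r1 \<in> T" "length r1 \<le> 2"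
    "dipath E H r2" "hd r2 \<in> S" "last r2 \<in> T" "length r2 \<le> 2" "set r1 \<inter> set r2 = {}"
    and two_cls: "2 \<le> card (cls ` H - cls ` (set r1 \<union> set r2))"
    and big: "S = T \<Longrightarrow> 5 \<le> card (cls ` H - cls ` (set r1 \<union> set r2))"
  shows "\<exists>p. ends p"
proof -
  interpret two_rails V E cls H S T r1 r2
    by unfold_locales (use HV SH TH r from_S to_T in simp_all)
  obtain vs where vs: "bipolar E S T vs" "set vs \<subseteq> H" "cls ` set vs = cls ` H"
    using two_rails_cover two_cls big unfolding R_def by blast
  have ne: "vs \<noteq> []" using vs(3) two_cls by auto
  note e = bipolar_hd_last[OF vs(1) ne]
  have d: "distinct ([x] @ vs @ [y])" using vs xy by (auto simp: bipolar_def H_def)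
  have "fwd E {x} ([x] @ [] @ vs @ [] @ [y])"
    by (rule fwd_assemble[of E S]) (use vs e ne in \<open>auto simp: bipolar_def S_def T_def\<close>)
  moreover have "fwd (\<lambda>u v. E v u) {y} ([y] @ [] @ rev vs @ [] @ [x])"
    by (rule fwd_assemble[of _ T]) (use vs e ne in \<open>auto simp: bipolar_def S_def T_def\<close>)
  ultimately have "bipolar E {x} {y} ([x] @ vs @ [y])" using d by (simp add: bipolar_def)
  then show ?thesis by (rule ends_from_bipolar) (use vs in auto)
qed

text \<open>With \<open>b\<close> next to \<open>x\<close> and \<open>c\<close> next to
  \<open>y\<close>, the sets \<open>S\<close> and \<open>T\<close> give way to \<open>S'\<close> and
  \<open>T'\<close> in \<open>G\<close>. At most two vertices of \<open>G\<close> separating these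
  would form a 2-separator of \<open>x\<close> and \<open>y\<close> and contain \<open>S\<close> or
  \<open>T\<close>. But they avoid \<open>b\<close> and \<open>c\<close>, and a side without such a
  vertex has at least three neighbours. \<open>noarc\<close> excludes the path \<open>x\<close>,
  \<open>b\<close>, \<open>c\<close>, \<open>y\<close>, which no subset of \<open>G\<close> can
  hit.\<close>

lemma ends_from_three_paths:
  assumes Bl: "Bl = [] \<and> 3 \<le> card S \<or> (\<exists>b. Bl = [b] \<and> b \<in> S \<and> b \<notin> T \<and> card S = 2)"
    and Cl: "Cl = [] \<and> 3 \<le> card T \<or> (\<exists>c. Cl = [c] \<and> c \<in> T \<and> c \<notin> S \<and> card T = 2)"
    and noarc: "\<And>b c. b \<in> set Bl \<Longrightarrow> c \<in> set Cl \<Longrightarrow> \<not> E b c"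
  shows "\<exists>p. ends p"
proof -
  define G where "G = H - set Bl - set Cl"
  define S' where "S' = {w \<in> G. w \<in> S \<or> (\<exists>b\<in>set Bl. E b w)}"
  define T' where "T' = {w \<in> G. w \<in> T \<or> (\<exists>c\<in>set Cl. E w c)}"
  have GV: "G \<subseteq> V" and GH: "G \<subseteq> H" and fG: "finite G" using HV fin_H by (auto simp: G_def)
  have BS: "set Bl \<subseteq> S" "set Bl \<inter> T = {}" and CT: "set Cl \<subseteq> T" "set Cl \<inter> S = {}" using Bl Cl by auto
  have fS: "finite S" "finite T" using SH TH fin_H finite_subset by blast+
  have "linked E G S' T' 3"
  proof (rule menger[OF fG])
    fix X assume X: "separates E G S' T' X"
    show "3 \<le> card X"
    proof (rule ccontr)
      assume "\<not> 3 \<le> card X"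
      then have c2: "card X \<le> 2" by simp
      have XG: "X \<subseteq> G" using X by (simp add: separates_def)
      have fX: "finite X" using XG fG finite_subset by blast
      have "\<not> reach E (V - X) x y"
      proof
        assume "reach E (V - X) x y"
        then obtain p where p: "dipath E (V - X) p" "hd p = x" "last p = y" by (auto simp: reach_def)
        then obtain p1 where p1: "p = x # p1" by (cases p) (auto simp: dipath_def)
        have "p1 \<noteq> []" using p xy by (auto simp: p1)
        then obtain w where w: "p1 = w @ [y]" using p(3) unfolding p1 by (cases p1 rule: rev_cases) auto
        have wne: "w \<noteq> []"
        proof
          assume "w = []"
          then show False using p(1) xy(4) unfolding p1 w by (simp add: dipath_def)
        qed
        have w1: "dipath E (H - X) w"
          using p(1) wne unfolding p1 w H_def by (auto simp: dipath_def successively_append_iff successively_Cons)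
        have "E x (hd w)" "E (last w) y"
          using p(1) wne unfolding p1 w by (auto simp: dipath_def successively_append_iff successively_Cons)
        moreover have "hd w \<in> H - X" "last w \<in> H - X" using w1 by (metis dipath_def hd_in_set last_in_set subsetD)+
        ultimately have wST: "hd w \<in> S" "last w \<in> T" using HV by (auto simp: S_def T_def)
        \<comment> \<open>Keep what follows the last visit to \<open>Bl\<close>, and of that what
          precedes the first visit to \<open>Cl\<close>: this runs from \<open>S'\<close> to
          \<open>T'\<close> in \<open>G\<close> and avoids \<open>X\<close>.\<close>
        obtain q where q: "dipath E (H - X - set Bl) q" "hd q \<in> S \<or> (\<exists>b\<in>set Bl. E b (hd q))" "last q \<in> T"
        proof (cases "set w \<inter> set Bl = {}")
          case True
          then have "dipath E (H - X - set Bl) w" using w1 by (auto simp: dipath_def)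
          then show ?thesis using that[of w] wST by blast
        next
          case False
          have "last w \<notin> set Bl" using wST BS by blast
          from dipath_last_exit[OF w1 False this] obtain b q where "b \<in> set Bl"
            "dipath E (H - X - set Bl) q" "E b (hd q)" "last q = last w" by metis
          then show ?thesis using that[of q] wST by metis
        qed
        have hq: "hd q \<notin> set Cl" using q(2) CT(2) noarc by blast
                obtain r where r: "dipath E (H - X - set Bl - set Cl) r" "hd r = hd q" "last r \<in> T \<or> (\<exists>c\<in>set Cl. E (last r) c)"
        proof (cases "set q \<inter> set Cl = {}")
          case True
          then have "dipath E (H - X - set Bl - set Cl) q" using q(1) by (auto simp: dipath_def)
          then show ?thesis using that[of q] q by blast
        next
          case False
          from dipath_first_entry[OF q(1) False hq] obtain c r where "c \<in> set Cl"
            "dipath E (H - X - set Bl - set Cl) r" "E (last r) c" "hd r = hd q" by metis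
          then show ?thesis using that[of r] by metis
        qed
        have rG: "dipath E G r" "set r \<inter> X = {}" using r(1) by (auto simp: dipath_def G_def)
        then have "hd r \<in> G" "last r \<in> G" by (metis dipath_def hd_in_set last_in_set subsetD)+
        then have "hd r \<in> S'" "last r \<in> T'" using q(2) r(2,3) by (auto simp: S'_def T'_def)
        then show False using X rG unfolding separates_def by blast
      qed
      moreover have "X \<subseteq> V - {x, y}" using XG GH by (auto simp: H_def)
      ultimately have "S \<subseteq> X \<or> T \<subseteq> X" using separators[OF _ c2] unfolding S_def T_def by blast
      then show False
      proof
        assume "S \<subseteq> X"
        then have "set Bl \<subseteq> X" using BS(1) by (rule order_trans[rotated])
        moreover have "X \<inter> set Bl = {}" using XG unfolding G_def by blast
        ultimately have "set Bl = {}" by (metis inf.absorb2)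
        moreover have "card S \<le> 2" using card_mono[OF fX \<open>S \<subseteq> X\<close>] c2 by linarith
        ultimately show False using Bl by auto
      next
        assume "T \<subseteq> X"
        then have "set Cl \<subseteq> X" using CT(1) by (rule order_trans[rotated])
        moreover have "X \<inter> set Cl = {}" using XG unfolding G_def by blast
        ultimately have "set Cl = {}" by (metis inf.absorb2)
        moreover have "card T \<le> 2" using card_mono[OF fX \<open>T \<subseteq> X\<close>] c2 by linarith
        ultimately show False using Cl by auto
      qed
    qed
  qed
  then obtain I :: "'a set" and f where I: "card I = 3"
    "\<forall>i\<in>I. dipath E G (f i) \<and> hd (f i) \<in> S' \<and> last (f i) \<in> T'"
    "\<forall>i\<in>I. \<forall>j\<in>I. i \<noteq> j \<longrightarrow> set (f i) \<inter> set (f j) = {}"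
    unfolding linked_def by blast
  obtain i j k where ijk: "I = {i, j, k}" "i \<noteq> j" "i \<noteq> k" "j \<noteq> k"
    using I(1) by (auto simp: numeral_3_eq_3 card_Suc_eq)
  have P: "three_paths G S' T' (f i) (f j) (f k)" using I(2,3) ijk unfolding three_paths_def by simp
  \<comment> \<open>Deleting \<open>c\<close> is paid for by 2-strength, and visits to
    \<open>b\<close> are cut off after the last one.\<close>
  have fromS: "\<exists>s\<in>S'. reach E G s v" if v: "v \<in> G" for v
  proof -
    have "\<exists>s\<in>S. reach E (H - set Cl) s v"
    proof (cases "Cl = []")
      case True then show ?thesis using from_S0[of v] v GH by auto
    next
      case False
      then obtain c where "Cl = [c]" "c \<in> T" using Cl by blast
      then show ?thesis using from_S[of c v] v TH by (auto simp: G_def)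
    qed
    moreover have "v \<in> H - set Cl" "v \<notin> set Bl" using v by (auto simp: G_def)
    ultimately obtain e where e: "e \<in> H - set Cl - set Bl" "e \<in> S \<or> (\<exists>z\<in>set Bl. E z e)" "reach E (H - set Cl - set Bl) e v"
      using entry_reach[of v "H - set Cl" "set Bl" S] by blast
    moreover have "H - set Cl - set Bl = G" by (auto simp: G_def)
    ultimately show ?thesis unfolding S'_def by auto
  qed
  have toT: "\<exists>t\<in>T'. reach E G v t" if v: "v \<in> G" for v
  proof -
    have "\<exists>t\<in>T. reach E (H - set Bl) v t"
    proof (cases "Bl = []")
      case True then show ?thesis using to_T0[of v] v GH by auto
    next
      case False
      then obtain b where "Bl = [b]" "b \<in> S" using Bl by blast
      then show ?thesis using to_T[of b v] v SH by (auto simp: G_def)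
    qed
    moreover have "v \<in> H - set Bl" "v \<notin> set Cl" using v by (auto simp: G_def)
    ultimately obtain e where e: "e \<in> H - set Bl - set Cl" "e \<in> T \<or> (\<exists>z\<in>set Cl. E e z)" "reach E (H - set Bl - set Cl) v e"
      using exit_reach[of v "H - set Bl" "set Cl" T] by blast
    then show ?thesis unfolding T'_def G_def[symmetric] by auto
  qed
  obtain vs where vs: "bipolar E S' T' vs" "set vs \<subseteq> G" "set (f i) \<union> set (f j) \<union> set (f k) \<subseteq> set vs" "cls ` set vs = cls ` G"
    using three_paths_cover[OF GV P fromS toT] by blast
  have hl: "hd (f m) \<in> set vs \<and> hd (f m) \<in> S' \<and> last (f m) \<in> set vs \<and> last (f m) \<in> T'" if "m \<in> I" for m
  proof -
    have "f m \<noteq> []" "set (f m) \<subseteq> set vs" using that I(2) vs(3) ijk by (auto simp: dipath_def)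
    then show ?thesis using that I(2) by (metis hd_in_set last_in_set subsetD)
  qed
  have iI: "i \<in> I" "j \<in> I" using ijk by auto
  have fne: "f m \<noteq> []" if "m \<in> I" for m using I(2) that by (auto simp: dipath_def)
  have hne: "hd (f i) \<noteq> hd (f j)" "last (f i) \<noteq> last (f j)"
    using I(3) iI ijk(2) fne by (metis disjoint_iff hd_in_set, metis disjoint_iff last_in_set)
  \<comment> \<open>\<open>b\<close> needs an out-neighbour later in the ordering. At most one of
    the two distinct first vertices is the other member \<open>a\<close> of \<open>S\<close>; a
    first vertex outside \<open>S\<close> belongs to \<open>S'\<close> because \<open>b\<close>
    dominates it.\<close>
  have one_out: "\<exists>v\<in>set vs. E b v" if b: "b \<in> set Bl" for b
  proof -
    obtain b' where b': "Bl = [b']" "b' \<in> S" "card S = 2" using Bl b by auto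
    then have bb: "Bl = [b]" "b \<in> S" "card (S - {b}) = 1" using b fS by auto
    then obtain a where a: "S - {b} = {a}" using card_1_singletonE by metis
    have "E b (hd (f m))" if "m \<in> I" "hd (f m) \<noteq> a" for m
      using hl[OF that(1)] that(2) a bb(1) unfolding S'_def G_def by auto
    then show ?thesis using hne iI hl by metis
  qed
  have one_in: "\<exists>v\<in>set vs. E v c" if c: "c \<in> set Cl" for c
  proof -
    obtain c' where c': "Cl = [c']" "c' \<in> T" "card T = 2" using Cl c by auto
    then have cc: "Cl = [c]" "c \<in> T" "card (T - {c}) = 1" using c fS by auto
    then obtain a where a: "T - {c} = {a}" using card_1_singletonE by metis
    have "E (last (f m)) c" if "m \<in> I" "last (f m) \<noteq> a" for m
      using hl[OF that(1)] that(2) a cc(1) unfolding T'_def G_def by auto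
    then show ?thesis using hne iI hl by metis
  qed
  have to_y: "\<exists>v\<in>set vs \<union> set Cl. E v y"
  proof (cases "Cl = []")
    case True
    then show ?thesis using hl[OF iI(1)] unfolding T'_def T_def by auto
  next
    case False
    then show ?thesis using CT unfolding T_def by (cases Cl) auto
  qed
  have from_x: "\<exists>v\<in>set vs \<union> set Bl. E x v"
  proof (cases "Bl = []")
    case True
    then show ?thesis using hl[OF iI(1)] unfolding S'_def S_def by auto
  next
    case False
    then show ?thesis using BS unfolding S_def by (cases Bl) auto
  qed
  have len: "rev Bl = Bl" "rev Cl = Cl" "distinct Bl" "distinct Cl" using Bl Cl by auto
  have "fwd E {x} ([x] @ Bl @ vs @ Cl @ [y])"
    by (rule fwd_assemble[of E S']) (use vs(1) BS one_in to_y in \<open>auto simp: bipolar_def S'_def S_def\<close>)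
  moreover have "fwd (\<lambda>u v. E v u) {y} ([y] @ Cl @ rev vs @ Bl @ [x])"
    by (rule fwd_assemble[of _ T']) (use vs(1) CT one_out from_x in \<open>auto simp: bipolar_def T'_def T_def\<close>)
  moreover have "set Bl \<inter> set Cl = {}" using BS CT by blast
  then have "distinct ([x] @ (Bl @ vs @ Cl) @ [y])"
    using vs(1,2) len SH TH BS CT xy unfolding bipolar_def G_def H_def by auto
  ultimately have "bipolar E {x} {y} ([x] @ (Bl @ vs @ Cl) @ [y])"
    using len by (simp add: bipolar_def)
  then show ?thesis
  proof (rule ends_from_bipolar)
    show "set (Bl @ vs @ Cl) \<subseteq> H" using vs(2) GH SH TH BS CT by auto
    have "H = G \<union> set Bl \<union> set Cl" using SH TH BS CT by (auto simp: G_def)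
    then have "cls ` H = cls ` G \<union> cls ` set Bl \<union> cls ` set Cl" by (metis image_Un)
    then show "cls ` H \<subseteq> cls ` set (Bl @ vs @ Cl)" using vs(4) by auto
  qed
qed


text \<open>Each vertex of \<open>R\<close> spoils one colour class, that is, at most
  \<open>k\<close> vertices of \<open>H\<close>; the summand 2 stands for \<open>x\<close> and
  \<open>y\<close>.\<close>

lemma few_classes_lost:
  assumes A: "\<And>A. A \<subseteq> V \<Longrightarrow> card A \<le> k * card (cls ` A)" and R: "R \<subseteq> H"
  shows "card V \<le> 2 + k * card R + k * card (cls ` H - cls ` R)"
proof -
  let ?A = "{v \<in> H. cls v \<notin> cls ` R}" and ?B = "{v \<in> H. cls v \<in> cls ` R}"
  have fR: "finite R" using R fin_H finite_subset by blast
  have "card H = card V - 2" using xy finite_V by (simp add: H_def card_Diff_subset)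
  then have "card V \<le> 2 + card H" by simp
  also have "H = ?A \<union> ?B" by blast
  also have "card (?A \<union> ?B) \<le> card ?A + card ?B" by (rule card_Un_le)
  also have "card ?A \<le> k * card (cls ` ?A)" using HV by (intro A) blast
  also have "cls ` ?A = cls ` H - cls ` R" by auto
  also have "card ?B \<le> k * card (cls ` ?B)" using HV by (intro A) blast
  also have "card (cls ` ?B) \<le> card R"
  proof -
    have "card (cls ` ?B) \<le> card (cls ` R)" using fR by (intro card_mono) auto
    then show ?thesis using card_image_le[OF fR, of cls] by linarith
  qed
  finally show ?thesis by (simp add: add.commute add.left_commute)
qed

theorem covering_path:
  assumes A: "\<And>A. A \<subseteq> V \<Longrightarrow> card A \<le> k * card (cls ` A)" and k: "1 \<le> k" "k \<le> 2" "5 + 5 * k \<le> card V"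
  shows "\<exists>p. ends p"
proof -
  have k12: "k = 1 \<or> k = 2" using k by auto
  have rails: "\<exists>p. ends p" if r: "dipath E H r1" "hd r1 \<in> S" "last r1 \<in> T" "length r1 \<le> 2"
    "dipath E H r2" "hd r2 \<in> S" "last r2 \<in> T" "length r2 \<le> 2" "set r1 \<inter> set r2 = {}"
    and eq: "S = T \<Longrightarrow> length r1 = 1 \<and> length r2 = 1" for r1 r2
  proof -
    let ?R = "set r1 \<union> set r2" and ?m = "card (cls ` H - cls ` (set r1 \<union> set r2))"
    have "?R \<subseteq> H" using r by (auto simp: dipath_def)
    from few_classes_lost[OF A this] have m: "5 + 5 * k \<le> 2 + k * card ?R + k * ?m" using k(3) by linarith
    have cR: "card ?R \<le> length r1 + length r2"
      using card_Un_le[of "set r1" "set r2"] card_length[of r1] card_length[of r2] by linarith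
    then have c4: "card ?R \<le> 4" using r(4,8) by linarith
    show ?thesis
    proof (rule ends_from_rails[OF r])
      \<comment> \<open>At most four rail vertices leave \<open>3 + k \<le> k * ?m\<close>, so
        \<open>?m\<close> is at least 4 for \<open>k = 1\<close> and at least 3 for
        \<open>k = 2\<close>.\<close>
      show "2 \<le> ?m" using m c4 k12 by auto
      show "5 \<le> ?m" if "S = T"
      proof -
        \<comment> \<open>Two rail vertices leave \<open>3 + 3 * k \<le> k * ?m\<close>, so
          \<open>?m\<close> is at least 6 for \<open>k = 1\<close> and at least 5 for
          \<open>k = 2\<close>.\<close>
        have "card ?R \<le> 2" using eq[OF that] cR by linarith
        then show ?thesis using m k12 by auto
      qed
    qed
  qed
  have single: "dipath E H [a]" if "a \<in> H" for a using that by (simp add: dipath_def)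
  have double: "dipath E H [a, b]" if "a \<in> H" "b \<in> H" "E a b" for a b
    using that no_loop HV by (auto simp: dipath_def)
  interpret conv: separated_pair V "\<lambda>u v. E v u" cls y x by (rule converse_pair)
  have cT: "2 \<le> card T" using conv.card_S unfolding conv_sets .
  have fin: "finite S" "finite T" using SH TH fin_H finite_subset by blast+
  show ?thesis
  proof (cases "card S = 2"; cases "card T = 2")
    assume "card S \<noteq> 2" "card T \<noteq> 2"
    then show ?thesis using card_S cT by (intro ends_from_three_paths[of "[]" "[]"]) auto
  next
    assume c: "card S = 2" "card T \<noteq> 2"
    show ?thesis
    proof (cases "S \<subseteq> T")
      case True
      \<comment> \<open>Both vertices of \<open>S\<close> lie in \<open>T\<close> and serve as
        one-vertex rails; because \<open>S \<noteq> T\<close>, two uncovered classes are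
        enough.\<close>
      obtain a b where ab: "S = {a, b}" "a \<noteq> b" using c(1) by (auto simp: card_2_iff)
      have "S \<noteq> T" using c by auto
      then show ?thesis using ab True SH by (intro rails[of "[a]" "[b]"] single) auto
    next
      case False
      then obtain b where "b \<in> S" "b \<notin> T" by blast
      then show ?thesis using c cT by (intro ends_from_three_paths[of "[b]" "[]"]) auto
    qed
  next
    assume c: "card S \<noteq> 2" "card T = 2"
    show ?thesis
    proof (cases "T \<subseteq> S")
      case True
      obtain a b where ab: "T = {a, b}" "a \<noteq> b" using c(2) by (auto simp: card_2_iff)
      have "S \<noteq> T" using c by auto
      then show ?thesis using ab True TH by (intro rails[of "[a]" "[b]"] single) auto
    next
      case False
      then obtain b where "b \<in> T" "b \<notin> S" by blast
      then show ?thesis using c card_S by (intro ends_from_three_paths[of "[]" "[b]"]) auto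
    qed
  next
    assume c: "card S = 2" "card T = 2"
    show ?thesis
    proof (cases "\<exists>b\<in>S - T. \<exists>c\<in>T - S. \<not> E b c")
      case True
      then obtain b c' where "b \<in> S - T" "c' \<in> T - S" "\<not> E b c'" by blast
      then show ?thesis using c by (intro ends_from_three_paths[of "[b]" "[c']"]) auto
    next
      case False
      \<comment> \<open>Every vertex of \<open>S - T\<close> now dominates every vertex of
        \<open>T - S\<close>, so these arcs serve as two-vertex rails, and a common vertex serves as
        a one-vertex rail.\<close>
      then have arc: "E b c" if "b \<in> S" "b \<notin> T" "c \<in> T" "c \<notin> S" for b c using that by blast
      obtain a b where ab: "S = {a, b}" "a \<noteq> b" using c(1) by (auto simp: card_2_iff)
      obtain a' b' where ab': "T = {a', b'}" "a' \<noteq> b'" using c(2) by (auto simp: card_2_iff)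
      have inH: "a \<in> H" "b \<in> H" "a' \<in> H" "b' \<in> H" using SH TH ab ab' by auto
      have shared: "\<exists>p. ends p" if "S = {e, f}" "T = {e, g}" "e \<noteq> f" "e \<noteq> g" "f \<noteq> g" for e f g
      proof -
        have "S \<noteq> T" "e \<in> H" "f \<in> H" "g \<in> H" using that SH TH by auto
        moreover have "E f g" using that by (intro arc) auto
        ultimately show ?thesis using that by (intro rails[of "[e]" "[f, g]"] single double) auto
      qed
      show ?thesis
      proof (cases "S = T")
        case True
        then show ?thesis using ab inH by (intro rails[of "[a]" "[b]"] single) auto
      next
        case neq: False
        show ?thesis
        proof (cases "S \<inter> T = {}")
          case True
          then have "a \<noteq> a'" "a \<noteq> b'" "b \<noteq> a'" "b \<noteq> b'" using ab ab' by auto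
          moreover from this have "E a a'" "E b b'" using ab ab' by (auto intro!: arc)
          ultimately show ?thesis using ab ab' inH neq by (intro rails[of "[a, a']" "[b, b']"] double) auto
        next
          case False
          then consider "a = a'" | "a = b'" | "b = a'" | "b = b'" using ab ab' by auto
          then show ?thesis
          proof cases
            case 1
            then show ?thesis using ab ab' neq by (intro shared[of a b b']) auto
          next
            case 2
            then show ?thesis using ab ab' neq by (intro shared[of a b a']) auto
          next
            case 3
            then show ?thesis using ab ab' neq by (intro shared[of b a b']) auto
          next
            case 4
            then show ?thesis using ab ab' neq by (intro shared[of b a a']) auto
          qed
        qed
      qed
    qed
  qed
qed

end

section \<open>Translation to digraphs\<close>

lemma (in wf_digraph) vertex_walk_awalk:
  assumes "p \<noteq> []" "set p \<subseteq> verts G" "successively (\<lambda>u v. u \<rightarrow>\<^bsub>G\<^esub> v) p"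
  shows "\<exists>es. awalk (hd p) es (last p) \<and> awalk_verts (hd p) es = p"
  using assms
proof (induction p rule: induct_list012)
  case (2 v)
  then have "awalk v [] v \<and> awalk_verts v [] = [v]" by (simp add: awalk_Nil_iff)
  then show ?case by auto
next
  case (3 u v p)
  then obtain es where es: "awalk v es (last (v # p))" "awalk_verts v es = v # p" by auto
  have "u \<rightarrow>\<^bsub>G\<^esub> v" using "3.prems" by simp
  then obtain e where "e \<in> arcs G" "tail G e = u" "head G e = v" by (rule reachableE)
  then have "awalk u (e # es) (last (v # p)) \<and> awalk_verts u (e # es) = u # v # p"
    using es by (simp add: awalk_Cons_iff)
  then show ?case by auto
qed simp

lemma reachable_imp_reach:
  assumes "wf_digraph D" "u \<rightarrow>\<^sup>*\<^bsub>D \<restriction> W\<^esub> v"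
  shows "reach (\<lambda>u v. u \<rightarrow>\<^bsub>D\<^esub> v) W u v"
proof -
  interpret D: wf_digraph D by fact
  interpret I: wf_digraph "D \<restriction> W" by (rule D.wellformed_induce_subgraph)
  show ?thesis using assms(2)
  proof (induct rule: I.converse_reachable_induct)
    case base
    then show ?case by (simp add: reach_refl)
  next
    case (step u w)
    have "u \<in> W" "w \<in> W" using I.adj_in_verts[OF step(1)] by auto
    moreover have "u \<rightarrow>\<^bsub>D\<^esub> w" using step(1) by (rule dominates_induce_subgraphD)
    ultimately have "reach (\<lambda>u v. u \<rightarrow>\<^bsub>D\<^esub> v) W u w"
      by (cases "u = w") (auto simp: reach_refl intro: reach_arc)
    then show ?case using step(3) by (rule reach_trans)
  qed
qed

lemma induce_subgraph_twice: "B \<subseteq> A \<Longrightarrow> (D \<restriction> A) \<restriction> B = D \<restriction> B"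
  by (auto simp: induce_subgraph_def)

lemma k_strong_reach:
  assumes "wf_digraph D" and strong: "k_strong 2 (delete_verts D {x})"
    and Z: "Z \<subseteq> verts D - {x}" "card Z \<le> 1" and uv: "u \<in> verts D - {x} - Z" "v \<in> verts D - {x} - Z"
  shows "reach (\<lambda>u v. u \<rightarrow>\<^bsub>D\<^esub> v) (verts D - {x} - Z) u v"
proof -
  have "strongly_connected (delete_verts (delete_verts D {x}) Z)"
    using strong Z by (simp add: k_strong_def delete_verts_def)
  then have "strongly_connected (D \<restriction> (verts D - {x} - Z))"
    by (simp add: delete_verts_def induce_subgraph_twice)
  then have "u \<rightarrow>\<^sup>*\<^bsub>D \<restriction> (verts D - {x} - Z)\<^esub> v" using uv by (simp add: strongly_connected_def)
  then show ?thesis by (rule reachable_imp_reach[OF assms(1)])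
qed

lemma two_separatorI:
  assumes "wf_digraph D" "X \<subseteq> verts D - {x, y}" "card X \<le> 2"
    "\<not> reach (\<lambda>u v. u \<rightarrow>\<^bsub>D\<^esub> v) (verts D - X) x y"
  shows "two_separator D x y X"
proof -
  interpret D: wf_digraph D by fact
  interpret I: wf_digraph "D \<restriction> (verts D - X)" by (rule D.wellformed_induce_subgraph)
  have "\<not> pre_digraph.apath (D \<restriction> (verts D - X)) x p y" for p
    using I.reachable_apath reachable_imp_reach[OF assms(1)] assms(4) by blast
  then show ?thesis using assms by (simp add: two_separator_def delete_verts_def)
qed

lemma card_le_independence_number:
  assumes "finite (verts D)" "independent_set D A"
  shows "card A \<le> independence_number D"
proof -
  have "{S. independent_set D S} \<subseteq> Pow (verts D)" by (auto simp: independent_set_def)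
  then have "finite {S. independent_set D S}" using assms(1) by (simp add: finite_subset)
  then show ?thesis using assms(2) unfolding independence_number_def by (intro Max_ge) auto
qed

context semicomplete_multipartite_digraph
begin

definition class_of :: "'a \<Rightarrow> 'a set" where
  "class_of v = (THE C. C \<in> color_classes \<and> v \<in> C)"

lemma class_of_eq: "C \<in> color_classes \<Longrightarrow> v \<in> C \<Longrightarrow> class_of v = C"
  unfolding class_of_def using partition_onD2[OF partition] by (intro the_equality) (auto dest: disjointD)

lemma class_of_in: "v \<in> verts D \<Longrightarrow> class_of v \<in> color_classes \<and> v \<in> class_of v"
  using partition_onD1[OF partition] class_of_eq by auto

lemma adjacent_iff_class_of:
  assumes "u \<in> verts D" "v \<in> verts D"
  shows "u \<rightarrow>\<^bsub>D\<^esub> v \<or> v \<rightarrow>\<^bsub>D\<^esub> u \<longleftrightarrow> class_of u \<noteq> class_of v"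
proof (cases "u = v")
  case True
  then show ?thesis using adj_not_same by blast
next
  case False
  have "(\<exists>C\<in>color_classes. u \<in> C \<and> v \<in> C) \<longleftrightarrow> class_of u = class_of v"
    using class_of_in[OF assms(1)] class_of_in[OF assms(2)] class_of_eq by metis
  then show ?thesis using adjacent_iff[OF assms False] by simp
qed

lemma card_same_class:
  assumes "A \<subseteq> verts D" "\<And>u v. u \<in> A \<Longrightarrow> v \<in> A \<Longrightarrow> class_of u = class_of v"
  shows "card A \<le> independence_number D"
proof (rule card_le_independence_number)
  have "\<not> u \<rightarrow>\<^bsub>D\<^esub> v" if "u \<in> A" "v \<in> A" for u v
    using assms(2)[OF that] adjacent_iff_class_of[of u v] assms(1) that by blast
  then show "independent_set D A" using assms(1) by (simp add: independent_set_def)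
qed simp

text \<open>Colour classes are independent, so each contributes at most the independence number.
  This supplies the factor \<open>k\<close> in the counting.\<close>

lemma card_le_classes:
  assumes "A \<subseteq> verts D"
  shows "card A \<le> independence_number D * card (class_of ` A)"
proof -
  have fin: "finite A" using assms finite_verts finite_subset by blast
  have "A = (\<Union>C\<in>class_of ` A. {v \<in> A. class_of v = C})" by blast
  then have "card A \<le> (\<Sum>C\<in>class_of ` A. card {v \<in> A. class_of v = C})"
    using card_UN_le[of "class_of ` A" "\<lambda>C. {v \<in> A. class_of v = C}"] fin by simp
  also have "\<dots> \<le> (\<Sum>C\<in>class_of ` A. independence_number D)"
    using assms by (intro sum_mono card_same_class) auto
  finally show ?thesis by (simp add: mult.commute)
qed

lemma multipartite_class_of:
  assumes "independence_number D \<le> 2"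
  shows "multipartite (verts D) (\<lambda>u v. u \<rightarrow>\<^bsub>D\<^esub> v) class_of"
proof
  show "u = v \<or> v = w \<or> u = w"
    if "u \<in> verts D" "v \<in> verts D" "w \<in> verts D" "class_of u = class_of v" "class_of v = class_of w" for u v w
  proof (rule ccontr)
    assume "\<not> ?thesis"
    then have "card {u, v, w} = 3" by auto
    moreover have "card {u, v, w} \<le> independence_number D" using that by (intro card_same_class) auto
    ultimately show False using assms by simp
  qed
qed (auto simp: adjacent_iff_class_of)

end

theorem theorem3:
  fixes D :: "('a, 'b) pre_digraph" and color_classes :: "'a set set" and x y :: 'a
  assumes "semicomplete_multipartite_digraph D color_classes"
    and "k_strong 2 D"
    and "independence_number D \<le> 2"
    and "card (verts D) \<ge> 5 + 5 * independence_number D"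
    and "x \<in> verts D" and "y \<in> verts D" and "x \<noteq> y"
    and "\<not> in_2_cycle D x" and "\<not> in_2_cycle D y"
    and "\<not> x \<rightarrow>\<^bsub>D\<^esub> y"
    and "k_strong 2 (delete_verts D {x})" and "k_strong 2 (delete_verts D {y})"
    and "\<forall>X. two_separator D x y X \<longrightarrow> trivial_two_separator D x y X"
  shows "\<exists>p. semicomplete_multipartite_digraph.quasi_hamiltonian_path D color_classes x p y"
proof -
  interpret semicomplete_multipartite_digraph D color_classes by fact
  interpret multipartite "verts D" "\<lambda>u v. u \<rightarrow>\<^bsub>D\<^esub> v" class_of
    using assms(3) by (rule multipartite_class_of)
  interpret separated_pair "verts D" "\<lambda>u v. u \<rightarrow>\<^bsub>D\<^esub> v" class_of x y
  proof
    note strong = k_strong_reach[OF wf_digraph_axioms assms(11)] k_strong_reach[OF wf_digraph_axioms assms(12)]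
    show "reach (\<lambda>u v. u \<rightarrow>\<^bsub>D\<^esub> v) (verts D - {x} - {z}) u v"
      if "z \<in> verts D - {x}" "u \<in> verts D - {x} - {z}" "v \<in> verts D - {x} - {z}" for z u v
      by (rule strong(1)) (use that in auto)
    show "reach (\<lambda>u v. u \<rightarrow>\<^bsub>D\<^esub> v) (verts D - {y} - {z}) u v"
      if "z \<in> verts D - {y}" "u \<in> verts D - {y} - {z}" "v \<in> verts D - {y} - {z}" for z u v
      by (rule strong(2)) (use that in auto)
    show "reach (\<lambda>u v. u \<rightarrow>\<^bsub>D\<^esub> v) (verts D - {x}) u v" if "u \<in> verts D - {x}" "v \<in> verts D - {x}" for u v
      using strong(1)[of "{}" u v] that by simp
    show "reach (\<lambda>u v. u \<rightarrow>\<^bsub>D\<^esub> v) (verts D - {y}) u v" if "u \<in> verts D - {y}" "v \<in> verts D - {y}" for u v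
      using strong(2)[of "{}" u v] that by simp
    show "{v \<in> verts D. x \<rightarrow>\<^bsub>D\<^esub> v} \<subseteq> X \<or> {v \<in> verts D. v \<rightarrow>\<^bsub>D\<^esub> y} \<subseteq> X"
      if "X \<subseteq> verts D - {x, y}" "card X \<le> 2" "\<not> reach (\<lambda>u v. u \<rightarrow>\<^bsub>D\<^esub> v) (verts D - X) x y" for X
    proof -
      have "trivial_two_separator D x y X"
        using assms(13) two_separatorI[OF wf_digraph_axioms that] by blast
      then show ?thesis by (auto simp: trivial_two_separator_def out_nbhd_def in_nbhd_def)
    qed
    show "4 \<le> card (verts D)" using assms(4) by linarith
  qed (use assms in auto)
  \<comment> \<open>The independence number takes the role of \<open>k\<close> in
    \<open>covering_path\<close>, where it has to be 1 or 2.\<close>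
  have "1 \<le> independence_number D"
    using card_same_class[of "{x}"] assms(5) by simp
  then obtain p where p: "ends p"
    using covering_path[OF card_le_classes _ assms(3,4)] by blast
  then have path: "p \<noteq> []" "distinct p" "set p \<subseteq> verts D" "successively (\<lambda>u v. u \<rightarrow>\<^bsub>D\<^esub> v) p"
    "hd p = x" "last p = y" "class_of ` set p = class_of ` verts D"
    by (auto simp: ends_def dipath_def)
  obtain es where es: "awalk x es y" "awalk_verts x es = p"
    using vertex_walk_awalk[OF path(1,3,4)] path(5,6) by auto
  have "\<exists>v\<in>C. v \<in> set p" if C: "C \<in> color_classes" for C
  proof -
    obtain v where v: "v \<in> C" using C partition_onD3[OF partition] by fastforce
    then have "v \<in> verts D" "class_of v = C"
      using C partition_onD1[OF partition] class_of_eq[OF C v] by auto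
    then obtain w where w: "w \<in> set p" "class_of w = C"
      using path(7) by (metis imageE imageI)
    then show ?thesis using class_of_in[of w] path(3) by auto
  qed
  then have "quasi_hamiltonian_path x es y"
    using es path(2) by (simp add: quasi_hamiltonian_path_def apath_def)
  then show ?thesis by blast
qed

end
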